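(* Let $p,q$ be positive integers and let $\alpha\in\mathcal W_+^{p\times p}$, $\beta\in\mathcal W_+^{p\times q}$, $\gamma\in\mathcal W_-^{q\times p}$, $\delta\in\mathcal W_-^{q\times q}$, with Fourier coefficients $a_j,b_j,c_j,d_j$ respectively. Let $b=[b_0\ b_1\ b_2\ \cdots]^\top:\mathbb C^q\to\ell^1_+(\mathbb C^p)$ and $c=[\cdots\ c_{-2}\ c_{-1}\ c_0]^\top:\mathbb C^p\to\ell^1_-(\mathbb C^q)$ be the associated linear maps. Assume that both matrices $a_0$ and $d_0$ are invertible. Let $$M_{11}=T_{+,\alpha}\Delta_{a_0^{-1}}T_{+,\alpha}^*-S_{+,p}T_{+,\beta}\Delta_{d_0^{-1}}T_{+,\beta}^*S_{+,p}^*\ \text{ on } \ell^2_+(\mathbb C^p),$$ $$M_{22}=T_{-,\delta}\Delta_{d_0^{-1}}T_{-,\delta}^*-S_{-,q}T_{-,\gamma}\Delta_{a_0^{-1}}T_{-,\gamma}^*S_{-,q}^*\ \text{ on } \ell^2_-(\mathbb C^q).$$ Then the twofold EG inverse problem associated with the data set $\{\alpha,\beta,\gamma,\delta\}$ has a solution if and only if the following two conditions are satisfied: (D1) $\alpha^*\alpha-\gamma^*\gamma=a_0$, $\ \delta^*\delta-\beta^*\beta=d_0$, $\ \alpha^*\beta=\gamma^*\delta$ on $\mathbb T$ (with $a_0,d_0$ viewed as constant functions); (D2) the operators $M_{11}$ and $M_{22}$ are one-to-one. Furthermore, in that case $M_{11}$ and $M_{22}$ are invertible, the solution is unique, and the unique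 solution $g$ and its adjoint are given by $$g=-\mathcal F(M_{11}^{-1}b)\quad\text{and}\quad g^*=-\mathcal F(M_{22}^{-1}c).$$
   Context: Wiener spaces. $\mathcal W^{n\times m}$ is the set of $n\times m$ matrix functions on the unit circle $\mathbb T$ whose entries lie in the Wiener algebra, i.e. $\rho(\zeta)=\sum_{\nu\in\mathbb Z}\zeta^\nu r_\nu$ with $\sum_\nu\|r_\nu\|<\infty$; $r_\nu$ is the $\nu$-th Fourier coefficient. $\mathcal W_+^{n\times m}$ (resp. $\mathcal W_-^{n\times m}$) consists of those with $r_\nu=0$ for $\nu<0$ (resp. $\nu>0$); $\mathcal W_{+,0}^{n\times m}$ (resp. $\mathcal W_{-,0}^{n\times m}$) of those with $r_\nu=0$ for $\nu\le 0$ (resp. $\nu\geq 0$). Put $\rho^*(\zeta)=\rho(\zeta)^*$. $e_p,e_q$ denote the constant functions $I_p,I_q$. Twofold EG inverse problem. A solution associated with $\{\alpha,\beta,\gamma,\delta\}$ is a function $g\in\mathcal W_+^{p\times q}$ such that $\alpha+g\gamma-e_p\in\mathcal W_{-,0}^{p\times p}$, $\ g^*\alpha+\gamma\in\mathcal W_{+,0}^{q\times p}$, $\ \delta+g^*\beta-e_q\in\mathcal W_{+,0}^{q\times q}$, $\ g\delta+\beta\in\mathcal W_{-,0}^{p\times q}$. Sequence spaces and operators. For $r=1,2$, $\ell^r_+(\mathbb C^n)$ is the space of $r$-summable $\mathbb C^n$-valued sequences $(x_j)_{j\ge0}$ and $\ell^r_-(\mathbb C^n)$ that of $r$-summable sequences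 $(x_j)_{j\le0}$. For $\rho\in\mathcal W^{n\times m}$ with Fourier coefficients $r_\nu$: $T_{+,\rho}:\ell^2_+(\mathbb C^m)\to\ell^2_+(\mathbb C^n)$, $(T_{+,\rho}x)_i=\sum_{j\ge0}r_{i-j}x_j$ ($i\ge0$); $T_{-,\rho}:\ell^2_-(\mathbb C^m)\to\ell^2_-(\mathbb C^n)$, $(T_{-,\rho}x)_i=\sum_{j\le0}r_{i-j}x_j$ ($i\le0$). $\Delta_{r}$ is the diagonal operator applying the matrix $r$ to each entry. Shifts: $S_{+,n}(x_0,x_1,\dots)=(0,x_0,x_1,\dots)$ on $\ell^2_+(\mathbb C^n)$ and $S_{-,n}(\dots,x_{-1},x_0)=(\dots,x_{-1},x_0,0)$ on $\ell^2_-(\mathbb C^n)$. Here $^*$ on operators is the Hilbert space adjoint. Inverse Fourier transform. For a linear map $h=[h_0\ h_1\ \cdots]^\top:\mathbb C^m\to\ell^1_+(\mathbb C^n)$, $\mathcal Fh(\lambda)=\sum_{\nu\ge0}\lambda^\nu h_\nu$; for $k=[\cdots\ k_{-1}\ k_0]^\top:\mathbb C^m\to\ell^1_-(\mathbb C^n)$, $\mathcal Fk(\lambda)=\sum_{\nu\ge0}\lambda^{-\nu}k_{-\nu}$. The formulas for $g$ and $g^*$ include the assertion that $M_{11}^{-1}b$ maps $\mathbb C^q$ into $\ell^1_+(\mathbb C^p)$ and $M_{22}^{-1}c$ maps $\mathbb C^p$ into $\ell^1_-(\mathbb C^q)$. *)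

theory Defs
  imports "HOL-Analysis.Analysis"
begin

section \<open>Wiener spaces of matrix functions on the unit circle\<close>

text \<open>A matrix function on the unit circle is a total function \<open>complex \<Rightarrow> complex^'m^'n\<close> of which
  only the values on \<open>sphere 0 1\<close> matter; equality of two such functions is equality on
  \<open>sphere 0 1\<close>.  In the library an \<open>n \<times> m\<close> matrix has type \<open>complex^'m^'n\<close>.\<close>

definition adj_mat :: "complex^'m^'n \<Rightarrow> complex^'n^'m" where
  "adj_mat A = map_matrix cnj (transpose A)"

definition smult_mat :: "complex \<Rightarrow> complex^'m^'n \<Rightarrow> complex^'m^'n" where
  "smult_mat c A = map_matrix ((*) c) A"

definition fourier_coeff :: "(complex \<Rightarrow> complex^'m^'n) \<Rightarrow> int \<Rightarrow> complex^'m^'n" where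
  "fourier_coeff \<rho> \<nu> =
     (1 / (2 * pi)) *\<^sub>R integral {0..2 * pi} (\<lambda>t. smult_mat (cis (- (of_int \<nu> * t))) (\<rho> (cis t)))"

definition wiener :: "(complex \<Rightarrow> complex^'m^'n) set" where
  "wiener = {\<rho>. (\<lambda>\<nu>. norm (fourier_coeff \<rho> \<nu>)) summable_on UNIV \<and>
     (\<forall>\<zeta>\<in>sphere 0 1. ((\<lambda>\<nu>. smult_mat (\<zeta> powi \<nu>) (fourier_coeff \<rho> \<nu>)) has_sum \<rho> \<zeta>) UNIV)}"

definition wiener_supp :: "int set \<Rightarrow> (complex \<Rightarrow> complex^'m^'n) set" where
  "wiener_supp N = {\<rho> \<in> wiener. \<forall>\<nu>. \<nu> \<notin> N \<longrightarrow> fourier_coeff \<rho> \<nu> = 0}"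

abbreviation "wiener_plus \<equiv> wiener_supp {0..}"
abbreviation "wiener_minus \<equiv> wiener_supp {..0}"
abbreviation "wiener_plus0 \<equiv> wiener_supp {0<..}"
abbreviation "wiener_minus0 \<equiv> wiener_supp {..<0}"

definition twofold_EG_solution ::
  "(complex \<Rightarrow> complex^'p^'p) \<Rightarrow> (complex \<Rightarrow> complex^'q^'p) \<Rightarrow>
   (complex \<Rightarrow> complex^'p^'q) \<Rightarrow> (complex \<Rightarrow> complex^'q^'q) \<Rightarrow>
   (complex \<Rightarrow> complex^'q^'p) \<Rightarrow> bool" where
  "twofold_EG_solution \<alpha> \<beta> \<gamma> \<delta> g \<longleftrightarrow>
     g \<in> wiener_plus \<and>
     (\<lambda>\<zeta>. \<alpha> \<zeta> + g \<zeta> ** \<gamma> \<zeta> - mat 1) \<in> wiener_minus0 \<and>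
     (\<lambda>\<zeta>. adj_mat (g \<zeta>) ** \<alpha> \<zeta> + \<gamma> \<zeta>) \<in> wiener_plus0 \<and>
     (\<lambda>\<zeta>. \<delta> \<zeta> + adj_mat (g \<zeta>) ** \<beta> \<zeta> - mat 1) \<in> wiener_plus0 \<and>
     (\<lambda>\<zeta>. g \<zeta> ** \<delta> \<zeta> + \<beta> \<zeta>) \<in> wiener_minus0"

section \<open>Sequence spaces and operators\<close>

text \<open>Sequences indexed by \<open>J\<close>, where \<open>J = {0..}\<close> for the subscript \<open>+\<close> and \<open>J = {..0}\<close> for the
  subscript \<open>-\<close>, are functions on \<open>int\<close> that vanish outside \<open>J\<close>.\<close>

type_synonym 'n seq = "int \<Rightarrow> complex^'n"

definition lspace :: "nat \<Rightarrow> int set \<Rightarrow> ('n::finite) seq set" where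
  "lspace r J = {x. (\<forall>j. j \<notin> J \<longrightarrow> x j = 0) \<and> (\<lambda>j. norm (x j) ^ r) summable_on J}"

definition l2_inner :: "('n::finite) seq \<Rightarrow> 'n seq \<Rightarrow> complex" where
  "l2_inner x y = (\<Sum>\<^sub>\<infinity>j. \<Sum>k\<in>UNIV. x j $ k * cnj (y j $ k))"

definition l2_adjoint :: "int set \<Rightarrow> (('m::finite) seq \<Rightarrow> ('n::finite) seq) \<Rightarrow> 'n seq \<Rightarrow> 'm seq" where
  "l2_adjoint J T y =
     (THE z. z \<in> lspace 2 J \<and> (\<forall>x\<in>lspace 2 J. l2_inner (T x) y = l2_inner x z))"

definition l2_bounded_op :: "int set \<Rightarrow> (('m::finite) seq \<Rightarrow> ('n::finite) seq) \<Rightarrow> bool" where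
  "l2_bounded_op J T \<longleftrightarrow>
     (\<forall>x\<in>lspace 2 J. T x \<in> lspace 2 J) \<and>
     (\<forall>x\<in>lspace 2 J. \<forall>y\<in>lspace 2 J. T (\<lambda>j. x j + y j) = (\<lambda>j. T x j + T y j)) \<and>
     (\<forall>c. \<forall>x\<in>lspace 2 J. T (\<lambda>j. c *s x j) = (\<lambda>j. c *s T x j)) \<and>
     (\<exists>K. \<forall>x\<in>lspace 2 J.
        sqrt (\<Sum>\<^sub>\<infinity>j\<in>J. norm (T x j) ^ 2) \<le> K * sqrt (\<Sum>\<^sub>\<infinity>j\<in>J. norm (x j) ^ 2))"

definition l2_invertible :: "int set \<Rightarrow> (('n::finite) seq \<Rightarrow> 'n seq) \<Rightarrow> bool" where
  "l2_invertible J M \<longleftrightarrow> l2_bounded_op J M \<and>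
     (\<exists>N. l2_bounded_op J N \<and> (\<forall>x\<in>lspace 2 J. N (M x) = x \<and> M (N x) = x))"

definition l2_inverse :: "int set \<Rightarrow> (('n::finite) seq \<Rightarrow> 'n seq) \<Rightarrow> 'n seq \<Rightarrow> 'n seq" where
  "l2_inverse J M = inv_into (lspace 2 J) M"

definition toeplitz :: "int set \<Rightarrow> (complex \<Rightarrow> complex^'m^'n) \<Rightarrow> ('m::finite) seq \<Rightarrow> ('n::finite) seq" where
  "toeplitz J \<rho> x = (\<lambda>i. if i \<in> J then \<Sum>\<^sub>\<infinity>j\<in>J. fourier_coeff \<rho> (i - j) *v x j else 0)"

definition diag_op :: "complex^'m^'n \<Rightarrow> ('m::finite) seq \<Rightarrow> ('n::finite) seq" where
  "diag_op r x = (\<lambda>j. r *v x j)"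

definition shift_plus :: "('n::finite) seq \<Rightarrow> 'n seq" where
  "shift_plus x = (\<lambda>j. x (j - 1))"

definition shift_minus :: "('n::finite) seq \<Rightarrow> 'n seq" where
  "shift_minus x = (\<lambda>j. x (j + 1))"

definition M11 ::
  "(complex \<Rightarrow> complex^'p^'p) \<Rightarrow> (complex \<Rightarrow> complex^'q^'p) \<Rightarrow> (complex \<Rightarrow> complex^'q^'q) \<Rightarrow>
   ('p::finite) seq \<Rightarrow> 'p seq" where
  "M11 \<alpha> \<beta> \<delta> x = (\<lambda>i.
     toeplitz {0..} \<alpha> (diag_op (matrix_inv (fourier_coeff \<alpha> 0))
       (l2_adjoint {0..} (toeplitz {0..} \<alpha>) x)) i
     - shift_plus (toeplitz {0..} \<beta> (diag_op (matrix_inv (fourier_coeff \<delta> 0))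
         (l2_adjoint {0..} (toeplitz {0..} \<beta>) (l2_adjoint {0..} shift_plus x)))) i)"

definition M22 ::
  "(complex \<Rightarrow> complex^'p^'p) \<Rightarrow> (complex \<Rightarrow> complex^'p^'q) \<Rightarrow> (complex \<Rightarrow> complex^'q^'q) \<Rightarrow>
   ('q::finite) seq \<Rightarrow> 'q seq" where
  "M22 \<alpha> \<gamma> \<delta> x = (\<lambda>i.
     toeplitz {..0} \<delta> (diag_op (matrix_inv (fourier_coeff \<delta> 0))
       (l2_adjoint {..0} (toeplitz {..0} \<delta>) x)) i
     - shift_minus (toeplitz {..0} \<gamma> (diag_op (matrix_inv (fourier_coeff \<alpha> 0))
         (l2_adjoint {..0} (toeplitz {..0} \<gamma>) (l2_adjoint {..0} shift_minus x)))) i)"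

text \<open>The column of Fourier coefficients of \<open>\<rho>\<close> with indices in \<open>J\<close>, as a linear map into sequences.\<close>

definition coeff_column :: "int set \<Rightarrow> (complex \<Rightarrow> complex^'m^'n) \<Rightarrow> complex^'m \<Rightarrow> ('n::finite) seq" where
  "coeff_column J \<rho> v = (\<lambda>j. if j \<in> J then fourier_coeff \<rho> j *v v else 0)"

text \<open>The inverse Fourier transform of a linear map \<open>h\<close> into sequences, whose \<open>\<nu>\<close>-th entry is the
  matrix of \<open>v \<mapsto> h v \<nu>\<close>.  For \<open>J = {..0}\<close> the summation index is \<open>-\<nu>\<close> with \<open>\<nu> \<ge> 0\<close>.\<close>

definition inv_fourier :: "int set \<Rightarrow> (complex^'m \<Rightarrow> ('n::finite) seq) \<Rightarrow> complex \<Rightarrow> complex^'m^'n" where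
  "inv_fourier J h \<zeta> = (\<Sum>\<^sub>\<infinity>\<nu>\<in>J. smult_mat (\<zeta> powi \<nu>) (matrix (\<lambda>v. h v \<nu>)))"

end

theory Submission
  imports Defs
begin

text \<open>
  Put \<open>\<Phi> = [\<alpha> \<beta>; \<gamma> \<delta>]\<close>, \<open>J = diag (I, -I)\<close>, \<open>D = diag (a\<^sub>0, -d\<^sub>0)\<close> and \<open>\<Psi> = [I g; g\<^sup>* I]\<close>.  Condition (D1) reads
  \<open>\<Phi>\<^sup>* J \<Phi> = D\<close>, and \<open>g\<close> is a solution iff the first block row of \<open>\<Psi> \<Phi> - I\<close> is strictly anti-analytic
  and the second one strictly analytic.  Under (D1), let \<open>E = \<Phi> Q D\<^sup>-\<^sup>1 \<Phi>\<^sup>*\<close> where \<open>Q\<close> projects onto the indices \<open>\<ge> 0\<close> in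
  the first and \<open>> 0\<close> in the second component.  Then \<open>E J E = E\<close>, \<open>E J S\<^sup>-\<^sup>1 E = E S\<^sup>-\<^sup>1\<close> for the bilateral shift \<open>S\<close>, and
  \<open>E + diag (0, I)\<close> is the zero extension of a block operator \<open>M\<close> with diagonal blocks \<open>M11\<close> and \<open>M22\<close>.  For a
  solution \<open>g\<close> with Hankel operator \<open>G\<close>, the operator \<open>[I G; G\<^sup>* I]\<close> is the inverse of \<open>M\<close>, whence
  \<open>M11\<^sup>-\<^sup>1 = I - G G\<^sup>*\<close> and \<open>M11\<^sup>-\<^sup>1 b = - G e\<close>.  Conversely, \<open>I - M11\<close> can be approximated by finite rank matrices in
  the \<open>\<ell>\<^sup>1\<close> operator norm, so injectivity of \<open>M11\<close> on \<open>\<ell>\<^sup>2\<close> yields \<open>g\<close> with absolutely summable coefficients from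
  \<open>M11 x = - b\<close>, and the shift identity together with the injectivity of \<open>M22\<close> shows that its Hankel operator \<open>G\<close>
  satisfies \<open>M11 G = - M12\<close>.

  All operators live in one ring: infinite matrices with bounded row and column sums, indexed by
  \<open>\<int> \<times> ({1..p} + {1..q})\<close>, which act on \<open>\<ell>\<^sup>1\<close> and \<open>\<ell>\<^sup>2\<close> alike.
\<close>

text \<open>By (D1) the inverse of \<Phi> is \<open>D' * adj \<Phi> * J\<close>, and Q commutes with
  \<open>D'\<close>; so \<open>E * J\<close> is the conjugate of Q by \<Phi>, an oblique projection,
  and its two identities mirror \<open>Q Q = Q\<close> and
  \<open>Q S\<^sup>-\<^sup>1 Q = Q S\<^sup>-\<^sup>1\<close>. The analyticity of the rows of \<Phi>
  confines the first block row of E to indices >= 0 and the second block row of J - E to indices <=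
  0; this is how half-line operators arise. Neither a_0 nor d_0 is assumed definite, so
  invertibility cannot come from positivity and the converse rests on a Fredholm alternative. Its
  obstacle is structural: \<open>M11 G = - M12\<close> could be solved column by column, but nothing
  makes such columns fit together to a Hankel matrix. Hence only the column at index 0 is solved
  for; it prescribes the coefficients of g, and the equation is then derived for the other columns.
  A vector is a matrix with one nonzero column, absolutely and hence square-summable by membership
  in the ring, so injectivity on square-summable sequences applies to it.\<close>

no_notation Infinite_Set_Sum.abs_summable_on (infix "abs'_summable'_on" 50)

section \<open>Infinite matrices with bounded row and column sums\<close>

text \<open>Finite partial sums state summability of all rows and a uniform bound at once.\<close>

definition row_bounded :: "real \<Rightarrow> ('i \<Rightarrow> 'j \<Rightarrow> complex) \<Rightarrow> bool" where
  "row_bounded C A \<longleftrightarrow> (\<forall>i F. finite F \<longrightarrow> (\<Sum>j\<in>F. norm (A i j)) \<le> C)"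

lemma row_boundedD: "row_bounded C A \<Longrightarrow> finite F \<Longrightarrow> (\<Sum>j\<in>F. norm (A i j)) \<le> C"
  unfolding row_bounded_def by blast

lemma row_bounded_nonneg: "row_bounded C A \<Longrightarrow> 0 \<le> C"
  using row_boundedD[of C A "{}"] by simp

lemma row_bounded_entry: "row_bounded C A \<Longrightarrow> norm (A i j) \<le> C"
  using row_boundedD[of C A "{j}" i] by simp

lemma row_bounded_summable:
  assumes "row_bounded C A" shows "(\<lambda>j. norm (A i j)) summable_on UNIV"
  by (rule nonneg_bdd_above_summable_on) (auto intro!: bdd_aboveI[of _ C] row_boundedD[OF assms])

lemma row_bounded_infsum:
  assumes "row_bounded C A" shows "(\<Sum>\<^sub>\<infinity>j. norm (A i j)) \<le> C"
  by (rule infsum_le_finite_sums) (auto intro: row_bounded_summable[OF assms] row_boundedD[OF assms])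

text \<open>Every finite set of pairs lies in a finite rectangle. This is the Fubini criterion
  behind the interchanges of two infinite sums below.\<close>

lemma abs_summable_prodI:
  fixes f :: "'i \<Rightarrow> 'j \<Rightarrow> 'a::real_normed_vector"
  assumes "\<And>F G. finite F \<Longrightarrow> finite G \<Longrightarrow> (\<Sum>i\<in>F. \<Sum>j\<in>G. norm (f i j)) \<le> C"
  shows "(\<lambda>(i,j). f i j) abs_summable_on UNIV"
proof (rule nonneg_bdd_above_summable_on)
  show "bdd_above (sum (\<lambda>x. norm (case x of (i,j) \<Rightarrow> f i j)) ` {F. F \<subseteq> UNIV \<and> finite F})"
  proof (rule bdd_aboveI[of _ C], clarify)
    fix F :: "('i \<times> 'j) set" assume F: "finite F"
    have "sum (\<lambda>x. norm (case x of (i,j) \<Rightarrow> f i j)) F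
      \<le> sum (\<lambda>x. norm (case x of (i,j) \<Rightarrow> f i j)) (fst ` F \<times> snd ` F)"
      by (rule sum_mono2) (use F in \<open>auto intro: rev_image_eqI\<close>)
    also have "\<dots> = (\<Sum>i\<in>fst ` F. \<Sum>j\<in>snd ` F. norm (f i j))"
      by (simp add: sum.cartesian_product split_def)
    also have "\<dots> \<le> C" using assms F by simp
    finally show "sum (\<lambda>x. norm (case x of (i,j) \<Rightarrow> f i j)) F \<le> C" .
  qed
qed simp

definition mprod :: "('i \<Rightarrow> 'j \<Rightarrow> complex) \<Rightarrow> ('j \<Rightarrow> 'k \<Rightarrow> complex) \<Rightarrow> 'i \<Rightarrow> 'k \<Rightarrow> complex" where
  "mprod A B = (\<lambda>i k. \<Sum>\<^sub>\<infinity>j. A i j * B j k)"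

lemma infsum_single:
  fixes f :: "'i \<Rightarrow> 'a::{comm_monoid_add,t2_space}"
  assumes "\<And>j. j \<noteq> i \<Longrightarrow> f j = 0" shows "(\<Sum>\<^sub>\<infinity>j. f j) = f i"
proof -
  have "(\<Sum>\<^sub>\<infinity>j. f j) = infsum f {i}" by (rule infsum_cong_neutral) (use assms in auto)
  then show ?thesis by simp
qed

lemma infsum_sum:
  fixes f :: "'k \<Rightarrow> 'i \<Rightarrow> 'a::{topological_comm_monoid_add,t2_space}"
  assumes "\<And>k. k \<in> F \<Longrightarrow> f k summable_on A"
  shows "(\<lambda>j. \<Sum>k\<in>F. f k j) summable_on A"
    and "(\<Sum>\<^sub>\<infinity>j\<in>A. \<Sum>k\<in>F. f k j) = (\<Sum>k\<in>F. \<Sum>\<^sub>\<infinity>j\<in>A. f k j)"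
  using assms by (induction F rule: infinite_finite_induct) (auto simp: infsum_add intro: summable_on_add)

lemma mprod_abs_summable:
  assumes "row_bounded C A" "\<And>j. norm (v j) \<le> D"
  shows "(\<lambda>j. A i j * v j) abs_summable_on UNIV"
proof (rule Infinite_Sum.abs_summable_on_comparison_test')
  show "(\<lambda>j. norm (A i j) * D) summable_on UNIV"
    using row_bounded_summable[OF assms(1)] by (rule summable_on_cmult_left)
  show "norm (A i j * v j) \<le> norm (A i j) * D" for j
    by (auto simp: norm_mult intro!: mult_left_mono assms(2))
qed

lemma norm_mprod_le:
  assumes "row_bounded C A" "\<And>j. norm (v j) \<le> D"
  shows "norm (\<Sum>\<^sub>\<infinity>j. A i j * v j) \<le> C * D"
proof -
  have D: "0 \<le> D" using assms(2) norm_ge_zero order_trans by blast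
  have "norm (\<Sum>\<^sub>\<infinity>j. A i j * v j) \<le> (\<Sum>\<^sub>\<infinity>j. norm (A i j * v j))"
    by (rule norm_infsum_bound) (rule mprod_abs_summable[OF assms])
  also have "\<dots> \<le> (\<Sum>\<^sub>\<infinity>j. norm (A i j) * D)"
    by (rule infsum_mono) (use mprod_abs_summable[OF assms] row_bounded_summable[OF assms(1)] assms(2) in
      \<open>auto simp: norm_mult intro!: mult_left_mono summable_on_cmult_left\<close>)
  also have "\<dots> = (\<Sum>\<^sub>\<infinity>j. norm (A i j)) * D"
    by (rule infsum_cmult_left) (use row_bounded_summable[OF assms(1)] in auto)
  also have "\<dots> \<le> C * D" using row_bounded_infsum[OF assms(1)] D by (intro mult_right_mono)
  finally show ?thesis .
qed

text \<open>Duality: multiplying the entries of the product by unimodular phases \<open>s\<close>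
  turns the sum of their norms into one value of A on the vector \<open>v\<close>, whose entries are
  bounded by D because the rows of B are.\<close>

lemma row_bounded_mprod:
  fixes B :: "'j \<Rightarrow> 'k \<Rightarrow> complex"
  assumes A: "row_bounded C A" and B: "row_bounded D B"
  shows "row_bounded (C * D) (mprod A B)"
  unfolding row_bounded_def
proof (intro allI impI)
  fix i and F :: "'k set" assume F: "finite F"
  have ex: "\<exists>s. norm s = 1 \<and> complex_of_real (norm z) = s * z" for z
    by (cases "z = 0", rule exI[of _ 1], simp, rule exI[of _ "cnj z / of_real (norm z)"])
       (simp add: norm_divide power2_eq_square complex_norm_square[symmetric] field_simps)
  obtain s where s: "\<And>z. norm (s z) = 1" "\<And>z. complex_of_real (norm z) = s z * z"
    using ex by metis
  let ?s = "\<lambda>k. s (mprod A B i k)"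
  define v where "v j = (\<Sum>k\<in>F. ?s k * B j k)" for j
  have v: "norm (v j) \<le> D" for j
  proof -
    have "norm (v j) \<le> (\<Sum>k\<in>F. norm (?s k * B j k))" unfolding v_def by (rule norm_sum)
    also have "\<dots> \<le> D" using row_boundedD[OF B F] by (simp add: norm_mult s)
    finally show ?thesis .
  qed
  have "complex_of_real (\<Sum>k\<in>F. norm (mprod A B i k)) = (\<Sum>k\<in>F. ?s k * mprod A B i k)"
    by (simp add: s(2))
  also have "\<dots> = (\<Sum>k\<in>F. \<Sum>\<^sub>\<infinity>j. ?s k * (A i j * B j k))"
    by (simp add: mprod_def infsum_cmult_right')
  also have "\<dots> = (\<Sum>\<^sub>\<infinity>j. \<Sum>k\<in>F. ?s k * (A i j * B j k))"
    by (rule infsum_sum(2)[symmetric], rule summable_on_cmult_right, rule abs_summable_summable,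
        rule mprod_abs_summable[OF A row_bounded_entry[OF B]])
  also have "\<dots> = (\<Sum>\<^sub>\<infinity>j. A i j * v j)"
    by (simp add: v_def sum_distrib_left algebra_simps)
  finally have "(\<Sum>k\<in>F. norm (mprod A B i k)) = norm (\<Sum>\<^sub>\<infinity>j. A i j * v j)"
    by (metis abs_of_nonneg norm_of_real sum_nonneg norm_ge_zero)
  also have "\<dots> \<le> C * D" by (rule norm_mprod_le[OF A v])
  finally show "(\<Sum>k\<in>F. norm (mprod A B i k)) \<le> C * D" .
qed

text \<open>The triple products are absolutely summable with total at most
  \<open>C * (D * K)\<close>: the rows of A and B are summed, while V contributes a bound on its
  entries.\<close>

lemma mprod_assoc:
  assumes A: "row_bounded C A" and B: "row_bounded D B" and v: "row_bounded K V"
  shows "mprod (mprod A B) V = mprod A (mprod B V)"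
proof (intro ext)
  fix i l
  have sm: "(\<lambda>(j,k). A i j * B j k * V k l) abs_summable_on UNIV"
  proof (rule abs_summable_prodI[where C = "C * (D * K)"])
    fix F :: "'b set" and G :: "'c set" assume FG: "finite F" "finite G"
    have "(\<Sum>j\<in>F. \<Sum>k\<in>G. norm (A i j * B j k * V k l)) \<le> (\<Sum>j\<in>F. norm (A i j) * (\<Sum>k\<in>G. norm (B j k) * K))"
      by (auto simp: norm_mult sum_distrib_left mult.assoc intro!: sum_mono mult_left_mono row_bounded_entry[OF v])
    also have "\<dots> \<le> (\<Sum>j\<in>F. norm (A i j) * (D * K))"
      by (intro sum_mono mult_left_mono norm_ge_zero)
         (simp add: sum_distrib_right[symmetric] mult_right_mono row_boundedD[OF B FG(2)] row_bounded_nonneg[OF v])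
    also have "\<dots> = (\<Sum>j\<in>F. norm (A i j)) * (D * K)" by (rule sum_distrib_right[symmetric])
    also have "\<dots> \<le> C * (D * K)"
      by (intro mult_right_mono row_boundedD[OF A FG(1)] mult_nonneg_nonneg row_bounded_nonneg[OF B] row_bounded_nonneg[OF v])
    finally show "(\<Sum>j\<in>F. \<Sum>k\<in>G. norm (A i j * B j k * V k l)) \<le> C * (D * K)" .
  qed
  have "mprod (mprod A B) V i l = (\<Sum>\<^sub>\<infinity>k. \<Sum>\<^sub>\<infinity>j. A i j * B j k * V k l)"
    by (simp add: mprod_def infsum_cmult_left'[symmetric])
  also have "\<dots> = (\<Sum>\<^sub>\<infinity>j. \<Sum>\<^sub>\<infinity>k. A i j * B j k * V k l)"
    using infsum_swap_banach[of "\<lambda>j k. A i j * B j k * V k l" UNIV UNIV] abs_summable_summable[OF sm] by simp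
  also have "\<dots> = mprod A (mprod B V) i l"
    by (simp add: mprod_def infsum_cmult_right'[symmetric] mult.assoc)
  finally show "mprod (mprod A B) V i l = mprod A (mprod B V) i l" .
qed

lemma mprod_transpose: "(\<lambda>i j. mprod A B j i) = mprod (\<lambda>i j. B j i) (\<lambda>i j. A j i)"
  by (auto simp: mprod_def mult.commute)

lemma row_bounded_add:
  assumes "row_bounded C A" "row_bounded D B" shows "row_bounded (C + D) (\<lambda>i j. A i j + B i j)"
  unfolding row_bounded_def
proof (intro allI impI)
  fix i and F :: "'b set" assume F: "finite F"
  have "(\<Sum>j\<in>F. norm (A i j + B i j)) \<le> (\<Sum>j\<in>F. norm (A i j) + norm (B i j))"
    by (intro sum_mono norm_triangle_ineq)
  also have "\<dots> \<le> C + D"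
    using row_boundedD[OF assms(1) F, of i] row_boundedD[OF assms(2) F, of i] by (simp add: sum.distrib)
  finally show "(\<Sum>j\<in>F. norm (A i j + B i j)) \<le> C + D" .
qed

lemma row_bounded_cmult:
  assumes "row_bounded C A" shows "row_bounded (norm c * C) (\<lambda>i j. c * A i j)"
  using assms by (auto simp: row_bounded_def norm_mult sum_distrib_left[symmetric] intro: mult_left_mono)

lemma row_bounded_mono:
  assumes "row_bounded C A" "\<And>i j. norm (B i j) \<le> norm (A i j)" "C \<le> D"
  shows "row_bounded D B"
  unfolding row_bounded_def
proof (intro allI impI)
  fix i and F :: "'b set" assume F: "finite F"
  have "(\<Sum>j\<in>F. norm (B i j)) \<le> (\<Sum>j\<in>F. norm (A i j))" by (intro sum_mono assms(2))
  then show "(\<Sum>j\<in>F. norm (B i j)) \<le> D" using row_boundedD[OF assms(1) F, of i] assms(3) by simp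
qed

lemma sum_delta_le: "finite F \<Longrightarrow> (\<Sum>j\<in>F. norm (if j = a then c else (0::complex))) \<le> norm c"
  by (simp add: if_distrib cong: if_cong)

lemma row_bounded_diag: "(\<And>i. norm (c i) \<le> C) \<Longrightarrow> row_bounded C (\<lambda>i j. if j = f i then c i else 0)"
  unfolding row_bounded_def by (intro allI impI order_trans[OF sum_delta_le])

text \<open>Row sums control the action on bounded vectors, column sums that on absolutely summable
  ones, both together that on square-summable ones. A single constant serves both, so adjoints keep
  the bound.\<close>

definition mbounded :: "real \<Rightarrow> ('i \<Rightarrow> 'j \<Rightarrow> complex) \<Rightarrow> bool" where
  "mbounded C A \<longleftrightarrow> row_bounded C A \<and> row_bounded C (\<lambda>i j. A j i)"

lemma mbounded_mprod: "mbounded C A \<Longrightarrow> mbounded D B \<Longrightarrow> mbounded (C * D) (mprod A B)"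
  unfolding mbounded_def
  by (simp add: mprod_transpose row_bounded_mprod) (metis mult.commute row_bounded_mprod)

lemma mbounded_add: "mbounded C A \<Longrightarrow> mbounded D B \<Longrightarrow> mbounded (C + D) (\<lambda>i j. A i j + B i j)"
  unfolding mbounded_def by (simp add: row_bounded_add)

lemma mbounded_cmult: "mbounded C A \<Longrightarrow> mbounded (norm c * C) (\<lambda>i j. c * A i j)"
  unfolding mbounded_def by (simp add: row_bounded_cmult)

lemma mbounded_mono:
  "mbounded C A \<Longrightarrow> (\<And>i j. norm (B i j) \<le> norm (A i j)) \<Longrightarrow> C \<le> D \<Longrightarrow> mbounded D B"
  unfolding mbounded_def by (metis (no_types, lifting) row_bounded_mono)

lemma mbounded_id: "mbounded 1 (\<lambda>i j. if i = j then 1 else 0)"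
proof -
  have "row_bounded 1 (\<lambda>i j::'a. if j = id i then 1 else 0)" by (rule row_bounded_diag) simp
  moreover have "(\<lambda>i j::'a. if j = id i then 1 else 0) = (\<lambda>i j. if i = j then 1 else (0::complex))"
    and "(\<lambda>i j::'a. if j = id i then 1 else 0) = (\<lambda>i j. if j = i then 1 else (0::complex))"
    by (auto intro!: ext)
  ultimately show ?thesis unfolding mbounded_def by metis
qed

section \<open>Ring structure, adjoints and coordinate projections\<close>

typedef 'i bmat = "{A :: 'i \<Rightarrow> 'i \<Rightarrow> complex. \<exists>C. mbounded C A}"
  morphisms ent Bmat
  by (rule exI[of _ "\<lambda>i j. if i = j then 1 else 0"]) (use mbounded_id in auto)

lemma bmat_eqI: "(\<And>i j. ent A i j = ent B i j) \<Longrightarrow> A = B"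
  using ent_inject by blast

lemma ent_Bmat: "mbounded C A \<Longrightarrow> ent (Bmat A) = A"
  by (rule Bmat_inverse) auto

text \<open>Some admissible bound, not necessarily the least one; it is taken positive so that one
  can divide by it, as in \<open>fredholm_A11\<close>.\<close>

definition bnd :: "'i bmat \<Rightarrow> real" where
  "bnd A = (SOME C. 0 < C \<and> mbounded C (ent A))"

lemma bnd: "0 < bnd A \<and> mbounded (bnd A) (ent A)"
proof -
  obtain C where C: "mbounded C (ent A)" using ent[of A] by auto
  then have "mbounded (max C 1) (ent A)" by (rule mbounded_mono) auto
  then have "\<exists>C. 0 < C \<and> mbounded C (ent A)" by (intro exI[of _ "max C 1"]) auto
  then show ?thesis unfolding bnd_def by (rule someI_ex)
qed

lemmas mbounded_ent = bnd[THEN conjunct2]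

text \<open>Real scalars are enough: they make the real linear algebra used in
  \<open>finite_rank_perturbation_surj\<close> available for ring elements.\<close>

instantiation bmat :: (type) real_algebra_1
begin

definition "0 = Bmat (\<lambda>i j. 0)"
definition "1 = Bmat (\<lambda>i j. if i = j then 1 else 0)"
definition "A + B = Bmat (\<lambda>i j. ent A i j + ent B i j)"
definition "- A = Bmat (\<lambda>i j. - ent A i j)" for A :: "'a bmat"
definition "A - B = Bmat (\<lambda>i j. ent A i j - ent B i j)"
definition "A * B = Bmat (mprod (ent A) (ent B))"
definition "r *\<^sub>R A = Bmat (\<lambda>i j. of_real r * ent A i j)" for A :: "'a bmat"

lemma ent_zero [simp]: "ent 0 i (j::'a) = 0"
proof -
  have "mbounded 0 (\<lambda>i j::'a. 0)" by (auto simp: mbounded_def row_bounded_def)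
  from ent_Bmat[OF this] show ?thesis by (simp add: zero_bmat_def)
qed

lemma ent_one: "ent 1 i (j::'a) = (if i = j then 1 else 0)"
  unfolding one_bmat_def by (subst ent_Bmat[OF mbounded_id]) simp

lemma ent_add [simp]: "ent (A + B) i (j::'a) = ent A i j + ent B i j"
  unfolding plus_bmat_def by (subst ent_Bmat[OF mbounded_add[OF mbounded_ent mbounded_ent]]) simp

lemma ent_uminus [simp]: "ent (- A) i (j::'a) = - ent A i j"
  using ent_Bmat[OF mbounded_cmult[OF mbounded_ent, of "-1" A]] by (simp add: uminus_bmat_def)

lemma ent_minus [simp]: "ent (A - B) i (j::'a) = ent A i j - ent B i j"
proof -
  have "ent (A + - B) i j = ent A i j - ent B i j" by simp
  moreover have "A + - B = A - B" by (simp only: plus_bmat_def minus_bmat_def ent_uminus) simp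
  ultimately show ?thesis by simp
qed

lemma ent_scaleR [simp]: "ent (r *\<^sub>R A) i (j::'a) = of_real r * ent A i j"
  using ent_Bmat[OF mbounded_cmult[OF mbounded_ent, of "of_real r" A]] by (simp add: scaleR_bmat_def)

lemma ent_mult: "ent (A * (B :: 'a bmat)) = mprod (ent A) (ent B)"
  using ent_Bmat[OF mbounded_mprod[OF mbounded_ent mbounded_ent, of A B]] by (simp add: times_bmat_def)

lemma ent_mult_summable: "(\<lambda>j::'a. ent A i j * ent B j k) summable_on UNIV"
  using mbounded_ent[of A] mbounded_ent[of B]
  by (intro abs_summable_summable[OF mprod_abs_summable] row_bounded_entry) (auto simp: mbounded_def)

instance
proof
  fix A B C :: "'a bmat" and r s :: real
  show "A * B * C = A * (B * C)"
  proof -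
    have "mprod (mprod (ent A) (ent B)) (ent C) = mprod (ent A) (mprod (ent B) (ent C))"
      using mbounded_ent[of A] mbounded_ent[of B] mbounded_ent[of C]
      by (intro mprod_assoc) (auto simp: mbounded_def)
    then show ?thesis by (intro bmat_eqI) (simp add: ent_mult)
  qed
  show "(A + B) * C = A * C + B * C" "A * (B + C) = A * B + A * C"
    by (auto intro!: bmat_eqI simp: ent_mult mprod_def algebra_simps infsum_add ent_mult_summable)
  show "1 * A = A" "A * 1 = A"
  proof -
    show "1 * A = A"
      by (intro bmat_eqI, simp only: ent_mult mprod_def, subst infsum_single[where i=x for x], auto simp: ent_one)
    show "A * 1 = A"
    proof (rule bmat_eqI)
      show "ent (A * 1) i j = ent A i j" for i j
        using infsum_single[of j "\<lambda>k. ent A i k * ent 1 k j"] by (simp add: ent_mult mprod_def ent_one)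
    qed
  qed
  have "ent (0::'a bmat) undefined undefined \<noteq> ent 1 undefined undefined" by (simp add: ent_one)
  then show "(0::'a bmat) \<noteq> 1" by metis
  show "r *\<^sub>R A * B = r *\<^sub>R (A * B)" "A * r *\<^sub>R B = r *\<^sub>R (A * B)"
    by (auto intro!: bmat_eqI simp: ent_mult mprod_def mult.assoc mult.left_commute infsum_cmult_right')
qed (auto intro!: bmat_eqI simp: algebra_simps)

end

definition adj :: "'i bmat \<Rightarrow> 'i bmat" where
  "adj A = Bmat (\<lambda>i j. cnj (ent A j i))"

lemma mbounded_adj: "mbounded C A \<Longrightarrow> mbounded C (\<lambda>i j. cnj (A j i))"
  by (simp add: mbounded_def row_bounded_def)

lemma ent_adj [simp]: "ent (adj A) i j = cnj (ent A j i)"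
  using ent_Bmat[OF mbounded_adj[OF mbounded_ent, of A]] by (simp add: adj_def)

lemma adj_adj [simp]: "adj (adj A) = A"
  by (rule bmat_eqI) simp

lemma adj_add: "adj (A + B) = adj A + adj B" and adj_minus: "adj (A - B) = adj A - adj B"
  and adj_uminus: "adj (- A) = - adj A" and adj_zero [simp]: "adj 0 = 0" and adj_one [simp]: "adj 1 = 1"
  by (auto intro!: bmat_eqI simp: ent_one)

lemma adj_mult: "adj (A * B) = adj B * adj A"
  by (rule bmat_eqI) (simp add: ent_mult mprod_def mult.commute flip: infsum_cnj)

text \<open>Truncation to a half line and selection of a block component are both multiplications by
  such diagonal idempotents, which keeps all operators in one ring.\<close>

definition pr :: "'i set \<Rightarrow> 'i bmat" where
  "pr S = Bmat (\<lambda>i j. if i = j \<and> i \<in> S then 1 else 0)"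

lemma ent_pr: "ent (pr S) i j = (if i = j \<and> i \<in> S then 1 else 0)"
proof -
  have "mbounded 1 (\<lambda>i j. if i = j \<and> i \<in> S then 1 else 0)"
    by (rule mbounded_mono[OF mbounded_id]) auto
  then show ?thesis by (simp add: pr_def ent_Bmat)
qed

lemma ent_mult_supp:
  assumes "\<And>j. j \<noteq> a \<Longrightarrow> ent A i j * ent B j k = 0"
  shows "ent (A * B) i k = ent A i a * ent B a k"
  using infsum_single[of a "\<lambda>j. ent A i j * ent B j k"] assms by (simp add: ent_mult mprod_def)

lemma ent_pr_mult [simp]: "ent (pr S * A) i k = (if i \<in> S then ent A i k else 0)"
  by (subst ent_mult_supp[where a = i]) (auto simp: ent_pr)

lemma ent_mult_pr [simp]: "ent (A * pr S) i k = (if k \<in> S then ent A i k else 0)"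
  by (subst ent_mult_supp[where a = k]) (auto simp: ent_pr)

lemma pr_mult_pr: "pr S * pr T = pr (S \<inter> T)"
  by (rule bmat_eqI) (auto simp: ent_pr)

lemma adj_pr [simp]: "adj (pr S) = pr S"
  by (rule bmat_eqI) (auto simp: ent_pr)

lemma pr_UNIV: "pr UNIV = 1"
  by (auto intro!: bmat_eqI simp: ent_pr ent_one)

section \<open>Action on square-summable vectors\<close>

text \<open>The action converges on all bounded vectors. Besides the square-summable ones these
  include the exponentials \<open>expv\<close>.\<close>

definition vbounded :: "('i \<Rightarrow> complex) \<Rightarrow> bool" where
  "vbounded v \<longleftrightarrow> (\<exists>D. \<forall>i. norm (v i) \<le> D)"

definition app :: "'i bmat \<Rightarrow> ('i \<Rightarrow> complex) \<Rightarrow> 'i \<Rightarrow> complex" where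
  "app A v = (\<lambda>i. \<Sum>\<^sub>\<infinity>j. ent A i j * v j)"

definition ell2 :: "('i \<Rightarrow> complex) \<Rightarrow> bool" where
  "ell2 v \<longleftrightarrow> (\<lambda>i. (norm (v i))\<^sup>2) summable_on UNIV"

definition inner2 :: "('i \<Rightarrow> complex) \<Rightarrow> ('i \<Rightarrow> complex) \<Rightarrow> complex" where
  "inner2 v w = (\<Sum>\<^sub>\<infinity>i. v i * cnj (w i))"

lemma bnd_row: "row_bounded (bnd A) (ent A)" and bnd_col: "row_bounded (bnd A) (\<lambda>i j. ent A j i)"
  and bnd_pos: "0 < bnd A"
  using bnd[of A] by (auto simp: mbounded_def)

lemma app_abs_summable: "vbounded v \<Longrightarrow> (\<lambda>j. ent A i j * v j) abs_summable_on UNIV"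
  unfolding vbounded_def by (elim exE, rule mprod_abs_summable[OF bnd_row], erule spec)

lemma app_summable: "vbounded v \<Longrightarrow> (\<lambda>j. ent A i j * v j) summable_on UNIV"
  by (rule abs_summable_summable[OF app_abs_summable])

lemma vbounded_app: "vbounded v \<Longrightarrow> vbounded (app A v)"
  unfolding vbounded_def app_def by (elim exE, intro exI allI, rule norm_mprod_le[OF bnd_row], erule spec)

text \<open>A bounded vector is a matrix whose columns are indexed by the type \<open>unit\<close>,
  so associativity of products applies to it.\<close>

lemma app_mult:
  assumes "vbounded v" shows "app (A * B) v = app A (app B v)"
proof -
  obtain D where D: "\<And>i. norm (v i) \<le> D" using assms unfolding vbounded_def by blast
  then have D0: "0 \<le> D" using norm_ge_zero order_trans by blast
  have "row_bounded D (\<lambda>j (u::unit). v j)"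
    unfolding row_bounded_def
  proof (intro allI impI)
    fix i and F :: "unit set"
    have "F = {} \<or> F = {()}" by auto
    then show "(\<Sum>j\<in>F. norm (v i)) \<le> D" using D D0 by auto
  qed
  from mprod_assoc[OF bnd_row bnd_row this, of A B]
  show ?thesis by (auto simp: app_def ent_mult mprod_def dest: fun_cong)
qed

lemma app_pr [simp]: "app (pr S) v = (\<lambda>i. if i \<in> S then v i else 0)"
proof
  show "app (pr S) v i = (if i \<in> S then v i else 0)" for i
    using infsum_single[of i "\<lambda>j. ent (pr S) i j * v j"] by (simp add: app_def ent_pr)
qed

lemma app_one [simp]: "app 1 v = v"
  using app_pr[of UNIV v] by (simp add: pr_UNIV)

lemma app_add: "vbounded v \<Longrightarrow> app (A + B) v = (\<lambda>i. app A v i + app B v i)"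
  by (auto simp: app_def distrib_right intro!: infsum_add app_summable)

lemma app_minus: "vbounded v \<Longrightarrow> app (A - B) v = (\<lambda>i. app A v i - app B v i)"
  using app_add[of v "A - B" B] by (auto simp: fun_eq_iff algebra_simps)

lemma app_uminus: "vbounded v \<Longrightarrow> app (- A) v = (\<lambda>i. - app A v i)"
  using app_minus[of v 0 A] app_minus[of v 0 0] by simp

lemma app_vadd: "vbounded v \<Longrightarrow> vbounded w \<Longrightarrow> app A (\<lambda>i. v i + w i) = (\<lambda>i. app A v i + app A w i)"
  by (auto simp: app_def distrib_left intro!: infsum_add app_summable)

lemma app_vcmult: "app A (\<lambda>i. c * v i) = (\<lambda>i. c * app A v i)"
  by (auto simp: app_def mult.left_commute infsum_cmult_right')

lemma ell2_vbounded:
  assumes "ell2 v" shows "vbounded v"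
  unfolding vbounded_def
proof (intro exI allI)
  fix i
  have "(norm (v i))\<^sup>2 \<le> (\<Sum>\<^sub>\<infinity>i. (norm (v i))\<^sup>2)"
    using finite_sum_le_infsum[of "\<lambda>i. (norm (v i))\<^sup>2" UNIV "{i}"] assms by (simp add: ell2_def)
  then show "norm (v i) \<le> sqrt (\<Sum>\<^sub>\<infinity>i. (norm (v i))\<^sup>2)" by (rule real_le_rsqrt)
qed

text \<open>Row half of the Schur test: Cauchy-Schwarz with the norm of each entry split into two
  square roots; one factor is a row sum, the other the weighted sum on the right.\<close>

lemma norm_app_sq_le:
  assumes "ell2 v"
  shows "(\<lambda>j. norm (ent A i j) * (norm (v j))\<^sup>2) summable_on UNIV"
    and "(norm (app A v i))\<^sup>2 \<le> bnd A * (\<Sum>\<^sub>\<infinity>j. norm (ent A i j) * (norm (v j))\<^sup>2)"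
proof -
  let ?R = "\<Sum>\<^sub>\<infinity>j. norm (ent A i j) * (norm (v j))\<^sup>2"
  have v: "vbounded v" using assms by (rule ell2_vbounded)
  show sm: "(\<lambda>j. norm (ent A i j) * (norm (v j))\<^sup>2) summable_on UNIV"
  proof (rule summable_on_comparison_test)
    show "(\<lambda>j. bnd A * (norm (v j))\<^sup>2) summable_on UNIV"
      using assms unfolding ell2_def by (rule summable_on_cmult_right)
  qed (auto intro!: mult_right_mono row_bounded_entry[OF bnd_row])
  have fin: "(\<Sum>j\<in>G. norm (ent A i j * v j)) \<le> sqrt (bnd A * ?R)" if G: "finite G" for G
  proof (rule real_le_rsqrt)
    have "(\<Sum>j\<in>G. norm (ent A i j * v j))\<^sup>2
      = (\<Sum>j\<in>G. sqrt (norm (ent A i j)) * (sqrt (norm (ent A i j)) * norm (v j)))\<^sup>2"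
      by (simp add: norm_mult mult.assoc[symmetric])
    also have "\<dots> \<le> (\<Sum>j\<in>G. (sqrt (norm (ent A i j)))\<^sup>2) * (\<Sum>j\<in>G. (sqrt (norm (ent A i j)) * norm (v j))\<^sup>2)"
      by (rule Cauchy_Schwarz_ineq_sum)
    also have "\<dots> = (\<Sum>j\<in>G. norm (ent A i j)) * (\<Sum>j\<in>G. norm (ent A i j) * (norm (v j))\<^sup>2)"
      by (simp add: power_mult_distrib)
    also have "\<dots> \<le> bnd A * ?R"
      by (intro mult_mono row_boundedD[OF bnd_row] G finite_sum_le_infsum sm)
         (auto intro: less_imp_le[OF bnd_pos] sum_nonneg)
    finally show "(\<Sum>j\<in>G. norm (ent A i j * v j))\<^sup>2 \<le> bnd A * ?R" .
  qed
  have "norm (app A v i) \<le> (\<Sum>\<^sub>\<infinity>j. norm (ent A i j * v j))"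
    unfolding app_def by (rule norm_infsum_bound) (rule app_abs_summable[OF v])
  also have "\<dots> \<le> sqrt (bnd A * ?R)"
    by (rule infsum_le_finite_sums) (use app_abs_summable[OF v] fin in auto)
  finally have "(norm (app A v i))\<^sup>2 \<le> (sqrt (bnd A * ?R))\<^sup>2" by (rule power_mono) simp
  also have "\<dots> = bnd A * ?R"
    by (intro real_sqrt_pow2 mult_nonneg_nonneg infsum_nonneg less_imp_le[OF bnd_pos]) auto
  finally show "(norm (app A v i))\<^sup>2 \<le> bnd A * ?R" .
qed

text \<open>Column half of the Schur test: after the sums are interchanged, the column sums supply
  the second factor \<open>bnd A\<close>.\<close>

lemma ell2_app:
  assumes "ell2 v"
  shows "ell2 (app A v)" and "(\<Sum>\<^sub>\<infinity>i. (norm (app A v i))\<^sup>2) \<le> (bnd A)\<^sup>2 * (\<Sum>\<^sub>\<infinity>i. (norm (v i))\<^sup>2)"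
proof -
  note sm = norm_app_sq_le(1)[OF assms, of A]
  have fin: "(\<Sum>i\<in>F. (norm (app A v i))\<^sup>2) \<le> (bnd A)\<^sup>2 * (\<Sum>\<^sub>\<infinity>i. (norm (v i))\<^sup>2)" if F: "finite F" for F
  proof -
    have "(\<Sum>i\<in>F. (norm (app A v i))\<^sup>2) \<le> (\<Sum>i\<in>F. bnd A * (\<Sum>\<^sub>\<infinity>j. norm (ent A i j) * (norm (v j))\<^sup>2))"
      by (intro sum_mono norm_app_sq_le(2) assms)
    also have "\<dots> = bnd A * (\<Sum>\<^sub>\<infinity>j. \<Sum>i\<in>F. norm (ent A i j) * (norm (v j))\<^sup>2)"
      by (simp add: infsum_sum(2)[OF sm] sum_distrib_left)
    also have "(\<Sum>\<^sub>\<infinity>j. \<Sum>i\<in>F. norm (ent A i j) * (norm (v j))\<^sup>2) \<le> (\<Sum>\<^sub>\<infinity>j. bnd A * (norm (v j))\<^sup>2)"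
    proof (rule infsum_mono)
      show "(\<lambda>j. bnd A * (norm (v j))\<^sup>2) summable_on UNIV"
        using assms unfolding ell2_def by (rule summable_on_cmult_right)
      show "(\<Sum>i\<in>F. norm (ent A i j) * (norm (v j))\<^sup>2) \<le> bnd A * (norm (v j))\<^sup>2" for j
        using row_boundedD[OF bnd_col F, of A j] by (simp add: sum_distrib_right[symmetric] mult_right_mono)
    qed (rule infsum_sum(1)[OF sm])
    also have "\<dots> = bnd A * (\<Sum>\<^sub>\<infinity>j. (norm (v j))\<^sup>2)" by (rule infsum_cmult_right')
    finally show ?thesis using bnd_pos[of A] by (simp add: power2_eq_square mult.assoc)
  qed
  show *: "ell2 (app A v)" unfolding ell2_def
    by (rule nonneg_bdd_above_summable_on)
       (auto intro!: bdd_aboveI[of _ "(bnd A)\<^sup>2 * (\<Sum>\<^sub>\<infinity>i. (norm (v i))\<^sup>2)"] fin)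
  show "(\<Sum>\<^sub>\<infinity>i. (norm (app A v i))\<^sup>2) \<le> (bnd A)\<^sup>2 * (\<Sum>\<^sub>\<infinity>i. (norm (v i))\<^sup>2)"
    by (rule infsum_le_finite_sums) (use * fin in \<open>auto simp: ell2_def\<close>)
qed

lemma ell2_add:
  assumes "ell2 v" "ell2 w" shows "ell2 (\<lambda>i. v i + w i)"
  unfolding ell2_def
proof (rule summable_on_comparison_test)
  show "(\<lambda>i. 2 * (norm (v i))\<^sup>2 + 2 * (norm (w i))\<^sup>2) summable_on UNIV"
    using assms by (auto simp: ell2_def intro!: summable_on_add summable_on_cmult_right)
  show "(norm (v i + w i))\<^sup>2 \<le> 2 * (norm (v i))\<^sup>2 + 2 * (norm (w i))\<^sup>2" for i
  proof -
    have "(norm (v i + w i))\<^sup>2 \<le> (norm (v i) + norm (w i))\<^sup>2"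
      by (intro power_mono norm_triangle_ineq) simp
    also have "\<dots> \<le> 2 * (norm (v i))\<^sup>2 + 2 * (norm (w i))\<^sup>2"
      using sum_squares_bound[of "norm (v i)" "norm (w i)"] by (simp add: power2_sum)
    finally show ?thesis .
  qed
qed simp

lemma ell2_cmult: "ell2 v \<Longrightarrow> ell2 (\<lambda>i. c * v i)"
  unfolding ell2_def by (simp add: norm_mult power_mult_distrib summable_on_cmult_right)

text \<open>Since the entries are bounded, their squares are dominated by a multiple of their norms.
  Hence injectivity on square-summable sequences can be tested on columns of ring elements.\<close>

lemma ell2_column: "ell2 (\<lambda>i. ent A i j)"
  unfolding ell2_def
proof (rule summable_on_comparison_test)
  show "(\<lambda>i. bnd A * norm (ent A i j)) summable_on UNIV"
    by (intro summable_on_cmult_right row_bounded_summable[OF bnd_col])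
  show "(norm (ent A i j))\<^sup>2 \<le> bnd A * norm (ent A i j)" for i
    using row_bounded_entry[OF bnd_col, of A j i]
    by (simp add: power2_eq_square mult_right_mono row_bounded_entry[OF bnd_row])
qed simp

lemma app_column: "app A (\<lambda>i. ent B i j) = (\<lambda>i. ent (A * B) i j)"
  by (simp add: app_def ent_mult mprod_def)

lemma inner2_summable:
  assumes "ell2 v" "ell2 w" shows "(\<lambda>i. v i * cnj (w i)) abs_summable_on UNIV"
proof (rule Infinite_Sum.abs_summable_on_comparison_test')
  show "(\<lambda>i. (norm (v i))\<^sup>2 + (norm (w i))\<^sup>2) summable_on UNIV"
    using assms by (auto simp: ell2_def intro!: summable_on_add)
  show "norm (v i * cnj (w i)) \<le> (norm (v i))\<^sup>2 + (norm (w i))\<^sup>2" for i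
    using sum_squares_bound[of "norm (v i)" "norm (w i)"] mult_nonneg_nonneg[OF norm_ge_zero norm_ge_zero, of "v i" "w i"]
    unfolding norm_mult complex_mod_cnj by linarith
qed

text \<open>The double series converges absolutely because a product of two norms is at most the sum
  of their squares; column sums bound one of the resulting parts, row sums the other.\<close>

lemma inner2_app:
  assumes "ell2 v" "ell2 w"
  shows "inner2 (app A v) w = inner2 v (app (adj A) w)"
proof -
  let ?f = "\<lambda>i j. ent A i j * v j * cnj (w i)"
  have fv: "(\<Sum>i\<in>F. (norm (v i))\<^sup>2) \<le> (\<Sum>\<^sub>\<infinity>i. (norm (v i))\<^sup>2)" if "finite F" "ell2 v" for F and v :: "'a \<Rightarrow> complex"
    using that by (intro finite_sum_le_infsum) (auto simp: ell2_def)
  have "(\<lambda>(i,j). ?f i j) abs_summable_on UNIV"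
  proof (rule abs_summable_prodI)
    fix F G :: "'a set" assume F: "finite F" and G: "finite G"
    have "(\<Sum>i\<in>F. \<Sum>j\<in>G. norm (?f i j))
      \<le> (\<Sum>i\<in>F. \<Sum>j\<in>G. norm (ent A i j) * (norm (v j))\<^sup>2 + norm (ent A i j) * (norm (w i))\<^sup>2)"
    proof (intro sum_mono)
      fix i j
      have "norm (v j) * norm (w i) \<le> (norm (v j))\<^sup>2 + (norm (w i))\<^sup>2"
        using sum_squares_bound[of "norm (v j)" "norm (w i)"]
          mult_nonneg_nonneg[OF norm_ge_zero norm_ge_zero, of "v j" "w i"] by linarith
      from mult_left_mono[OF this norm_ge_zero[of "ent A i j"]]
      show "norm (?f i j) \<le> norm (ent A i j) * (norm (v j))\<^sup>2 + norm (ent A i j) * (norm (w i))\<^sup>2"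
        by (simp add: norm_mult algebra_simps)
    qed
    also have "\<dots> = (\<Sum>j\<in>G. (\<Sum>i\<in>F. norm (ent A i j)) * (norm (v j))\<^sup>2)
        + (\<Sum>i\<in>F. (\<Sum>j\<in>G. norm (ent A i j)) * (norm (w i))\<^sup>2)"
      by (simp add: sum.distrib sum_distrib_right sum.swap[of _ G F])
    also have "\<dots> \<le> (\<Sum>j\<in>G. bnd A * (norm (v j))\<^sup>2) + (\<Sum>i\<in>F. bnd A * (norm (w i))\<^sup>2)"
      by (intro add_mono sum_mono mult_right_mono row_boundedD[OF bnd_row G] row_boundedD[OF bnd_col F]) auto
    also have "\<dots> \<le> bnd A * (\<Sum>\<^sub>\<infinity>i. (norm (v i))\<^sup>2) + bnd A * (\<Sum>\<^sub>\<infinity>i. (norm (w i))\<^sup>2)"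
      unfolding sum_distrib_left[symmetric]
      by (intro add_mono mult_left_mono fv F G assms less_imp_le[OF bnd_pos])
    finally show "(\<Sum>i\<in>F. \<Sum>j\<in>G. norm (?f i j))
      \<le> bnd A * (\<Sum>\<^sub>\<infinity>i. (norm (v i))\<^sup>2) + bnd A * (\<Sum>\<^sub>\<infinity>i. (norm (w i))\<^sup>2)" .
  qed
  from abs_summable_summable[OF this]
  have "(\<Sum>\<^sub>\<infinity>i. \<Sum>\<^sub>\<infinity>j. ?f i j) = (\<Sum>\<^sub>\<infinity>j. \<Sum>\<^sub>\<infinity>i. ?f i j)"
    using infsum_swap_banach[of ?f UNIV UNIV] by simp
  moreover have "(\<Sum>\<^sub>\<infinity>j. \<Sum>\<^sub>\<infinity>i. ?f i j) = inner2 v (app (adj A) w)"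
    by (simp add: inner2_def app_def infsum_cmult_right'[symmetric] mult.commute mult.left_commute flip: infsum_cnj)
  ultimately show ?thesis
    by (simp add: inner2_def app_def infsum_cmult_left'[symmetric])
qed

section \<open>A Fredholm alternative\<close>

lemma geometric_has_sum:
  assumes "0 \<le> c" "c < (1::real)" shows "((\<lambda>n. c ^ n) has_sum 1 / (1 - c)) UNIV"
  using assms by (intro sums_nonneg_imp_has_sum) (auto intro!: geometric_sums)

lemma row_bounded_geometric:
  assumes T: "\<And>n. row_bounded (c ^ n) (T n)" and c: "0 \<le> c" "c < 1"
  shows "row_bounded (1 / (1 - c)) (\<lambda>i j. \<Sum>\<^sub>\<infinity>n. T n i j)"
  unfolding row_bounded_def
proof (intro allI impI)
  fix i and F :: "'b set" assume F: "finite F"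
  note gs = geometric_has_sum[OF c]
  have sm: "(\<lambda>n. norm (T n i j)) summable_on UNIV" for j
    by (rule summable_on_comparison_test[OF has_sum_imp_summable[OF gs]]) (auto intro: row_bounded_entry[OF T])
  have "(\<Sum>j\<in>F. norm (\<Sum>\<^sub>\<infinity>n. T n i j)) \<le> (\<Sum>j\<in>F. \<Sum>\<^sub>\<infinity>n. norm (T n i j))"
    by (intro sum_mono norm_infsum_bound sm)
  also have "\<dots> = (\<Sum>\<^sub>\<infinity>n. \<Sum>j\<in>F. norm (T n i j))"
    by (rule infsum_sum(2)[symmetric]) (rule sm)
  also have "\<dots> \<le> (\<Sum>\<^sub>\<infinity>n. c ^ n)"
    by (intro infsum_mono infsum_sum(1)[OF sm] has_sum_imp_summable[OF gs] row_boundedD[OF T F])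
  also have "\<dots> = 1 / (1 - c)" by (rule infsumI[OF gs])
  finally show "(\<Sum>j\<in>F. norm (\<Sum>\<^sub>\<infinity>n. T n i j)) \<le> 1 / (1 - c)" .
qed

text \<open>The ring carries no norm here, so the Neumann series is summed entry by entry;
  \<open>row_bounded_geometric\<close> puts the sum back into the ring.\<close>

lemma neumann_right:
  assumes E: "mbounded c (ent E)" and c: "c < 1"
  shows "\<exists>N. (1 - E) * N = 1"
proof -
  have c0: "0 \<le> c" using E row_bounded_nonneg by (auto simp: mbounded_def)
  have pw: "mbounded (c ^ n) (ent (E ^ n))" for n
    by (induction n) (use mbounded_id in \<open>auto simp: ent_mult ent_one[abs_def] mbounded_mprod E\<close>)
  define S where "S = (\<lambda>i k. \<Sum>\<^sub>\<infinity>n. ent (E ^ n) i k)"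
  have "mbounded (1 / (1 - c)) S"
    unfolding mbounded_def S_def
    using row_bounded_geometric[of c "\<lambda>n. ent (E ^ n)"] row_bounded_geometric[of c "\<lambda>n i j. ent (E ^ n) j i"]
      pw c0 c by (simp add: mbounded_def)
  then have N: "ent (Bmat S) = S" by (rule ent_Bmat)
  have pwe: "norm (ent (E ^ n) i j) \<le> c ^ n" for n i j
    using pw[of n] row_bounded_entry by (auto simp: mbounded_def)
  note gs = geometric_has_sum[OF c0 c]
  have sm: "(\<lambda>n. ent (E ^ n) i j) summable_on UNIV" for i j
    by (rule abs_summable_summable, rule summable_on_comparison_test[OF has_sum_imp_summable[OF gs]]) (auto intro: pwe)
  have "ent (E * Bmat S) i k = S i k - ent 1 i k" for i k
  proof -
    let ?f = "\<lambda>j n. ent E i j * ent (E ^ n) j k"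
    have "(\<lambda>(j,n). ?f j n) abs_summable_on UNIV"
    proof (rule abs_summable_prodI)
      fix F :: "'a set" and G :: "nat set" assume FG: "finite F" "finite G"
      have "(\<Sum>j\<in>F. \<Sum>n\<in>G. norm (?f j n)) \<le> (\<Sum>j\<in>F. \<Sum>n\<in>G. norm (ent E i j) * c ^ n)"
        by (intro sum_mono) (simp add: norm_mult mult_left_mono pwe)
      also have "\<dots> = (\<Sum>j\<in>F. norm (ent E i j)) * (\<Sum>n\<in>G. c ^ n)"
        by (simp add: sum_product)
      also have "\<dots> \<le> c * (1 / (1 - c))"
        using E FG c0 finite_sum_le_infsum[OF has_sum_imp_summable[OF gs] FG(2)] infsumI[OF gs]
        by (intro mult_mono row_boundedD[of c "ent E"]) (auto simp: mbounded_def intro: sum_nonneg)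
      finally show "(\<Sum>j\<in>F. \<Sum>n\<in>G. norm (?f j n)) \<le> c * (1 / (1 - c))" .
    qed
    from abs_summable_summable[OF this]
    have sw: "(\<Sum>\<^sub>\<infinity>j. \<Sum>\<^sub>\<infinity>n. ?f j n) = (\<Sum>\<^sub>\<infinity>n. \<Sum>\<^sub>\<infinity>j. ?f j n)"
      using infsum_swap_banach[of ?f UNIV UNIV] by simp
    have "ent (E * Bmat S) i k = (\<Sum>\<^sub>\<infinity>j. \<Sum>\<^sub>\<infinity>n. ?f j n)"
      unfolding ent_mult mprod_def N by (simp add: S_def infsum_cmult_right'[symmetric])
    also have "\<dots> = (\<Sum>\<^sub>\<infinity>n. ent (E ^ Suc n) i k)"
      unfolding sw by (simp add: ent_mult mprod_def)
    also have "\<dots> = infsum (\<lambda>n. ent (E ^ n) i k) (range Suc)"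
      by (simp add: infsum_reindex o_def del: power_Suc)
    also have "S i k = ent 1 i k + infsum (\<lambda>n. ent (E ^ n) i k) (range Suc)"
    proof -
      have "S i k = infsum (\<lambda>n. ent (E ^ n) i k) (insert 0 (range Suc))"
        unfolding S_def by (simp add: UNIV_nat_eq[symmetric])
      also have "\<dots> = ent (E ^ 0) i k + infsum (\<lambda>n. ent (E ^ n) i k) (range Suc)"
        by (rule infsum_insert) (auto intro: summable_on_subset_banach[OF sm])
      finally show ?thesis by simp
    qed
    then have "infsum (\<lambda>n. ent (E ^ n) i k) (range Suc) = S i k - ent 1 i k" by simp
    finally show ?thesis .
  qed
  then have "(1 - E) * Bmat S = 1" by (intro bmat_eqI) (simp add: left_diff_distrib N)
  then show ?thesis by blast
qed

text \<open>The adjoint of E satisfies the same bound, and a right inverse of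
  \<open>1 - adj E\<close> is the adjoint of a left inverse of \<open>1 - E\<close>.\<close>

lemma neumann:
  assumes E: "mbounded c (ent E)" and c: "c < 1"
  shows "\<exists>N. (1 - E) * N = 1 \<and> N * (1 - E) = 1"
proof -
  obtain N where N: "(1 - E) * N = 1" using neumann_right[OF assms] by blast
  have "mbounded c (ent (adj E))" using mbounded_adj[OF E] by (metis (no_types, lifting) ent_adj ext)
  then obtain L where "(1 - adj E) * L = 1" using neumann_right c by blast
  from arg_cong[OF this, of adj] have L: "adj L * (1 - E) = 1" by (simp add: adj_mult adj_minus)
  have "adj L = N" using arg_cong[OF N, of "\<lambda>X. adj L * X"] L by (simp flip: mult.assoc)
  then show ?thesis using N L by blast
qed

text \<open>The ansatz \<open>x = b + y\<close> with y in the image of V under R reduces the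
  equation to \<open>y - R y = R b\<close> in a finite-dimensional space, where injective linear
  maps are onto.\<close>

lemma finite_rank_perturbation_surj:
  fixes R :: "'a::real_vector \<Rightarrow> 'a"
  assumes R: "linear R" and V: "subspace V" "R ` V \<subseteq> V" and S: "finite S" "R ` V \<subseteq> span S"
    and inj: "\<And>x. x \<in> V \<Longrightarrow> R x = x \<Longrightarrow> x = 0" and b: "b \<in> V"
  shows "\<exists>x\<in>V. x - R x = b"
proof -
  define f where "f x = x - R x" for x
  have f: "linear f" unfolding f_def using R by (intro linear_compose_sub) (auto simp: linear_ident)
  have W: "subspace (R ` V)" using R V(1) by (rule linear_subspace_image)
  obtain B where B: "B \<subseteq> R ` V" "independent B" "R ` V \<subseteq> span B"
    using maximal_independent_subset by blast
  have spB: "span B = R ` V" using B W by (metis span_minimal subset_antisym)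
  have finB: "finite B" using independent_span_bound[OF S(1) B(2)] B(1) S(2) by auto
  have fW: "f x \<in> R ` V" if "x \<in> R ` V" for x
    unfolding f_def using that V(2) by (intro subspace_diff[OF W]) auto
  have injf: "inj_on f (span B)"
  proof (rule inj_onI)
    fix x y assume xy: "x \<in> span B" "y \<in> span B" "f x = f y"
    then have "f (x - y) = 0" by (simp add: linear_diff[OF f])
    moreover have "x - y \<in> V" using subspace_diff[OF subspace_span xy(1,2)] spB V(2) by auto
    ultimately show "x = y" using inj[of "x - y"] by (simp add: f_def)
  qed
  have ind: "independent (f ` B)" using linear_independent_injective_image[OF f B(2) injf] .
  have card: "card (f ` B) = card B"
    by (rule card_image[OF inj_on_subset[OF injf span_superset]])
  have sub: "f ` B \<subseteq> span B" using fW B(1) spB by auto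
  \<comment> \<open>A vector of B outside the span of the image would give \<open>card B + 1\<close>
    independent vectors in the span of B.\<close>
  have "B \<subseteq> span (f ` B)"
  proof (rule ccontr)
    assume "\<not> B \<subseteq> span (f ` B)"
    then obtain z where z: "z \<in> B" "z \<notin> span (f ` B)" by blast
    then have "independent (insert z (f ` B))" using ind by (simp add: independent_insertI)
    moreover have "insert z (f ` B) \<subseteq> span B" using sub z(1) span_superset by auto
    ultimately have "card (insert z (f ` B)) \<le> card B" using independent_span_bound[OF finB] by blast
    moreover have "z \<notin> f ` B" using z(2) by (blast intro: span_base)
    ultimately show False using finB card by simp
  qed
  then have "span B \<subseteq> span (f ` B)" by (rule span_minimal) (rule subspace_span)
  then have "R ` V \<subseteq> f ` span B" using spB linear_span_image[OF f] by metis
  then obtain y where y: "y \<in> span B" "R b = f y" using b by blast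
  have "b + y \<in> V" using b y spB V by (auto intro: subspace_add[OF V(1)])
  moreover have "b + y - R (b + y) = b" using y(2) linear_add[OF R] by (simp add: f_def)
  ultimately show ?thesis by blast
qed

lemma ent_sum: "ent (sum f F) i j = (\<Sum>k\<in>F. ent (f k) i j)"
  by (induction F rule: infinite_finite_induct) auto

text \<open>Let E be the small part of K outside the rows F and N the inverse of
  \<open>1 - E\<close>. Then \<open>X - K * X = B\<close> becomes
  \<open>X - N * (pr F * K * X) = N * B\<close>, a finite rank perturbation of the identity. The
  unknowns are matrices supported in the column \<open>l\<close>, which makes them absolutely
  summable.\<close>

lemma fredholm:
  fixes K :: "'i bmat"
  assumes F: "finite F" and small: "mbounded c (ent (pr (- F) * K))" "c < 1"
    and inj: "\<And>X. X * pr {l} = X \<Longrightarrow> K * X = X \<Longrightarrow> X = 0"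
    and B: "B * pr {l} = B"
  shows "\<exists>X. X * pr {l} = X \<and> X - K * X = B"
proof -
  define E where "E = pr (- F) * K"
  obtain N where N: "(1 - E) * N = 1" "N * (1 - E) = 1" using neumann[OF small] E_def by blast
  have K: "K = pr F * K + E" unfolding E_def by (rule bmat_eqI) auto
  define V where "V = {X :: 'i bmat. X * pr {l} = X}"
  define R where "R = (\<lambda>X. N * (pr F * K * X))"
  \<comment> \<open>Scaled matrix units. Both z = 1 and z = \<i> occur in the spanning set S,
    because spans are taken over the reals.\<close>
  define U where "U z i = Bmat (\<lambda>a b. if b = l \<and> a = i then z else 0)" for z i
  have U: "ent (U z i) a b = (if b = l \<and> a = i then z else 0)" for z i a b
  proof -
    have "row_bounded (norm z) (\<lambda>a b. if b = l then (if a = i then z else 0) else 0)"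
      and "row_bounded (norm z) (\<lambda>b a. if a = i then (if b = l then z else 0) else 0)"
      by (rule row_bounded_diag; simp)+
    moreover have "(\<lambda>a b. if b = l then (if a = i then z else 0) else 0) = (\<lambda>a b. if b = l \<and> a = i then z else 0)"
      "(\<lambda>b a. if a = i then (if b = l then z else 0) else 0) = (\<lambda>b a. if b = l \<and> a = i then z else 0)"
      by (intro ext; simp)+
    ultimately have "mbounded (norm z) (\<lambda>a b. if b = l \<and> a = i then z else 0)"
      unfolding mbounded_def by metis
    from ent_Bmat[OF this] show ?thesis by (simp add: U_def)
  qed
  define S where "S = (\<lambda>i. N * U 1 i) ` F \<union> (\<lambda>i. N * U \<i> i) ` F"
  have RS: "R X \<in> span S" if "X \<in> V" for X
  proof -
    define Y where "Y = K * X"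
    have "Y * pr {l} = Y" using that by (simp add: Y_def V_def mult.assoc)
    then have Y: "ent Y i j = 0" if "j \<noteq> l" for i j
      using that by (metis ent_mult_pr singletonD)
    have "pr F * Y = (\<Sum>i\<in>F. Re (ent Y i l) *\<^sub>R U 1 i + Im (ent Y i l) *\<^sub>R U \<i> i)"
    proof (rule bmat_eqI)
      fix a b
      have "ent (\<Sum>i\<in>F. Re (ent Y i l) *\<^sub>R U 1 i + Im (ent Y i l) *\<^sub>R U \<i> i) a b
        = (\<Sum>i\<in>F. if a = i then (if b = l then ent Y a b else 0) else 0)"
        unfolding ent_sum by (intro sum.cong refl) (auto simp: U complex_eq_iff)
      then show "ent (pr F * Y) a b = ent (\<Sum>i\<in>F. Re (ent Y i l) *\<^sub>R U 1 i + Im (ent Y i l) *\<^sub>R U \<i> i) a b"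
        using F Y by simp
    qed
    then have "R X = (\<Sum>i\<in>F. Re (ent Y i l) *\<^sub>R (N * U 1 i) + Im (ent Y i l) *\<^sub>R (N * U \<i> i))"
      by (simp add: R_def Y_def mult.assoc sum_distrib_left distrib_left)
    also have "\<dots> \<in> span S"
      by (intro span_sum span_add span_scale span_base) (auto simp: S_def)
    finally show ?thesis .
  qed
  have "\<exists>X\<in>V. X - R X = N * B"
  proof (rule finite_rank_perturbation_surj)
    show "linear R" unfolding R_def by (rule linearI) (simp_all add: distrib_left)
    show "subspace V" unfolding V_def by (auto simp: subspace_def distrib_right)
    show "R ` V \<subseteq> V" by (auto simp: R_def V_def mult.assoc)
    show "finite S" using F by (simp add: S_def)
    show "R ` V \<subseteq> span S" using RS by blast
    show "N * B \<in> V" using B by (simp add: V_def mult.assoc)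
    fix X assume X: "X \<in> V" "R X = X"
    \<comment> \<open>Multiplication by \<open>1 - E\<close> turns a fixed point of R into one of
      K.\<close>
    have "pr F * K * X = ((1 - E) * N) * (pr F * K * X)" by (simp add: N)
    also have "\<dots> = (1 - E) * R X" by (simp add: R_def mult.assoc)
    also have "\<dots> = X - E * X" by (simp add: X(2) left_diff_distrib)
    finally have "pr F * K * X + E * X = X" by (simp add: algebra_simps)
    then have "K * X = X" by (metis K distrib_right)
    then show "X = 0" using inj X(1) by (simp add: V_def)
  qed
  then obtain X where X: "X \<in> V" "X - R X = N * B" by blast
  have "(1 - E) * (X - R X) = B" by (simp add: X(2) N flip: mult.assoc)
  moreover have "(1 - E) * R X = pr F * K * X"
    using N(1) by (simp add: R_def flip: mult.assoc)
  ultimately have "(1 - E) * X - pr F * K * X = B" by (simp only: right_diff_distrib)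
  then have "X - (pr F * K * X + E * X) = B" by (simp add: left_diff_distrib diff_diff_eq add.commute)
  then have "X - K * X = B" by (metis K distrib_right)
  then show ?thesis using X(1) by (auto simp: V_def)
qed

section \<open>Fourier coefficients of Wiener functions\<close>

lemma smult_mat_nth [simp]: "smult_mat c A $ i $ j = c * A $ i $ j"
  by (simp add: smult_mat_def map_matrix_def)

lemma adj_mat_nth [simp]: "adj_mat A $ i $ j = cnj (A $ j $ i)"
  by (simp add: adj_mat_def map_matrix_def transpose_def)

lemma norm_entry_le: "norm (A $ i $ j) \<le> norm (A :: complex^'m^'n)"
  by (rule order_trans[OF Finite_Cartesian_Product.norm_nth_le Finite_Cartesian_Product.norm_nth_le])

lemma norm_le_sum_entries: "norm (A :: complex^'m^'n) \<le> (\<Sum>i\<in>UNIV. \<Sum>j\<in>UNIV. norm (A $ i $ j))"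
proof -
  have "norm A \<le> (\<Sum>i\<in>UNIV. norm (A $ i))"
    by (simp add: norm_vec_def[of A] L2_set_le_sum)
  also have "\<dots> \<le> (\<Sum>i\<in>UNIV. \<Sum>j\<in>UNIV. norm (A $ i $ j))"
    by (intro sum_mono) (simp add: norm_vec_def L2_set_le_sum)
  finally show ?thesis .
qed

lemma norm_smult_mat: "norm (smult_mat c A) = norm c * norm (A :: complex^'m^'n)"
proof -
  have "norm (smult_mat c A $ i) = norm c * norm (A $ i)" for i
    by (simp add: norm_vec_def norm_mult L2_set_right_distrib)
  then show ?thesis by (simp add: norm_vec_def[of "smult_mat c A"] norm_vec_def[of A] L2_set_right_distrib)
qed

lemma bounded_linear_smult_mat: "bounded_linear (\<lambda>c. smult_mat c (A :: complex^'m^'n))"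
proof (rule bounded_linear_intro[where K = "norm A"])
  show "smult_mat (x + y) A = smult_mat x A + smult_mat y A" for x y
    by (simp add: vec_eq_iff algebra_simps)
  show "smult_mat (r *\<^sub>R x) A = r *\<^sub>R smult_mat x A" for r x
    by (simp add: vec_eq_iff)
  show "norm (smult_mat x A) \<le> norm x * norm A" for x by (simp add: norm_smult_mat)
qed

lemma smult_mat_smult_mat: "smult_mat c (smult_mat d A) = smult_mat (c * d) A"
  by (simp add: vec_eq_iff mult.assoc)

lemma has_integral_cis:
  "((\<lambda>t. cis (of_int k * t)) has_integral (if k = 0 then of_real (2 * pi) else 0)) {0..2 * pi}"
proof (cases "k = 0")
  case True
  have "((\<lambda>t::real. 1::complex) has_integral (2 * pi - 0) *\<^sub>R 1) {0..2 * pi}"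
    using has_integral_const_real[of "1::complex" 0 "2 * pi"] by simp
  then show ?thesis using True by (simp add: scaleR_conv_of_real)
next
  case False
  have "((\<lambda>t. cis (of_int k * t)) has_integral
      cis (of_int k * (2 * pi)) / (\<i> * of_int k) - cis (of_int k * 0) / (\<i> * of_int k)) {0..2 * pi}"
  proof (rule fundamental_theorem_of_calculus)
    fix t :: real
    have "((\<lambda>z. exp (\<i> * of_int k * z) / (\<i> * of_int k)) has_field_derivative exp (\<i> * of_int k * of_real t)) (at (of_real t))"
      using False by (auto intro!: derivative_eq_intros)
    from has_vector_derivative_real_field[OF this]
    show "((\<lambda>t. cis (of_int k * t) / (\<i> * of_int k)) has_vector_derivative cis (of_int k * t))
        (at t within {0..2 * pi})"
      by (simp add: cis_conv_exp mult.assoc)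
  qed simp
  moreover have "cis (of_int k * (2 * pi)) = 1" using cis_multiple_2pi[of "of_int k"] by (simp add: mult.commute mult.left_commute)
  ultimately show ?thesis using False by simp
qed

text \<open>The Weierstrass test gives uniform convergence on the circle, so the series may be
  integrated term by term. All later identifications of Fourier coefficients rest on this
  uniqueness.\<close>

lemma fourier_coeff_series:
  fixes r :: "int \<Rightarrow> complex^'m^'n"
  assumes r: "(\<lambda>\<nu>. norm (r \<nu>)) summable_on UNIV"
    and \<rho>: "\<And>\<zeta>. \<zeta> \<in> sphere 0 1 \<Longrightarrow> ((\<lambda>\<nu>. smult_mat (\<zeta> powi \<nu>) (r \<nu>)) has_sum \<rho> \<zeta>) UNIV"
  shows "fourier_coeff \<rho> \<nu> = r \<nu>"
proof -
  let ?f = "\<lambda>\<mu> t. smult_mat (cis (- (of_int \<nu> * t))) (smult_mat (cis t powi \<mu>) (r \<mu>))"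
  let ?g = "\<lambda>t. smult_mat (cis (- (of_int \<nu> * t))) (\<rho> (cis t))"
  have f: "?f \<mu> t = smult_mat (cis (of_int (\<mu> - \<nu>) * t)) (r \<mu>)" for \<mu> t
    by (simp add: smult_mat_smult_mat cis_power_int cis_mult algebra_simps)
  have ul: "uniform_limit {0..2 * pi} (\<lambda>X t. \<Sum>\<mu>\<in>X. ?f \<mu> t) ?g (finite_subsets_at_top UNIV)"
  proof (rule Weierstrass_m_test_general'[OF _ _ r])
    show "norm (?f \<mu> t) \<le> norm (r \<mu>)" for \<mu> t by (simp add: f norm_smult_mat)
    have bl: "bounded_linear (smult_mat c :: complex^'m^'n \<Rightarrow> _)" for c
      by (rule bounded_linear_intro[where K = "norm c"])
         (simp_all add: vec_eq_iff algebra_simps norm_smult_mat)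
    show "((\<lambda>\<mu>. ?f \<mu> t) has_sum ?g t) UNIV" for t
      by (rule has_sum_bounded_linear[OF bl]) (rule \<rho>, simp)
  qed
  have int: "(?f \<mu> has_integral (if \<mu> = \<nu> then (2 * pi) *\<^sub>R r \<nu> else 0)) {0..2 * pi}" for \<mu>
  proof -
    have "(?f \<mu> has_integral smult_mat (if \<mu> - \<nu> = 0 then of_real (2 * pi) else 0) (r \<mu>)) {0..2 * pi}"
      unfolding f using has_integral_linear[OF has_integral_cis[of "\<mu> - \<nu>"] bounded_linear_smult_mat[of "r \<mu>"]]
      by (simp add: o_def)
    moreover have "smult_mat (if \<mu> - \<nu> = 0 then of_real (2 * pi) else 0) (r \<mu>) = (if \<mu> = \<nu> then (2 * pi) *\<^sub>R r \<nu> else 0)"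
      by (simp add: vec_eq_iff) (simp add: scaleR_conv_of_real)
    ultimately show ?thesis by simp
  qed
  have cont: "continuous_on {0..2 * pi} (\<lambda>t. \<Sum>\<mu>\<in>X. ?f \<mu> t)" for X
    unfolding f by (intro continuous_intros bounded_linear.continuous_on[OF bounded_linear_smult_mat])
  obtain I J where IJ: "\<And>X. ((\<lambda>t. \<Sum>\<mu>\<in>X. ?f \<mu> t) has_integral I X) {0..2 * pi}"
    "(?g has_integral J) {0..2 * pi}" "(I \<longlongrightarrow> J) (finite_subsets_at_top UNIV)"
    using uniform_limit_integral[OF ul cont] finite_subsets_at_top_neq_bot by blast
  have "I X = (2 * pi) *\<^sub>R r \<nu>" if "finite X" "\<nu> \<in> X" for X
    using has_integral_unique[OF IJ(1) has_integral_sum[OF that(1) int]] that by simp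
  then have "\<forall>\<^sub>F X in finite_subsets_at_top UNIV. I X = (2 * pi) *\<^sub>R r \<nu>"
    unfolding eventually_finite_subsets_at_top by (intro exI[of _ "{\<nu>}"]) auto
  then have "(I \<longlongrightarrow> (2 * pi) *\<^sub>R r \<nu>) (finite_subsets_at_top UNIV)"
    by (rule tendsto_eventually)
  then have "J = (2 * pi) *\<^sub>R r \<nu>" using IJ(3) tendsto_unique finite_subsets_at_top_neq_bot by blast
  then show ?thesis using IJ(2) by (simp add: fourier_coeff_def integral_unique)
qed

lemma bounded_linear_entry: "bounded_linear (\<lambda>A::complex^'m^'n. A $ k $ l)"
  by (rule bounded_linear_intro[where K = 1]) (simp_all add: norm_entry_le)

text \<open>Entrywise criterion, so that only scalar series have to be summed later.\<close>

lemma wienerI: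
  fixes r :: "int \<Rightarrow> complex^'m^'n"
  assumes r: "\<And>k l. (\<lambda>\<nu>. norm (r \<nu> $ k $ l)) summable_on UNIV"
    and \<rho>: "\<And>\<zeta> k l. \<zeta> \<in> sphere 0 1 \<Longrightarrow> \<rho> \<zeta> $ k $ l = (\<Sum>\<^sub>\<infinity>\<nu>. \<zeta> powi \<nu> * r \<nu> $ k $ l)"
  shows "\<rho> \<in> wiener" and "fourier_coeff \<rho> = r"
proof -
  have "(\<lambda>\<nu>. \<Sum>i\<in>UNIV. \<Sum>j\<in>UNIV. norm (r \<nu> $ i $ j)) summable_on UNIV"
    by (intro infsum_sum(1) r)
  then have r1: "(\<lambda>\<nu>. norm (r \<nu>)) summable_on UNIV"
    by (rule summable_on_comparison_test) (auto intro: norm_le_sum_entries)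
  have \<rho>1: "((\<lambda>\<nu>. smult_mat (\<zeta> powi \<nu>) (r \<nu>)) has_sum \<rho> \<zeta>) UNIV" if "\<zeta> \<in> sphere 0 1" for \<zeta>
  proof -
    have "(\<lambda>\<nu>. smult_mat (\<zeta> powi \<nu>) (r \<nu>)) summable_on UNIV"
      by (rule abs_summable_summable) (use r1 that in \<open>simp add: norm_smult_mat norm_power_int\<close>)
    then have hs: "((\<lambda>\<nu>. smult_mat (\<zeta> powi \<nu>) (r \<nu>)) has_sum (\<Sum>\<^sub>\<infinity>\<nu>. smult_mat (\<zeta> powi \<nu>) (r \<nu>))) UNIV"
      by (rule has_sum_infsum)
    have "(\<Sum>\<^sub>\<infinity>\<nu>. smult_mat (\<zeta> powi \<nu>) (r \<nu>)) $ k $ l = \<rho> \<zeta> $ k $ l" for k l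
    proof -
      show ?thesis using infsumI[OF has_sum_bounded_linear[OF bounded_linear_entry hs]]
        by (simp add: \<rho>[OF that])
    qed
    then have "(\<Sum>\<^sub>\<infinity>\<nu>. smult_mat (\<zeta> powi \<nu>) (r \<nu>)) = \<rho> \<zeta>" by (simp add: vec_eq_iff)
    then show ?thesis using hs by simp
  qed
  show fc: "fourier_coeff \<rho> = r" using fourier_coeff_series[OF r1 \<rho>1] by blast
  show "\<rho> \<in> wiener" unfolding wiener_def using r1 \<rho>1 by (simp add: fc)
qed

lemma wienerD:
  fixes \<rho> :: "complex \<Rightarrow> complex^'m^'n"
  assumes "\<rho> \<in> wiener"
  shows "(\<lambda>\<nu>. norm (fourier_coeff \<rho> \<nu> $ k $ l)) summable_on UNIV"
    and "\<zeta> \<in> sphere 0 1 \<Longrightarrow> \<rho> \<zeta> $ k $ l = (\<Sum>\<^sub>\<infinity>\<nu>. \<zeta> powi \<nu> * fourier_coeff \<rho> \<nu> $ k $ l)"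
proof -
  show "(\<lambda>\<nu>. norm (fourier_coeff \<rho> \<nu> $ k $ l)) summable_on UNIV"
    by (rule summable_on_comparison_test[of "\<lambda>\<nu>. norm (fourier_coeff \<rho> \<nu>)"])
       (use assms in \<open>auto simp: wiener_def intro: norm_entry_le\<close>)
  assume "\<zeta> \<in> sphere 0 1"
  then have "((\<lambda>\<nu>. smult_mat (\<zeta> powi \<nu>) (fourier_coeff \<rho> \<nu>)) has_sum \<rho> \<zeta>) UNIV"
    using assms by (simp add: wiener_def)
  from infsumI[OF has_sum_bounded_linear[OF bounded_linear_entry this]]
  show "\<rho> \<zeta> $ k $ l = (\<Sum>\<^sub>\<infinity>\<nu>. \<zeta> powi \<nu> * fourier_coeff \<rho> \<nu> $ k $ l)" by simp
qed

section \<open>Laurent matrices\<close>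

definition laurent :: "(int \<times> 's) bmat \<Rightarrow> bool" where
  "laurent A \<longleftrightarrow> (\<forall>i j k s t. ent A (i + k, s) (j + k, t) = ent A (i, s) (j, t))"

definition cf :: "(int \<times> 's) bmat \<Rightarrow> int \<Rightarrow> 's \<Rightarrow> 's \<Rightarrow> complex" where
  "cf A \<nu> s t = ent A (\<nu>, s) (0, t)"

definition symf :: "(int \<times> 's) bmat \<Rightarrow> complex \<Rightarrow> 's \<Rightarrow> 's \<Rightarrow> complex" where
  "symf A \<zeta> s t = (\<Sum>\<^sub>\<infinity>\<nu>. \<zeta> powi \<nu> * cf A \<nu> s t)"

lemma laurent_ent: "laurent A \<Longrightarrow> ent A (i, s) (j, t) = cf A (i - j) s t"
  unfolding laurent_def cf_def by (metis add.left_neutral diff_add_cancel)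

lemma laurent_eqI:
  assumes "laurent A" "laurent B" "\<And>\<nu> s t. cf A \<nu> s t = cf B \<nu> s t" shows "A = B"
  by (rule bmat_eqI) (use assms in \<open>auto simp: laurent_ent split: prod.splits\<close>)

lemma laurent_add: "laurent A \<Longrightarrow> laurent B \<Longrightarrow> laurent (A + B)"
  and laurent_minus: "laurent A \<Longrightarrow> laurent B \<Longrightarrow> laurent (A - B)"
  and laurent_adj: "laurent A \<Longrightarrow> laurent (adj A)"
  and laurent_pr: "laurent (pr (UNIV \<times> T))"
  and laurent_one: "laurent 1"
  by (auto simp: laurent_def ent_pr ent_one)

lemma laurent_mult:
  assumes "laurent A" "laurent B" shows "laurent (A * B)"
  unfolding laurent_def
proof (intro allI)
  fix i j k s t
  have bij: "bij_betw (\<lambda>(m, u). (m + k, u)) UNIV (UNIV :: (int \<times> 'a) set)"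
    by (rule bij_betw_byWitness[where f' = "\<lambda>(m, u). (m - k, u)"]) auto
  have "ent (A * B) (i + k, s) (j + k, t) = (\<Sum>\<^sub>\<infinity>x. ent A (i + k, s) x * ent B x (j + k, t))"
    by (simp add: ent_mult mprod_def)
  also have "\<dots> = (\<Sum>\<^sub>\<infinity>x. ent A (i + k, s) (case x of (m, u) \<Rightarrow> (m + k, u)) * ent B (case x of (m, u) \<Rightarrow> (m + k, u)) (j + k, t))"
    by (rule infsum_reindex_bij_betw[OF bij, symmetric])
  also have "\<dots> = (\<Sum>\<^sub>\<infinity>x. ent A (i, s) x * ent B x (j, t))"
    by (rule infsum_cong) (use assms in \<open>auto simp: laurent_def\<close>)
  finally show "ent (A * B) (i + k, s) (j + k, t) = ent (A * B) (i, s) (j, t)"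
    by (simp add: ent_mult mprod_def)
qed

lemma summable_cf: "(\<lambda>\<nu>. norm (cf A \<nu> s t)) summable_on UNIV"
proof -
  have "(\<lambda>x. norm (ent A x (0, t))) summable_on range (\<lambda>\<nu>. (\<nu>, s))"
    using row_bounded_summable[OF bnd_col] by (rule summable_on_subset_banach) simp
  then show ?thesis
    by (subst (asm) summable_on_reindex) (auto simp: inj_on_def o_def cf_def)
qed

text \<open>Summing over all pairs \<open>(s, t)\<close> gives one crude constant that bounds rows
  and columns alike.\<close>

lemma laurent_exists:
  fixes r :: "int \<Rightarrow> 's::finite \<Rightarrow> 's \<Rightarrow> complex"
  assumes "\<And>s t. (\<lambda>\<nu>. norm (r \<nu> s t)) summable_on UNIV"
  obtains A where "laurent A" "\<And>\<nu> s t. cf A \<nu> s t = r \<nu> s t"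
proof -
  let ?C = "\<Sum>s\<in>UNIV. \<Sum>t\<in>UNIV. \<Sum>\<^sub>\<infinity>\<nu>. norm (r \<nu> s t)"
  \<comment> \<open>The reindexings \<open>g\<close> and \<open>p\<close> cover both uses: along a
    row as well as along a column the diagonal index \<open>i - j\<close> runs injectively.\<close>
  have row: "row_bounded ?C (\<lambda>(i, s) (j, t). h i j s t)"
    if h: "\<And>i j s t. norm (h i j s t) \<le> norm (r (g i j) (fst (p s t)) (snd (p s t)))"
      and g: "\<And>i. inj (g i)" and p: "\<And>s. inj (p s)"
    for h :: "int \<Rightarrow> int \<Rightarrow> 's \<Rightarrow> 's \<Rightarrow> complex" and g p
    unfolding row_bounded_def
  proof (intro allI impI)
    fix x :: "int \<times> 's" and F :: "(int \<times> 's) set" assume F: "finite F"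
    obtain i s where x: "x = (i, s)" by (cases x)
    let ?n = "\<lambda>(j, t). norm (h i j s t)"
    have "(\<Sum>y\<in>F. ?n y) \<le> (\<Sum>y\<in>fst ` F \<times> UNIV. ?n y)"
      by (rule sum_mono2) (use F in \<open>auto intro: rev_image_eqI\<close>)
    also have "\<dots> = (\<Sum>t\<in>UNIV. \<Sum>j\<in>fst ` F. norm (h i j s t))"
      by (subst sum.swap) (simp add: sum.cartesian_product)
    also have "\<dots> \<le> (\<Sum>t\<in>UNIV. \<Sum>\<^sub>\<infinity>\<nu>. norm (r \<nu> (fst (p s t)) (snd (p s t))))"
    proof (rule sum_mono)
      fix t
      have "(\<Sum>j\<in>fst ` F. norm (h i j s t)) \<le> (\<Sum>j\<in>fst ` F. norm (r (g i j) (fst (p s t)) (snd (p s t))))"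
        by (intro sum_mono h)
      also have "\<dots> = (\<Sum>\<nu>\<in>g i ` fst ` F. norm (r \<nu> (fst (p s t)) (snd (p s t))))"
        by (subst sum.reindex) (auto intro: inj_on_subset[OF g])
      also have "\<dots> \<le> (\<Sum>\<^sub>\<infinity>\<nu>. norm (r \<nu> (fst (p s t)) (snd (p s t))))"
        by (rule finite_sum_le_infsum) (use F assms in auto)
      finally show "(\<Sum>j\<in>fst ` F. norm (h i j s t)) \<le> (\<Sum>\<^sub>\<infinity>\<nu>. norm (r \<nu> (fst (p s t)) (snd (p s t))))" .
    qed
    also have "\<dots> = (\<Sum>y\<in>p s ` UNIV. \<Sum>\<^sub>\<infinity>\<nu>. norm (r \<nu> (fst y) (snd y)))"
      by (subst sum.reindex[OF p]) simp
    also have "\<dots> \<le> (\<Sum>y\<in>UNIV. \<Sum>\<^sub>\<infinity>\<nu>. norm (r \<nu> (fst y) (snd y)))"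
      by (rule sum_mono2) (auto intro: infsum_nonneg)
    also have "\<dots> = ?C"
      by (simp add: sum.cartesian_product split_def flip: UNIV_Times_UNIV)
    finally show "(\<Sum>y\<in>F. norm ((case x of (i, s) \<Rightarrow> \<lambda>(j, t). h i j s t) y)) \<le> ?C"
      by (simp add: x split_def)
  qed
  define B where "B = (\<lambda>(i, s) (j, t). r (i - j) s t)"
  have "row_bounded ?C B" unfolding B_def
    by (rule row[where g = "\<lambda>i j. i - j" and p = Pair]) (auto simp: inj_on_def)
  moreover have "row_bounded ?C (\<lambda>(j, t) (i, s). r (i - j) s t)"
    by (rule row[where g = "\<lambda>j i. i - j" and p = "\<lambda>t s. (s, t)"]) (auto simp: inj_on_def)
  moreover have "(\<lambda>(j, t) (i, s). r (i - j) s t) = (\<lambda>x y. B y x)" by (auto simp: B_def)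
  ultimately have "mbounded ?C B" by (simp add: mbounded_def)
  then have "ent (Bmat B) = B" by (rule ent_Bmat)
  then have e: "ent (Bmat B) (i, s) (j, t) = r (i - j) s t" for i j s t by (simp only:) (simp add: B_def)
  show ?thesis
    by (rule that[of "Bmat B"]) (simp_all add: laurent_def cf_def e)
qed

lemma infsum_fibre:
  "(\<Sum>\<^sub>\<infinity>x. if snd x = t then g (fst x) else 0) = (\<Sum>\<^sub>\<infinity>j. g j)" for g :: "'i \<Rightarrow> complex" and t :: 's
proof -
  have "(\<Sum>\<^sub>\<infinity>x. if snd x = t then g (fst x) else 0) = (\<Sum>\<^sub>\<infinity>x\<in>range (\<lambda>j. (j, t)). g (fst x))"
    by (rule infsum_cong_neutral) auto
  also have "\<dots> = (\<Sum>\<^sub>\<infinity>j. g j)"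
    by (subst infsum_reindex) (auto simp: inj_on_def o_def)
  finally show ?thesis .
qed

text \<open>The negative exponent makes the eigenvalue the symbol at \<zeta> itself rather than at
  its inverse.\<close>

definition expv :: "complex \<Rightarrow> 's \<Rightarrow> int \<times> 's \<Rightarrow> complex" where
  "expv \<zeta> t = (\<lambda>x. if snd x = t then \<zeta> powi (- fst x) else 0)"

lemma vbounded_expv: "norm \<zeta> = 1 \<Longrightarrow> vbounded (expv \<zeta> t)"
  unfolding vbounded_def expv_def by (intro exI[of _ 1]) (auto simp: norm_power_int)

text \<open>Exponentials are bounded eigenvectors of Laurent matrices; this makes the symbol multiplicative.\<close>

lemma app_expv:
  assumes A: "laurent A" and \<zeta>: "norm \<zeta> = 1"
  shows "app A (expv \<zeta> t) (i, s) = \<zeta> powi (- i) * symf A \<zeta> s t"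
proof -
  have nz: "\<zeta> \<noteq> 0" using \<zeta> by auto
  have "app A (expv \<zeta> t) (i, s) = (\<Sum>\<^sub>\<infinity>x. if snd x = t then cf A (i - fst x) s t * \<zeta> powi (- fst x) else 0)"
    unfolding app_def expv_def by (rule infsum_cong) (auto simp: laurent_ent[OF A])
  also have "\<dots> = (\<Sum>\<^sub>\<infinity>j. cf A (i - j) s t * \<zeta> powi (- j))" by (rule infsum_fibre)
  also have "\<dots> = (\<Sum>\<^sub>\<infinity>\<nu>. cf A \<nu> s t * \<zeta> powi (\<nu> - i))"
    by (rule infsum_reindex_bij_witness[where i = "\<lambda>\<nu>. i - \<nu>" and j = "\<lambda>j. i - j"]) auto
  also have "\<dots> = (\<Sum>\<^sub>\<infinity>\<nu>. \<zeta> powi (- i) * (\<zeta> powi \<nu> * cf A \<nu> s t))"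
    using nz by (intro infsum_cong) (simp add: power_int_diff power_int_minus field_simps)
  finally show ?thesis by (simp add: symf_def infsum_cmult_right')
qed

text \<open>The value at index 0 of \<open>A * B\<close> applied to \<open>expv \<zeta> t\<close> is
  computed in two ways.\<close>

lemma symf_mult:
  fixes A B :: "(int \<times> 's::finite) bmat"
  assumes A: "laurent A" and B: "laurent B" and \<zeta>: "norm \<zeta> = 1"
  shows "symf (A * B) \<zeta> s t = (\<Sum>u\<in>UNIV. symf A \<zeta> s u * symf B \<zeta> u t)"
proof -
  have e: "app B (expv \<zeta> t) = (\<lambda>x. \<Sum>u\<in>UNIV. symf B \<zeta> u t * expv \<zeta> u x)"
  proof
    fix x :: "int \<times> 's"
    obtain i u where x: "x = (i, u)" by (cases x)
    show "app B (expv \<zeta> t) x = (\<Sum>u\<in>UNIV. symf B \<zeta> u t * expv \<zeta> u x)"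
      unfolding x app_expv[OF B \<zeta>] by (simp add: expv_def if_distrib mult.commute cong: if_cong)
  qed
  have "symf (A * B) \<zeta> s t = app (A * B) (expv \<zeta> t) (0, s)"
    by (simp add: app_expv[OF laurent_mult[OF A B] \<zeta>])
  also have "\<dots> = (\<Sum>\<^sub>\<infinity>x. \<Sum>u\<in>UNIV. symf B \<zeta> u t * (ent A (0, s) x * expv \<zeta> u x))"
    unfolding app_mult[OF vbounded_expv[OF \<zeta>]] e by (simp add: app_def sum_distrib_left mult.left_commute)
  also have "\<dots> = (\<Sum>u\<in>UNIV. symf B \<zeta> u t * app A (expv \<zeta> u) (0, s))"
    by (subst infsum_sum(2)) (auto intro!: summable_on_cmult_right app_summable vbounded_expv \<zeta> simp: infsum_cmult_right' app_def)
  finally show ?thesis by (simp add: app_expv[OF A \<zeta>] mult.commute)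
qed

lemma cf_add: "cf (A + B) \<nu> s t = cf A \<nu> s t + cf B \<nu> s t"
  and cf_one: "cf 1 \<nu> s t = (if \<nu> = 0 \<and> s = t then 1 else 0)"
  by (auto simp: cf_def ent_one)

lemma cf_adj: "laurent A \<Longrightarrow> cf (adj A) \<nu> s t = cnj (cf A (- \<nu>) t s)"
  using laurent_ent[of A 0 t \<nu> s] by (simp add: cf_def)

lemma summable_symf: "norm \<zeta> = 1 \<Longrightarrow> (\<lambda>\<nu>. \<zeta> powi \<nu> * cf A \<nu> s t) summable_on UNIV"
  by (rule abs_summable_summable) (simp add: norm_mult norm_power_int summable_cf)

lemma symf_add: "norm \<zeta> = 1 \<Longrightarrow> symf (A + B) \<zeta> s t = symf A \<zeta> s t + symf B \<zeta> s t"
  by (simp add: symf_def cf_add distrib_left infsum_add summable_symf)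

lemma symf_minus: "norm \<zeta> = 1 \<Longrightarrow> symf (A - B) \<zeta> s t = symf A \<zeta> s t - symf B \<zeta> s t"
  using symf_add[of \<zeta> "A - B" B s t] by simp

lemma symf_const:
  assumes "\<And>\<nu>. cf A \<nu> s t = (if \<nu> = 0 then c else 0)" shows "symf A \<zeta> s t = c"
  using infsum_single[of 0 "\<lambda>\<nu>. \<zeta> powi \<nu> * cf A \<nu> s t"] by (simp add: symf_def assms)

lemma symf_one: "symf 1 \<zeta> s t = (if s = t then 1 else 0)"
  by (rule symf_const) (simp add: cf_one)

lemma symf_adj:
  assumes "laurent A" "norm \<zeta> = 1" shows "symf (adj A) \<zeta> s t = cnj (symf A \<zeta> t s)"
proof -
  have c: "cnj \<zeta> powi \<nu> = \<zeta> powi (- \<nu>)" for \<nu>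
  proof -
    have "cnj \<zeta> * \<zeta> = 1" using assms(2) complex_norm_square[of \<zeta>] by (simp add: mult.commute)
    then have "cnj \<zeta> = inverse \<zeta>" by (metis inverse_unique mult.commute)
    then show ?thesis by (simp add: power_int_inverse power_int_minus)
  qed
  have "symf (adj A) \<zeta> s t = (\<Sum>\<^sub>\<infinity>\<nu>. \<zeta> powi (- \<nu>) * cnj (cf A \<nu> t s))"
    unfolding symf_def cf_adj[OF assms(1)]
    by (rule infsum_reindex_bij_witness[where i = uminus and j = uminus]) auto
  also have "\<dots> = cnj (symf A \<zeta> t s)"
    by (simp add: symf_def c flip: infsum_cnj)
  finally show ?thesis .
qed

text \<open>The passage from the ring to functions: membership of sums, products and adjoints in the
  Wiener class is obtained by recognizing their entries as symbol entries of a ring element.\<close>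

lemma block_wiener:
  fixes A :: "(int \<times> 's) bmat" and \<rho> :: "complex \<Rightarrow> complex^'m^'n"
  assumes \<rho>: "\<And>\<zeta> k l. norm \<zeta> = 1 \<Longrightarrow> \<rho> \<zeta> $ k $ l = symf A \<zeta> (f k) (h l)"
  shows "\<rho> \<in> wiener" and "fourier_coeff \<rho> \<nu> $ k $ l = cf A \<nu> (f k) (h l)"
proof -
  define r :: "int \<Rightarrow> complex^'m^'n" where "r \<nu> = (\<chi> k l. cf A \<nu> (f k) (h l))" for \<nu>
  have r: "r \<nu> $ k $ l = cf A \<nu> (f k) (h l)" for \<nu> k l by (simp add: r_def)
  have *: "\<rho> \<in> wiener \<and> fourier_coeff \<rho> = r"
    by (intro conjI wienerI[of r]) (auto simp: r summable_cf \<rho> symf_def)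
  show "\<rho> \<in> wiener" using * by simp
  show "fourier_coeff \<rho> \<nu> $ k $ l = cf A \<nu> (f k) (h l)" using * by (simp add: r)
qed

text \<open>The coefficients are recovered from the symbol as Fourier coefficients.\<close>

lemma symf_inject:
  fixes A B :: "(int \<times> 's::finite) bmat"
  assumes "laurent A" "laurent B" "\<And>\<zeta> s t. norm \<zeta> = 1 \<Longrightarrow> symf A \<zeta> s t = symf B \<zeta> s t"
  shows "A = B"
proof (rule laurent_eqI[OF assms(1,2)])
  fix \<nu> s t
  let ?\<rho> = "\<lambda>\<zeta>. \<chi> s t. symf A \<zeta> s t"
  have "fourier_coeff ?\<rho> \<nu> $ s $ t = cf A \<nu> s t"
    by (rule block_wiener(2)[where f = id and h = id, simplified]) simp
  moreover have "fourier_coeff ?\<rho> \<nu> $ s $ t = cf B \<nu> s t"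
    by (rule block_wiener(2)[where f = id and h = id, simplified]) (simp add: assms(3))
  ultimately show "cf A \<nu> s t = cf B \<nu> s t" by simp
qed

section \<open>Shifts and coordinate projections\<close>

definition sh :: "int \<Rightarrow> (int \<times> 's) bmat" where
  "sh m = Bmat (\<lambda>x y. if fst x = fst y + m \<and> snd x = snd y then 1 else 0)"

lemma ent_sh: "ent (sh m) x y = (if fst x = fst y + m \<and> snd x = snd y then 1 else 0)"
proof -
  have "row_bounded 1 (\<lambda>x y :: int \<times> 'a. if y = (\<lambda>z. (fst z - m, snd z)) x then 1 else 0)"
    and "row_bounded 1 (\<lambda>y x :: int \<times> 'a. if x = (\<lambda>z. (fst z + m, snd z)) y then 1 else 0)"
    by (rule row_bounded_diag; simp)+
  moreover have "(\<lambda>x y :: int \<times> 'a. if y = (\<lambda>z. (fst z - m, snd z)) x then 1 else 0)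
      = (\<lambda>x y. if fst x = fst y + m \<and> snd x = snd y then 1 else (0::complex))"
    and "(\<lambda>y x :: int \<times> 'a. if x = (\<lambda>z. (fst z + m, snd z)) y then 1 else 0)
      = (\<lambda>y x. if fst x = fst y + m \<and> snd x = snd y then 1 else (0::complex))"
    by (auto intro!: ext)
  ultimately have "mbounded 1 (\<lambda>x y :: int \<times> 'a. if fst x = fst y + m \<and> snd x = snd y then 1 else 0)"
    unfolding mbounded_def by metis
  from ent_Bmat[OF this] show ?thesis by (simp add: sh_def)
qed

lemma ent_sh_mult [simp]: "ent (sh m * A) x y = ent A (fst x - m, snd x) y"
  by (subst ent_mult_supp[where a = "(fst x - m, snd x)"]) (auto simp: ent_sh prod_eq_iff)

lemma ent_mult_sh [simp]: "ent (A * sh m) x y = ent A x (fst y + m, snd y)"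
  by (subst ent_mult_supp[where a = "(fst y + m, snd y)"]) (auto simp: ent_sh prod_eq_iff)

lemma adj_sh: "adj (sh m) = sh (- m)"
  by (auto intro!: bmat_eqI simp: ent_sh prod_eq_iff)

lemma laurent_sh_commute: "laurent A \<Longrightarrow> sh m * A = A * sh m"
  by (rule bmat_eqI) (auto simp: laurent_ent algebra_simps split: prod.splits)

lemma ent_mult_fibre:
  fixes A B :: "(int \<times> 's::finite) bmat"
  assumes "\<And>n u. n \<noteq> m \<Longrightarrow> ent A x (n, u) * ent B (n, u) y = 0"
  shows "ent (A * B) x y = (\<Sum>u\<in>UNIV. ent A x (m, u) * ent B (m, u) y)"
proof -
  have "ent (A * B) x y = (\<Sum>\<^sub>\<infinity>z\<in>Pair m ` UNIV. ent A x z * ent B z y)"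
    unfolding ent_mult mprod_def by (rule infsum_cong_neutral) (use assms in \<open>auto simp: image_iff\<close>)
  then show ?thesis by (simp add: sum.reindex inj_on_def)
qed

lemma ent_mult_eq_zero:
  assumes "\<And>z. ent A x z * ent B z y = 0" shows "ent (A * B) x y = 0"
  by (simp add: ent_mult mprod_def assms)

lemma mbounded_pr_mult: "mbounded C (ent A) \<Longrightarrow> mbounded C (ent (pr S * A))"
  by (erule mbounded_mono; simp)

lemma summable_tail_small:
  fixes f :: "int \<Rightarrow> real"
  assumes f: "f summable_on UNIV" "\<And>\<nu>. 0 \<le> f \<nu>" and e: "0 < e"
  shows "\<exists>N\<ge>0. \<forall>F. finite F \<and> F \<subseteq> {N..} \<longrightarrow> sum f F \<le> e"
proof -
  obtain G where G: "finite G" "dist (sum f G) (infsum f UNIV) \<le> e"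
    using infsum_finite_approximation[OF f(1) e] by auto
  obtain N where N: "\<And>n. n \<in> G \<Longrightarrow> n < N" "N \<ge> 0"
  proof
    show "n < max 0 (Max (insert 0 G) + 1)" if "n \<in> G" for n
      using that G(1) Max_ge[of "insert 0 G" n] by simp
  qed simp
  have "sum f F \<le> e" if F: "finite F" "F \<subseteq> {N..}" for F
  proof -
    have "F \<inter> G = {}" using F(2) N(1) by force
    then have "sum f F + sum f G = sum f (F \<union> G)" using F(1) G(1) by (simp add: sum.union_disjoint)
    also have "\<dots> \<le> infsum f UNIV" using f F(1) G(1) by (intro finite_sum_le_infsum) auto
    finally show ?thesis using G(2) by (simp add: dist_real_def)
  qed
  then show ?thesis using N(2) by blast
qed

text \<open>Along a row or column of a Laurent matrix the diagonal index \<open>g i\<close> takes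
  each value at most once; if the values that count are at least N, the sum is part of a tail of
  f.\<close>

lemma sum_fibres_le:
  fixes n :: "int \<times> 's::finite \<Rightarrow> real"
  assumes F: "finite F" and n0: "\<And>x. 0 \<le> n x" and le: "\<And>i. (\<Sum>s\<in>UNIV. n (i, s)) \<le> (if R i then f (g i) else 0)"
    and g: "inj g" and N: "\<And>i. R i \<Longrightarrow> N \<le> g i"
    and tail: "\<And>G. finite G \<Longrightarrow> G \<subseteq> {N..} \<Longrightarrow> sum f G \<le> (e :: real)"
  shows "(\<Sum>x\<in>F. n x) \<le> e"
proof -
  have "(\<Sum>x\<in>F. n x) \<le> (\<Sum>x\<in>fst ` F \<times> UNIV. n x)"
    by (rule sum_mono2) (use F n0 in \<open>auto intro: rev_image_eqI\<close>)
  also have "\<dots> = (\<Sum>i\<in>fst ` F. \<Sum>s\<in>UNIV. n (i, s))"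
    by (simp only: sum.cartesian_product split_def prod.collapse)
  also have "\<dots> \<le> (\<Sum>i\<in>fst ` F. if R i then f (g i) else 0)"
    by (intro sum_mono le)
  also have "\<dots> = (\<Sum>i\<in>{i\<in>fst ` F. R i}. f (g i))"
    by (rule sum.inter_filter[symmetric]) (use F in simp)
  also have "\<dots> = sum f (g ` {i\<in>fst ` F. R i})"
    by (subst sum.reindex) (auto intro: inj_on_subset[OF g])
  also have "\<dots> \<le> e" by (rule tail) (use F N in auto)
  finally show ?thesis .
qed

text \<open>Entries with row index at least N and column index at most 0 lie on diagonals of index
  at least N, so their row and column sums are bounded by tails of a convergent series.\<close>

lemma hankel_tail_small:
  fixes A :: "(int \<times> 's::finite) bmat"
  assumes A: "laurent A" and e: "0 < e"
  shows "\<exists>N\<ge>0. mbounded e (ent (pr ({N..} \<times> UNIV) * A * pr ({..0} \<times> UNIV)))"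
proof -
  define f where "f \<nu> = (\<Sum>s\<in>UNIV. \<Sum>t\<in>UNIV. norm (cf A \<nu> s t))" for \<nu>
  have f: "f summable_on UNIV" unfolding f_def by (intro infsum_sum(1) summable_cf)
  have f0: "0 \<le> f \<nu>" for \<nu> by (simp add: f_def sum_nonneg)
  obtain N where N: "N \<ge> 0" "\<And>F. finite F \<Longrightarrow> F \<subseteq> {N..} \<Longrightarrow> sum f F \<le> e"
    using summable_tail_small[OF f f0 e] by blast
  let ?T = "pr ({N..} \<times> UNIV) * A * pr ({..0} \<times> UNIV)"
  have T: "ent ?T (i, s) (j, t) = (if N \<le> i \<and> j \<le> 0 then cf A (i - j) s t else 0)" for i j s t
    by (simp add: laurent_ent[OF A])
  have row: "(\<Sum>t\<in>UNIV. norm (cf A \<nu> s t)) \<le> f \<nu>" for \<nu> s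
    unfolding f_def by (rule member_le_sum) (auto intro: sum_nonneg)
  have col: "(\<Sum>s\<in>UNIV. norm (cf A \<nu> s t)) \<le> f \<nu>" for \<nu> t
    unfolding f_def by (intro sum_mono member_le_sum) auto
  have "(\<Sum>y\<in>F. norm (ent ?T (i, s) y)) \<le> e" if "finite F" for F i s
    by (rule sum_fibres_le[where R = "\<lambda>j. N \<le> i \<and> j \<le> 0" and g = "\<lambda>j. i - j", OF that _ _ _ _ N(2)])
       (use row in \<open>auto simp: T inj_def simp del: ent_pr_mult ent_mult_pr\<close>)
  moreover have "(\<Sum>x\<in>F. norm (ent ?T x (j, t))) \<le> e" if "finite F" for F j t
    by (rule sum_fibres_le[where R = "\<lambda>i. N \<le> i \<and> j \<le> 0" and g = "\<lambda>i. i - j", OF that _ _ _ _ N(2)])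
       (use col in \<open>auto simp: T inj_def simp del: ent_pr_mult ent_mult_pr\<close>)
  ultimately have "mbounded e (ent ?T)" by (simp only: mbounded_def row_bounded_def split_paired_all) simp
  then show ?thesis using N(1) by blast
qed

section \<open>The operator identities\<close>

type_synonym ('p, 'q) bl = "(int \<times> ('p + 'q)) bmat"

definition e1 :: "('p, 'q) bl" where "e1 = pr (UNIV \<times> range Inl)"
definition e2 :: "('p, 'q) bl" where "e2 = pr (UNIV \<times> range Inr)"
definition pp :: "('p, 'q) bl" where "pp = pr ({0..} \<times> range Inl)"
definition pm :: "('p, 'q) bl" where "pm = pr ({..0} \<times> range Inr)"
text \<open>Index 0 belongs to Q in the first component only. Hence \<open>e1 * Q = pp\<close> and
  \<open>e2 * (1 - Q) = pm\<close>, the identities of the spaces on which \<open>M11\<close> and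
  \<open>M22\<close> act.\<close>

definition Q :: "('p, 'q) bl" where "Q = pr ({0..} \<times> range Inl \<union> {0<..} \<times> range Inr)"
definition eps :: "int \<Rightarrow> (int \<times> 's) bmat" where "eps j = pr ({j} \<times> UNIV)"

lemmas proj_defs = e1_def e2_def pp_def pm_def Q_def eps_def

lemma range_Inl_iff [simp]: "s \<in> range Inl \<longleftrightarrow> isl s" and range_Inr_iff [simp]: "s \<in> range Inr \<longleftrightarrow> \<not> isl s"
  by (cases s; auto)+

lemma ent_proj [simp]:
  "ent (e1 * A) x y = (if isl (snd x) then ent A x y else 0)"
  "ent (e2 * A) x y = (if isl (snd x) then 0 else ent A x y)"
  "ent (pp * A) x y = (if 0 \<le> fst x \<and> isl (snd x) then ent A x y else 0)"
  "ent (pm * A) x y = (if fst x \<le> 0 \<and> \<not> isl (snd x) then ent A x y else 0)"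
  "ent (Q * A) x y = (if 0 \<le> fst x \<and> isl (snd x) \<or> 0 < fst x \<and> \<not> isl (snd x) then ent A x y else 0)"
  "ent (eps j * B) w z = (if fst w = j then ent B w z else 0)"
  "ent (A * e1) x y = (if isl (snd y) then ent A x y else 0)"
  "ent (A * e2) x y = (if isl (snd y) then 0 else ent A x y)"
  "ent (A * pp) x y = (if 0 \<le> fst y \<and> isl (snd y) then ent A x y else 0)"
  "ent (A * pm) x y = (if fst y \<le> 0 \<and> \<not> isl (snd y) then ent A x y else 0)"
  "ent (A * Q) x y = (if 0 \<le> fst y \<and> isl (snd y) \<or> 0 < fst y \<and> \<not> isl (snd y) then ent A x y else 0)"
  "ent (B * eps j) w z = (if fst z = j then ent B w z else 0)"
  by (auto simp: proj_defs mem_Times_iff)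

lemma ent_proj':
  "ent e1 x y = (if x = y \<and> isl (snd x) then 1 else 0)"
  "ent e2 x y = (if x = y \<and> \<not> isl (snd x) then 1 else 0)"
  "ent pp x y = (if x = y \<and> 0 \<le> fst x \<and> isl (snd x) then 1 else 0)"
  "ent pm x y = (if x = y \<and> fst x \<le> 0 \<and> \<not> isl (snd x) then 1 else 0)"
  "ent Q x y = (if x = y \<and> (0 \<le> fst x \<and> isl (snd x) \<or> 0 < fst x \<and> \<not> isl (snd x)) then 1 else 0)"
  "ent (eps j) w z = (if w = z \<and> fst w = j then 1 else 0)"
  by (auto simp: proj_defs mem_Times_iff ent_pr)

lemma adj_proj [simp]: "adj e1 = e1" "adj e2 = e2" "adj pp = pp" "adj pm = pm" "adj Q = Q" "adj (eps j) = eps j"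
  by (simp_all add: proj_defs)

lemma laurent_e1: "laurent e1" and laurent_e2: "laurent e2"
  by (simp_all add: e1_def e2_def laurent_pr)

lemma e1_plus_e2: "e1 + e2 = 1"
  by (rule bmat_eqI) (simp add: ent_proj' ent_one)

lemma proj_mult:
  "e1 * e1 = e1" "e2 * e2 = e2" "e1 * e2 = 0" "e2 * e1 = 0" "pp * pp = pp" "pm * pm = pm" "Q * Q = Q"
  "e1 * pp = pp" "pp * e1 = pp" "e2 * pp = 0" "pp * e2 = 0" "pp * pm = 0" "pm * pp = 0"
  "e2 * pm = pm" "pm * e2 = pm" "e1 * pm = 0" "pm * e1 = 0" "eps j * eps j = eps j"
  by (rule bmat_eqI; force simp: ent_proj')+

text \<open>For rewriting in products nested to the right, where \<open>A * B\<close> is not a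
  visible subterm.\<close>

lemma mult_assoc_eq: "A * B = C \<Longrightarrow> A * (B * X) = C * X" for A :: "'a::semigroup_mult"
  by (simp flip: mult.assoc)

lemmas proj_simps = proj_mult proj_mult[THEN mult_assoc_eq]

lemma e_split: "A * e1 + A * e2 = A" "e1 * A + e2 * A = A"
  by (simp_all add: e1_plus_e2 flip: distrib_left distrib_right)

lemma e_split_mid: "A * e1 * B + A * e2 * B = A * B"
  by (metis distrib_right e_split(1))

lemma blockdiag_commute:
  fixes A :: "('p, 'q) bl"
  assumes "\<And>i s j t. ent A (i, s) (j, t) \<noteq> 0 \<Longrightarrow> i = j \<and> isl s = isl t"
    and "\<And>i s t. isl s = isl t \<Longrightarrow> (i, s) \<in> S \<longleftrightarrow> (i, t) \<in> S"
  shows "pr S * A = A * pr S"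
proof (rule bmat_eqI)
  fix x y
  show "ent (pr S * A) x y = ent (A * pr S) x y"
    using assms(1)[of "fst x" "snd x" "fst y" "snd y"] assms(2)[of "snd x" "snd y" "fst x"]
    by (cases x; cases y) auto
qed

text \<open>\<open>D\<close> stands for \<open>diag (a\<^sub>0, - d\<^sub>0)\<close> and \<open>D'\<close> for its inverse.\<close>

locale eg =
  fixes \<Phi> D D' :: "('p::finite, 'q::finite) bl"
  assumes lau: "laurent \<Phi>" "laurent D" "laurent D'"
    and tri1: "isl s \<Longrightarrow> i < j \<Longrightarrow> ent \<Phi> (i, s) (j, t) = 0"
    and tri2: "\<not> isl s \<Longrightarrow> j < i \<Longrightarrow> ent \<Phi> (i, s) (j, t) = 0"
    and D_inv: "D * D' = 1" "D' * D = 1"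
    and cf_D: "cf D \<nu> s t = (if \<nu> = 0 \<and> isl s = isl t then (if isl s then cf \<Phi> 0 s t else - cf \<Phi> 0 s t) else 0)"
    and cf_D': "cf D' \<nu> s t \<noteq> 0 \<Longrightarrow> \<nu> = 0 \<and> isl s = isl t"
begin

lemma D'_commute:
  "(\<And>i s t. isl s = isl t \<Longrightarrow> (i, s) \<in> S \<longleftrightarrow> (i, t) \<in> S) \<Longrightarrow> pr S * D' = D' * pr S"
  by (rule blockdiag_commute) (use cf_D' in \<open>force simp: laurent_ent[OF lau(3)]\<close>)

lemma D'_proj: "e1 * D' = D' * e1" "e2 * D' = D' * e2" "Q * D' = D' * Q"
  unfolding proj_defs by (rule D'_commute; simp)+

text \<open>\<open>\<Psi>\<close> is the Laurent matrix with rows \<open>(I, g)\<close> and \<open>(g\<^sup>*, I)\<close>; see \<open>solution_iff_EG\<close>.\<close>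

definition EG :: "('p, 'q) bl \<Rightarrow> bool" where
  "EG \<Psi> \<longleftrightarrow> laurent \<Psi> \<and> adj \<Psi> = \<Psi> \<and> e1 * \<Psi> * e1 = e1 \<and> e2 * \<Psi> * e2 = e2 \<and>
     pp * (\<Psi> * \<Phi> - 1) * eps 0 = 0 \<and> pm * (\<Psi> * \<Phi> - 1) * eps 0 = 0"

text \<open>\<open>\<Psi> * \<Phi>\<close> is Laurent, so the conditions imposed at index 0 by
  \<open>eps 0\<close> spread to all columns.\<close>

lemma EG_entries:
  assumes "EG \<Psi>"
  shows "isl s \<Longrightarrow> j \<le> i \<Longrightarrow> ent (\<Psi> * \<Phi>) (i, s) (j, t) = (if i = j \<and> s = t then 1 else 0)"
    and "\<not> isl s \<Longrightarrow> i \<le> j \<Longrightarrow> ent (\<Psi> * \<Phi>) (i, s) (j, t) = (if i = j \<and> s = t then 1 else 0)"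
proof -
  have l: "laurent (\<Psi> * \<Phi>)" using assms lau(1) by (simp add: EG_def laurent_mult)
  { assume a: "isl s" "j \<le> i"
    have z: "pp * (\<Psi> * \<Phi> - 1) * eps 0 = 0" using assms by (simp add: EG_def)
    have "ent (pp * (\<Psi> * \<Phi> - 1) * eps 0) (i - j, s) (0, t) = 0" by (simp only: z ent_zero)
    then have "ent (\<Psi> * \<Phi>) (i - j, s) (0, t) = (if i = j \<and> s = t then 1 else 0)" using a by (simp add: ent_one)
    then show "ent (\<Psi> * \<Phi>) (i, s) (j, t) = (if i = j \<and> s = t then 1 else 0)"
      by (simp add: laurent_ent[OF l]) }
  { assume a: "\<not> isl s" "i \<le> j"
    have z: "pm * (\<Psi> * \<Phi> - 1) * eps 0 = 0" using assms by (simp add: EG_def)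
    have "ent (pm * (\<Psi> * \<Phi> - 1) * eps 0) (i - j, s) (0, t) = 0" by (simp only: z ent_zero)
    then have "ent (\<Psi> * \<Phi>) (i - j, s) (0, t) = (if i = j \<and> s = t then 1 else 0)" using a by (simp add: ent_one)
    then show "ent (\<Psi> * \<Phi>) (i, s) (j, t) = (if i = j \<and> s = t then 1 else 0)"
      by (simp add: laurent_ent[OF l]) }
qed

text \<open>With \<open>N = \<Psi> \<Phi>\<close> one has \<open>\<Phi>\<^sup>* J \<Phi> = \<Phi>\<^sup>* e1 N - N\<^sup>* e2 \<Phi>\<close>; the right-hand side is upper triangular, the
  left-hand side Hermitian, so both are block diagonal.\<close>

lemma EG_imp_D1:
  assumes "EG \<Psi>" shows "adj \<Phi> * (e1 - e2) * \<Phi> = D"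
proof -
  define N where "N = \<Psi> * \<Phi>"
  define X where "X = adj \<Phi> * (e1 - e2) * \<Phi>"
  have \<Psi>: "adj \<Psi> = \<Psi>" "e1 * \<Psi> * e1 = e1" "e2 * \<Psi> * e2 = e2" using assms by (auto simp: EG_def)
  \<comment> \<open>The off-diagonal block \<open>e1 * \<Psi> * e2\<close> occurs in both terms and
    cancels, so g disappears and \<open>e1 - e2\<close> remains.\<close>
  have "e1 * \<Psi> - \<Psi> * e2 = e1 * \<Psi> * e1 - e2 * \<Psi> * e2"
  proof -
    have "a - d = b - f" if "b + c = a" "c + f = d" for a b c d f :: "('p, 'q) bl"
      using that by auto
    from this[OF e_split(1)[of "e1 * \<Psi>"] e_split(2)[of "\<Psi> * e2", folded mult.assoc]] show ?thesis .
  qed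
  then have "e1 - e2 = e1 * \<Psi> - \<Psi> * e2" by (simp only: \<Psi>)
  then have X_eq: "X = (adj \<Phi> * e1) * N - (adj N * e2) * \<Phi>"
    unfolding X_def N_def adj_mult \<Psi>(1) by (simp only:) (simp add: algebra_simps)
  have lX: "laurent X" unfolding X_def
    by (intro laurent_mult laurent_adj laurent_minus laurent_e1 laurent_e2 lau)
  have adjX: "adj X = X" by (simp add: X_def adj_mult adj_minus mult.assoc)
  have N1: "ent N (i, s) (j, t) = (if i = j \<and> s = t then 1 else 0)" if "isl s" "j \<le> i" for i j s t
    using EG_entries(1)[OF assms that] by (simp add: N_def)
  have N2: "ent N (i, s) (j, t) = (if i = j \<and> s = t then 1 else 0)" if "\<not> isl s" "i \<le> j" for i j s t
    using EG_entries(2)[OF assms that] by (simp add: N_def)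
  \<comment> \<open>At each intermediate index z either the triangularity of \<Phi> or the
    strictness of the conditions on N makes a factor vanish.\<close>
  have X_low: "ent X (i, s) (j, t) = 0" if "j < i" for i j s t
  proof -
    have "ent ((adj \<Phi> * e1) * N) (i, s) (j, t) = 0"
    proof (rule ent_mult_eq_zero)
      fix z :: "int \<times> ('p + 'q)"
      show "ent (adj \<Phi> * e1) (i, s) z * ent N z (j, t) = 0"
        using that tri1[of "snd z" "fst z" i s] N1[of "snd z" j "fst z" t] by (cases "fst z < i") auto
    qed
    moreover have "ent ((adj N * e2) * \<Phi>) (i, s) (j, t) = 0"
    proof (rule ent_mult_eq_zero)
      fix z :: "int \<times> ('p + 'q)"
      show "ent (adj N * e2) (i, s) z * ent \<Phi> z (j, t) = 0"
        using that tri2[of "snd z" j "fst z" t] N2[of "snd z" "fst z" i s] by (cases "j < fst z") auto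
    qed
    ultimately show ?thesis by (simp add: X_eq)
  qed
  have X_diag: "ent X (0, s) (0, t) = (if isl t then cnj (cf \<Phi> 0 t s) else 0) - (if isl s then 0 else cf \<Phi> 0 s t)" for s t
  proof -
    have "ent ((adj \<Phi> * e1) * N) (0, s) (0, t) = (\<Sum>u\<in>UNIV. ent (adj \<Phi> * e1) (0, s) (0, u) * ent N (0, u) (0, t))"
    proof (rule ent_mult_fibre)
      fix n :: int and u :: "'p + 'q" assume "n \<noteq> 0"
      then show "ent (adj \<Phi> * e1) (0, s) (n, u) * ent N (n, u) (0, t) = 0"
        using tri1[of u n 0 s] N1[of u 0 n t] by (cases "n < 0") auto
    qed
    also have "\<dots> = (\<Sum>u\<in>UNIV. if u = t then (if isl t then cnj (cf \<Phi> 0 t s) else 0) else 0)"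
      by (rule sum.cong) (auto simp: N1 cf_def)
    finally have 1: "ent ((adj \<Phi> * e1) * N) (0, s) (0, t) = (if isl t then cnj (cf \<Phi> 0 t s) else 0)" by simp
    have "ent ((adj N * e2) * \<Phi>) (0, s) (0, t) = (\<Sum>u\<in>UNIV. ent (adj N * e2) (0, s) (0, u) * ent \<Phi> (0, u) (0, t))"
    proof (rule ent_mult_fibre)
      fix n :: int and u :: "'p + 'q" assume "n \<noteq> 0"
      then show "ent (adj N * e2) (0, s) (n, u) * ent \<Phi> (n, u) (0, t) = 0"
        using tri2[of u 0 n t] N2[of u n 0 s] by (cases "0 < n") auto
    qed
    also have "\<dots> = (\<Sum>u\<in>UNIV. if u = s then (if isl s then 0 else cf \<Phi> 0 s t) else 0)"
      by (rule sum.cong) (auto simp: N2 cf_def)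
    finally show ?thesis using 1 by (simp add: X_eq)
  qed
  have X_herm: "ent X x y = cnj (ent X y x)" for x y by (metis adjX ent_adj)
  have "X = D"
  proof (rule laurent_eqI[OF lX lau(2)])
    fix \<nu> s t
    have "cf X \<nu> s t = 0" if "\<nu> \<noteq> 0"
      using that X_low[of 0 \<nu> s t] X_low[of \<nu> 0 t s] X_herm[of "(\<nu>, s)" "(0, t)"]
      by (cases "0 < \<nu>") (auto simp: cf_def)
    \<comment> \<open>The upper right block is zero by \<open>X_diag\<close>, the lower left one
      then by Hermitian symmetry, which also turns the conjugate transpose of a_0 in the first
      diagonal block into a_0.\<close>
    moreover have "cf X 0 s t = cf D 0 s t"
      using X_diag[of s t] X_diag[of t s] X_herm[of "(0, s)" "(0, t)"]
      by (cases "isl s"; cases "isl t") (auto simp: cf_D cf_def[of X])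
    ultimately show "cf X \<nu> s t = cf D \<nu> s t" by (cases "\<nu> = 0") (auto simp: cf_D)
  qed
  then show ?thesis by (simp add: X_def)
qed

end

text \<open>At each point of the circle the symbols are finite square matrices, whose one-sided
  inverses are two-sided. Infinite matrices in general do not behave like this.\<close>

lemma laurent_left_right_inverse:
  fixes A B :: "(int \<times> 's::finite) bmat"
  assumes A: "laurent A" and B: "laurent B" and AB: "A * B = 1" shows "B * A = 1"
proof (rule symf_inject[OF laurent_mult[OF B A] laurent_one])
  fix \<zeta> :: complex and s t :: 's assume \<zeta>: "norm \<zeta> = 1"
  define MA MB where "MA = (\<chi> s t. symf A \<zeta> s t)" and "MB = (\<chi> s t. symf B \<zeta> s t)"
  have "MA ** MB = mat 1"
    by (simp add: vec_eq_iff MA_def MB_def matrix_matrix_mult_def mat_def symf_mult[OF A B \<zeta>, symmetric] AB symf_one)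
  then have "MB ** MA = mat 1" by (simp add: matrix_left_right_inverse)
  then have "(MB ** MA) $ s $ t = (mat 1 :: complex^'s^'s) $ s $ t" by simp
  then show "symf (B * A) \<zeta> s t = symf 1 \<zeta> s t"
    by (simp add: MA_def MB_def matrix_matrix_mult_def mat_def symf_mult[OF B A \<zeta>] symf_one)
qed

section \<open>The oblique projection given by (D1) and its blocks\<close>

locale eg_D1 = eg \<Phi> D D' for \<Phi> D D' :: "('p::finite, 'q::finite) bl" +
  assumes D1: "adj \<Phi> * (e1 - e2) * \<Phi> = D"
begin

lemma adj_D: "adj D = D"
proof -
  have "adj (adj \<Phi> * (e1 - e2) * \<Phi>) = adj \<Phi> * (e1 - e2) * \<Phi>" by (simp add: adj_mult adj_minus mult.assoc)
  then show ?thesis by (simp only: D1)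
qed

lemma adj_D': "adj D' = D'"
proof -
  have "adj D' * D = 1" using arg_cong[OF D_inv(1), of adj] by (simp add: adj_mult adj_D)
  then have "adj D' * (D * D') = D'" by (simp flip: mult.assoc)
  then show ?thesis by (simp add: D_inv)
qed

text \<open>\<open>E (e1 - e2)\<close> is idempotent, and \<open>E\<close> differs only by \<open>e2\<close> from the block operator with entries
  \<open>A11\<close>, \<open>A12\<close>, \<open>A21\<close>, \<open>A22\<close>, of which \<open>A11\<close> and \<open>A22\<close> are \<open>M11\<close> and \<open>M22\<close> extended by zero to
  all of \<open>\<int>\<close>; see \<open>M11_act\<close> and \<open>M22_act\<close>.\<close>

definition E :: "('p, 'q) bl" where "E = \<Phi> * Q * D' * adj \<Phi>"

definition "A11 = e1 * E * e1"
definition "A12 = e1 * E * e2"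
definition "A21 = e2 * E * e1"
definition "A22 = e2 * E * e2 + e2"

lemma JJ: "(e1 - e2) * (e1 - e2) = (1 :: ('p, 'q) bl)"
  by (simp add: algebra_simps proj_mult e1_plus_e2)

text \<open>(D1) exhibits \<open>D' * adj \<Phi> * (e1 - e2)\<close> as a left inverse of \<Phi>;
  being Laurent, it is a right inverse too.\<close>

lemma \<Phi>_D'_\<Phi>: "\<Phi> * D' * adj \<Phi> = e1 - e2"
proof -
  have "(D' * adj \<Phi> * (e1 - e2)) * \<Phi> = 1" using D1 D_inv by (simp add: mult.assoc)
  then have "\<Phi> * (D' * adj \<Phi> * (e1 - e2)) = 1"
    by (rule laurent_left_right_inverse[rotated 2]) (intro laurent_mult laurent_minus laurent_adj laurent_e1 laurent_e2 lau)+
  then have "\<Phi> * (D' * adj \<Phi> * (e1 - e2)) * (e1 - e2) = e1 - e2" by simp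
  then show ?thesis by (simp only: mult.assoc JJ mult_1_right)
qed

text \<open>A second factorization with \<open>1 - Q\<close> in place of Q. E itself controls the
  first block row, this difference the second one.\<close>

lemma E_compl: "(e1 - e2) - E = \<Phi> * (1 - Q) * D' * adj \<Phi>"
  by (simp add: E_def algebra_simps flip: \<Phi>_D'_\<Phi>)

lemma adj_E: "adj E = E"
  by (simp add: E_def adj_mult adj_D' D'_proj mult.assoc)

lemma D1_assoc: "adj \<Phi> * ((e1 - e2) * (\<Phi> * X)) = D * X"
  by (simp only: D1[symmetric] mult.assoc)

lemma EJE: "E * (e1 - e2) * E = E"
  by (simp only: E_def mult.assoc D1_assoc D_inv[THEN mult_assoc_eq] mult_1_left proj_mult[THEN mult_assoc_eq])

text \<open>The range of \<open>1 - Q\<close> is invariant under the backward shift.\<close>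

lemma Q_sh_Q: "Q * (sh (- 1) * (Q * X)) = Q * (sh (- 1) * (X :: ('p, 'q) bl))"
  by (rule bmat_eqI) auto

text \<open>The shift commutes with all Laurent factors, so (D1) cancels the middle as in
  \<open>EJE\<close>; between the two copies of Q it is dealt with by \<open>Q_sh_Q\<close>.\<close>

lemma EJVE: "E * (e1 - e2) * sh (- 1) * E = E * sh (- 1)"
proof -
  have c: "sh m * (\<Phi> * X) = \<Phi> * (sh m * X)" "sh m * (D' * X) = D' * (sh m * X)" for m X
    using laurent_sh_commute[OF lau(1)] laurent_sh_commute[OF lau(3)] by (simp_all flip: mult.assoc)
  have c': "sh m * adj \<Phi> = adj \<Phi> * sh m" for m
    using laurent_sh_commute[OF laurent_adj[OF lau(1)]] .
  show ?thesis
    by (simp only: E_def mult.assoc c D1_assoc D_inv[THEN mult_assoc_eq] mult_1_left Q_sh_Q c')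
qed

text \<open>A nonzero entry in a row of the first component has row index at least its column index,
  and the latter is nonnegative under Q.\<close>

lemma e1_\<Phi>_Q: "e1 * \<Phi> * Q = pp * \<Phi> * Q"
  using tri1 by (intro bmat_eqI) (auto split: prod.splits)

lemma e2_\<Phi>_Q: "e2 * \<Phi> * (1 - Q) = pm * \<Phi> * (1 - Q)"
  using tri2 by (intro bmat_eqI) (auto simp: right_diff_distrib split: prod.splits)

lemma e1_E: "e1 * E = pp * E"
  by (simp only: E_def e1_\<Phi>_Q flip: mult.assoc)

lemma e2_E: "e2 * ((e1 - e2) - E) = pm * ((e1 - e2) - E)"
  by (simp only: E_compl e2_\<Phi>_Q flip: mult.assoc)

lemma adj_A: "adj A11 = A11" "adj A12 = A21" "adj A21 = A12" "adj A22 = A22"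
  by (simp_all add: A11_def A12_def A21_def A22_def adj_mult adj_add adj_E mult.assoc)

lemma e2_E': "e2 * E * e1 = pm * E * e1" "e2 * E * e2 + e2 = pm * E * e2 + pm"
proof -
  have "e2 * ((e1 - e2) - E) * e1 = pm * ((e1 - e2) - E) * e1" "e2 * ((e1 - e2) - E) * e2 = pm * ((e1 - e2) - E) * e2"
    by (simp_all only: e2_E)
  then show "e2 * E * e1 = pm * E * e1" "e2 * E * e2 + e2 = pm * E * e2 + pm"
    by (simp_all add: algebra_simps proj_simps)
qed

lemma proj_A_left: "pp * A11 = A11" "pp * A12 = A12" "pm * A21 = A21" "pm * A22 = A22"
    "e1 * A11 = A11" "e1 * A12 = A12" "e2 * A21 = A21" "e2 * A22 = A22"
  unfolding A11_def A12_def A21_def A22_def e1_E e2_E'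
  by (simp_all add: mult.assoc distrib_left proj_simps)

lemma proj_A_right: "A11 * pp = A11" "A12 * pm = A12" "A21 * pp = A21" "A22 * pm = A22"
    "A11 * e1 = A11" "A12 * e2 = A12" "A21 * e1 = A21" "A22 * e2 = A22"
  using proj_A_left[THEN arg_cong[of _ _ adj]] by (simp_all add: adj_mult adj_A)

lemmas proj_A = proj_A_left proj_A_right proj_A_left[THEN mult_assoc_eq] proj_A_right[THEN mult_assoc_eq]

lemma E_blocks: "e1 * E * e1 = A11" "e1 * E * e2 = A12" "e2 * E * e1 = A21" "e2 * E * e2 = A22 - e2"
  by (simp_all add: A11_def A12_def A21_def A22_def)

lemma EJX: "E * (e1 - e2) * X = E * e1 * (e1 * X) - E * e2 * (e2 * X)"
  by (simp add: algebra_simps proj_simps)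

text \<open>The four blocks of \<open>EJE\<close>. The summand \<open>e2\<close> in
  \<open>A22\<close> absorbs the terms that are not products of two blocks.\<close>

lemma A_identities:
  "A11 * A11 - A12 * A21 = A11" "A11 * A12 = A12 * A22" "A22 * A21 = A21 * A11" "A22 * A22 - A21 * A12 = A22"
proof -
  have *: "a * E * e1 * (e1 * E * b) - a * E * e2 * (e2 * E * b) = a * E * b" for a b
    using arg_cong[OF EJE, of "\<lambda>X. a * X * b"] unfolding EJX by (simp add: algebra_simps)
  show "A11 * A11 - A12 * A21 = A11" using *[of e1 e1] by (simp only: E_blocks)
  show 1: "A11 * A12 = A12 * A22" using *[of e1 e2] by (simp only: E_blocks) (simp add: algebra_simps proj_A)
  show "A22 * A22 - A21 * A12 = A22" using *[of e2 e2] by (simp only: E_blocks) (simp add: algebra_simps proj_A proj_mult)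
  show "A22 * A21 = A21 * A11" using arg_cong[OF 1, of adj] by (simp add: adj_mult adj_A)
qed

lemma sh_e: "sh m * (e1 :: ('p, 'q) bl) = e1 * sh m" "sh m * (e2 :: ('p, 'q) bl) = e2 * sh m"
  by (simp_all add: laurent_sh_commute laurent_e1 laurent_e2)

text \<open>The first block row of \<open>EJVE\<close>; the shift commutes with \<open>e1\<close>
  and \<open>e2\<close> and therefore respects the block decomposition.\<close>

lemma A_shift_identities:
  "A11 * sh (- 1) * A11 - A12 * sh (- 1) * A21 = A11 * sh (- 1)" "A11 * sh (- 1) * A12 = A12 * sh (- 1) * A22"
proof -
  have *: "e1 * E * e1 * (sh (- 1) * (e1 * E * b)) - e1 * E * e2 * (sh (- 1) * (e2 * E * b)) = e1 * E * sh (- 1) * b" for b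
  proof -
    have "e1 * (E * (e1 - e2) * (sh (- 1) * E)) * b = e1 * E * sh (- 1) * b"
      using EJVE by (simp add: mult.assoc)
    then show ?thesis unfolding EJX
      by (simp add: algebra_simps sh_e sh_e[THEN mult_assoc_eq] proj_simps)
  qed
  have "e1 * E * sh (- 1) * e1 = A11 * sh (- 1)" "e1 * E * sh (- 1) * e2 = A12 * sh (- 1)"
    by (simp_all add: A11_def A12_def mult.assoc sh_e)
  then show "A11 * sh (- 1) * A11 - A12 * sh (- 1) * A21 = A11 * sh (- 1)" "A11 * sh (- 1) * A12 = A12 * sh (- 1) * A22"
    using *[of e1] *[of e2] unfolding E_blocks
    by (simp_all add: mult.assoc right_diff_distrib sh_e proj_A)
qed

text \<open>A nonzero entry of \<open>adj \<Phi>\<close> in these columns has row index at most 0,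
  and Q retains of those rows only index 0 of the first component, where the entries are those of D.
  Then \<open>D'\<close> cancels D.\<close>

lemma E_col1: "E * e1 * eps 0 = \<Phi> * e1 * eps 0"
proof -
  have D0: "ent D (i, s) (0, t) = cnj (ent \<Phi> (0, t) (0, s))" if "i = 0" "isl s" "isl t" for i s t
    using that cf_D[of 0 t s] arg_cong[OF adj_D, of "\<lambda>X. ent X (0, s) (0, t)"] by (simp add: cf_def)
  have D1: "ent D (i, s) (0, t) = 0" if "i \<noteq> 0 \<or> isl s \<noteq> isl t" for i s t
    using that cf_D[of i s t] by (auto simp: cf_def)
  have "Q * adj \<Phi> * e1 * eps 0 = D * e1 * eps 0"
  proof (rule bmat_eqI)
    fix x y :: "int \<times> ('p + 'q)"
    obtain i s j t where xy: "x = (i, s)" "y = (j, t)" by (cases x, cases y)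
    show "ent (Q * adj \<Phi> * e1 * eps 0) x y = ent (D * e1 * eps 0) x y"
      using tri1[of t 0 i s] D0[of i s t] D1[of i s t] unfolding xy by (cases "i = 0") auto
  qed
  then have "\<Phi> * D' * (Q * adj \<Phi> * e1 * eps 0) = \<Phi> * e1 * eps 0"
    using D_inv by (simp add: mult.assoc D_inv[THEN mult_assoc_eq])
  then show ?thesis by (simp add: E_def mult.assoc D'_proj[THEN mult_assoc_eq])
qed

text \<open>Here it is \<open>1 - Q\<close> that isolates index 0 of the second component, so the
  computation is made for \<open>(e1 - e2) - E\<close>.\<close>

lemma E_col2: "E * e2 * eps 0 = \<Phi> * e2 * eps 0 - e2 * eps 0"
proof -
  have D0: "ent D (i, s) (0, t) = - cnj (ent \<Phi> (0, t) (0, s))" if "i = 0" "\<not> isl s" "\<not> isl t" for i s t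
    using that cf_D[of 0 t s] arg_cong[OF adj_D, of "\<lambda>X. ent X (0, s) (0, t)"] by (simp add: cf_def)
  have D1: "ent D (i, s) (0, t) = 0" if "i \<noteq> 0 \<or> isl s \<noteq> isl t" for i s t
    using that cf_D[of i s t] by (auto simp: cf_def)
  have "(1 - Q) * adj \<Phi> * e2 * eps 0 = - (D * e2 * eps 0)"
  proof (rule bmat_eqI)
    fix x y :: "int \<times> ('p + 'q)"
    obtain i s j t where xy: "x = (i, s)" "y = (j, t)" by (cases x, cases y)
    show "ent ((1 - Q) * adj \<Phi> * e2 * eps 0) x y = ent (- (D * e2 * eps 0)) x y"
      using tri2[of t i 0 s] D0[of i s t] D1[of i s t] unfolding xy by (cases "i = 0") (auto simp: left_diff_distrib)
  qed
  then have "\<Phi> * D' * ((1 - Q) * adj \<Phi> * e2 * eps 0) = - (\<Phi> * e2 * eps 0)"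
    using D_inv by (simp add: mult.assoc D_inv[THEN mult_assoc_eq])
  then have "((e1 - e2) - E) * e2 * eps 0 = - (\<Phi> * e2 * eps 0)"
    unfolding E_compl by (simp add: algebra_simps D'_proj[THEN mult_assoc_eq])
  then show ?thesis by (simp add: algebra_simps proj_simps)
qed

text \<open>At index 0 the block operator agrees with \<Phi>. Thus the maps b and c are columns of
  \<open>A12\<close> and \<open>A21\<close>.\<close>

lemma A_columns:
  "A11 * eps 0 = e1 * \<Phi> * e1 * eps 0" "A21 * eps 0 = e2 * \<Phi> * e1 * eps 0"
  "A12 * eps 0 = e1 * \<Phi> * e2 * eps 0" "A22 * eps 0 = e2 * \<Phi> * e2 * eps 0"
  unfolding A11_def A12_def A21_def A22_def distrib_right
  using E_col1 E_col2 by (simp_all add: mult.assoc right_diff_distrib proj_simps)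

text \<open>The block operator with rows \<open>(I, G)\<close> and \<open>(G', I)\<close> is a left inverse of the one with entries \<open>A11\<close>, \<open>A12\<close>,
  \<open>A21\<close>, \<open>A22\<close>.\<close>

definition inverse_pair :: "('p, 'q) bl \<Rightarrow> ('p, 'q) bl \<Rightarrow> bool" where
  "inverse_pair G G' \<longleftrightarrow> A11 + G * A21 = pp \<and> A12 + G * A22 = 0 \<and> G' * A11 + A21 = 0 \<and> G' * A12 + A22 = pm"

text \<open>\<open>pp * \<Psi> * \<Phi>\<close> vanishes on the range of \<open>1 - Q\<close>, and
  \<open>pm * \<Psi> * \<Phi>\<close> on that of Q. By the two factorizations
  \<open>pp * \<Psi>\<close> annihilates \<open>(e1 - e2) - E\<close> and \<open>pm * \<Psi>\<close>
  annihilates E; the blocks of these two facts are the four equations.\<close>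

lemma EG_inverse_pair:
  assumes EG: "EG \<Psi>"
  shows "inverse_pair (pp * \<Psi> * pm) (pm * \<Psi> * pp)"
proof -
  have \<Psi>: "e1 * \<Psi> * e1 = e1" "e2 * \<Psi> * e2 = e2" using EG by (auto simp: EG_def)
  have N1: "pp * (\<Psi> * \<Phi>) * (1 - Q) = 0"
  proof (rule bmat_eqI)
    fix x y :: "int \<times> ('p + 'q)"
    obtain i s j t where xy: "x = (i, s)" "y = (j, t)" by (cases x, cases y)
    show "ent (pp * (\<Psi> * \<Phi>) * (1 - Q)) x y = ent 0 x y"
      using EG_entries(1)[OF EG, of s j i t] unfolding xy by (auto simp: right_diff_distrib)
  qed
  have N2: "pm * (\<Psi> * \<Phi>) * Q = 0"
  proof (rule bmat_eqI)
    fix x y :: "int \<times> ('p + 'q)"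
    obtain i s j t where xy: "x = (i, s)" "y = (j, t)" by (cases x, cases y)
    show "ent (pm * (\<Psi> * \<Phi>) * Q) x y = ent 0 x y"
      using EG_entries(2)[OF EG, of s i j t] unfolding xy by auto
  qed
  have "pp * \<Psi> * ((e1 - e2) - E) = pp * (\<Psi> * \<Phi>) * (1 - Q) * D' * adj \<Phi>"
    by (simp only: E_compl mult.assoc)
  then have "pp * \<Psi> * ((e1 - e2) - E) = 0" by (simp only: N1 mult_zero_left)
  then have P: "pp * \<Psi> * E = pp * \<Psi> * (e1 - e2)" by (simp only: right_diff_distrib[of _ "e1 - e2" E] right_minus_eq)
  have M: "pm * \<Psi> * E = 0"
    using N2 by (simp add: E_def flip: mult.assoc)
  have split: "X * \<Psi> * E * Y = X * \<Psi> * e1 * (e1 * E * Y) + X * \<Psi> * e2 * (e2 * E * Y)" for X Y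
    using e_split_mid[of "X * \<Psi>" "E * Y"] by (simp add: mult.assoc proj_simps)
  have p1: "pp * \<Psi> * e1 = pp" using arg_cong[OF \<Psi>(1), of "\<lambda>X. pp * X"] by (simp add: mult.assoc[symmetric] proj_simps)
  have p2: "pm * \<Psi> * e2 = pm" using arg_cong[OF \<Psi>(2), of "\<lambda>X. pm * X"] by (simp add: mult.assoc[symmetric] proj_simps)
  have "pp * A11 + pp * \<Psi> * e2 * A21 = pp * \<Psi> * E * e1"
    unfolding split E_blocks p1 ..
  then have a1: "A11 + pp * \<Psi> * pm * A21 = pp"
    unfolding P by (simp add: proj_A algebra_simps proj_simps p1[unfolded mult.assoc])
  have "pp * A12 + pp * \<Psi> * e2 * (A22 - e2) = pp * \<Psi> * E * e2"
    unfolding split E_blocks p1 ..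
  then have a2: "A12 + pp * \<Psi> * pm * A22 = 0"
    unfolding P by (simp add: proj_A algebra_simps proj_simps)
  have "pm * \<Psi> * e1 * A11 + pm * A21 = pm * \<Psi> * E * e1"
    unfolding split E_blocks p2 ..
  then have a3: "pm * \<Psi> * pp * A11 + A21 = 0"
    unfolding M by (simp add: proj_A mult.assoc)
  have "pm * \<Psi> * e1 * A12 + pm * (A22 - e2) = pm * \<Psi> * E * e2"
    unfolding split E_blocks p2 ..
  then have a4: "pm * \<Psi> * pp * A12 + A22 = pm"
    unfolding M by (simp add: proj_A algebra_simps proj_simps)
  show ?thesis using a1 a2 a3 a4 by (simp add: inverse_pair_def)
qed

text \<open>Inserting \<open>adj G * A11 = - A21\<close> into the first equation gives a left
  inverse of \<open>A11\<close>, and similarly for \<open>A22\<close>; adjoints turn left inverses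
  into right ones. The last two identities are the source of the formulas for g.\<close>

lemma inverse_pair_inverses:
  assumes ip: "inverse_pair G (adj G)" and G: "pp * G = G" "G * pm = G"
  shows "(pp - G * adj G) * A11 = pp" "A11 * (pp - G * adj G) = pp"
    "(pm - adj G * G) * A22 = pm" "A22 * (pm - adj G * G) = pm"
    "(pp - G * adj G) * A12 = - G" "(pm - adj G * G) * A21 = - adj G"
proof -
  have a: "A11 = pp - G * A21" "A12 = - (G * A22)" "adj G * A11 = - A21" "adj G * A12 = pm - A22"
    using ip by (auto simp: inverse_pair_def algebra_simps eq_neg_iff_add_eq_0)
  have G': "pm * adj G = adj G" "adj G * pp = adj G"
    using G[THEN arg_cong[of _ _ adj]] by (simp_all add: adj_mult)
  show 1: "(pp - G * adj G) * A11 = pp"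
    by (simp add: left_diff_distrib mult.assoc a(3) proj_A) (simp add: a(1))
  show 2: "(pm - adj G * G) * A22 = pm"
  proof -
    have "adj G * (G * A22) = - (adj G * A12)" by (simp add: a(2))
    then show ?thesis by (simp add: left_diff_distrib mult.assoc a(4) proj_A)
  qed
  show "A11 * (pp - G * adj G) = pp" using arg_cong[OF 1, of adj] by (simp add: adj_mult adj_minus adj_A)
  show "A22 * (pm - adj G * G) = pm" using arg_cong[OF 2, of adj] by (simp add: adj_mult adj_minus adj_A)
  show "(pp - G * adj G) * A12 = - G"
    by (simp add: left_diff_distrib mult.assoc a(4) proj_A right_diff_distrib G) (simp add: a(2))
  have "adj G * (G * A21) = adj G * pp - adj G * A11" by (simp add: a(1) right_diff_distrib)
  then show "(pm - adj G * G) * A21 = - adj G"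
    by (simp add: left_diff_distrib mult.assoc proj_A G' a(3))
qed

text \<open>By \<open>A_columns\<close> the columns of \<Phi> at index 0 are those of the block
  operator, so the four equations multiplied by \<open>eps 0\<close> add up to the two support
  conditions.\<close>

lemma inverse_pair_EG:
  assumes \<Gamma>: "laurent \<Gamma>" "e1 * \<Gamma> * e2 = \<Gamma>" and ip: "inverse_pair (pp * \<Gamma> * pm) (pm * adj \<Gamma> * pp)"
  shows "EG (1 + \<Gamma> + adj \<Gamma>)"
proof -
  let ?\<Psi> = "1 + \<Gamma> + adj \<Gamma>"
  have "e2 * (e1 * \<Gamma> * e2) = 0" "(e1 * \<Gamma> * e2) * e1 = 0" by (simp_all add: mult.assoc proj_simps)
  then have G0: "e2 * \<Gamma> = 0" "\<Gamma> * e1 = 0" by (simp_all only: \<Gamma>(2))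
  have G0': "e1 * adj \<Gamma> = 0" "adj \<Gamma> * e2 = 0" using G0[THEN arg_cong[of _ _ adj]] by (simp_all add: adj_mult)
  have pm0: "pm * \<Gamma> = 0" "pp * adj \<Gamma> = 0"
    using arg_cong[OF G0(1), of "\<lambda>X. pm * X"] arg_cong[OF G0'(1), of "\<lambda>X. pp * X"] by (simp_all add: proj_simps)
  have p\<Phi>: "e1 * \<Phi> * eps 0 = pp * \<Phi> * eps 0" "e2 * \<Phi> * eps 0 = pm * \<Phi> * eps 0"
    using tri1 tri2 by (auto intro!: bmat_eqI split: prod.splits)
  have "pm * (pm * \<Phi> * eps 0) = pm * \<Phi> * eps 0" "pp * (pp * \<Phi> * eps 0) = pp * \<Phi> * eps 0"
    by (simp_all add: mult.assoc proj_simps)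
  then have q: "pm * (e2 * \<Phi> * eps 0) = e2 * \<Phi> * eps 0" "pp * (e1 * \<Phi> * eps 0) = e1 * \<Phi> * eps 0"
    by (simp_all only: p\<Phi>)
  have G1: "\<Gamma> * X = \<Gamma> * (e2 * X)" "adj \<Gamma> * X = adj \<Gamma> * (e1 * X)" for X
    using e_split(2)[of X] G0(2) G0'(2) by (metis (no_types, lifting) add.right_neutral add.left_neutral distrib_left mult.assoc mult_zero_left)+
  have ee: "e1 * \<Phi> * eps 0 = A11 * eps 0 + A12 * eps 0" "e2 * \<Phi> * eps 0 = A21 * eps 0 + A22 * eps 0"
    using e_split_mid[of "e1 * \<Phi>" "eps 0"] e_split_mid[of "e2 * \<Phi>" "eps 0"] by (simp_all add: A_columns)
  have "pp * ?\<Psi> * \<Phi> * eps 0 = pp * \<Phi> * eps 0 + pp * (\<Gamma> * (e2 * \<Phi> * eps 0))"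
    using pm0 by (simp add: algebra_simps mult_assoc_eq[OF pm0(2)] flip: G1)
  also have "\<dots> = e1 * \<Phi> * eps 0 + pp * \<Gamma> * pm * (e2 * \<Phi> * eps 0)"
    by (simp only: mult.assoc[of "pp * \<Gamma>" pm] q p\<Phi>(1)) (simp only: mult.assoc[of pp \<Gamma>])
  also have "\<dots> = (A11 + pp * \<Gamma> * pm * A21) * eps 0 + (A12 + pp * \<Gamma> * pm * A22) * eps 0"
    unfolding ee by (simp add: algebra_simps)
  also have "\<dots> = pp * eps 0" using ip by (simp add: inverse_pair_def)
  finally have 1: "pp * (?\<Psi> * \<Phi> - 1) * eps 0 = 0"
    by (simp only: right_diff_distrib left_diff_distrib mult_1_right mult.assoc diff_self)
  have "pm * ?\<Psi> * \<Phi> * eps 0 = pm * \<Phi> * eps 0 + pm * (adj \<Gamma> * (e1 * \<Phi> * eps 0))"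
    using pm0 by (simp add: algebra_simps mult_assoc_eq[OF pm0(1)] flip: G1)
  also have "\<dots> = e2 * \<Phi> * eps 0 + pm * adj \<Gamma> * pp * (e1 * \<Phi> * eps 0)"
    by (simp only: mult.assoc[of "pm * adj \<Gamma>" pp] q p\<Phi>(2)) (simp only: mult.assoc[of pm "adj \<Gamma>"])
  also have "\<dots> = (pm * adj \<Gamma> * pp * A11 + A21) * eps 0 + (pm * adj \<Gamma> * pp * A12 + A22) * eps 0"
    unfolding ee by (simp add: algebra_simps)
  also have "\<dots> = pm * eps 0" using ip by (simp add: inverse_pair_def)
  finally have 2: "pm * (?\<Psi> * \<Phi> - 1) * eps 0 = 0"
    by (simp only: right_diff_distrib left_diff_distrib mult_1_right mult.assoc diff_self)
  show ?thesis unfolding EG_def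
    using 1 2 G0 G0' \<Gamma>(1)
    by (auto intro!: laurent_add laurent_one laurent_adj simp: adj_add algebra_simps proj_simps mult_assoc_eq[OF G0'(1)] mult_assoc_eq[OF G0(1)])
qed

text \<open>\<open>pp - A11\<close> factors through a Hankel matrix, whose rows far out are uniformly small.\<close>

lemma fredholm_A11:
  assumes inj: "\<And>X. pp * X = X \<Longrightarrow> A11 * X = 0 \<Longrightarrow> X = 0"
  shows "\<exists>X. X * pr {l} = X \<and> pp * X = X \<and> A11 * X = - A12 * pr {l}"
proof -
  define K where "K = pp - A11"
  define Z where "Z = (1 - Q) * D' * adj \<Phi> * pp"
  have "pp * ((e1 - e2) - E) * pp = pp * \<Phi> * Z"
    by (simp only: E_compl Z_def mult.assoc)
  moreover have "pp * ((e1 - e2) - E) * pp = pp - pp * A11 * pp"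
    by (simp add: A11_def algebra_simps proj_simps)
  ultimately have K: "K = pp * \<Phi> * Z" by (simp add: K_def proj_A)
  \<comment> \<open>The rows of Z have index at most 0, so only the Hankel part of \<Phi>, from
    indices at most 0 to nonnegative ones, enters K.\<close>
  have Z: "pr ({..0} \<times> UNIV) * Z = Z"
    unfolding Z_def by (rule bmat_eqI) (auto simp: left_diff_distrib mem_Times_iff mult.assoc)
  \<comment> \<open>The constant is chosen to leave the bound 1 / 2 after multiplication by
    Z.\<close>
  obtain N where N: "0 \<le> N" "mbounded (1 / (2 * bnd Z)) (ent (pr ({N..} \<times> UNIV) * \<Phi> * pr ({..0} \<times> UNIV)))"
    using hankel_tail_small[OF lau(1), of "1 / (2 * bnd Z)"] bnd_pos[of Z] by auto
  let ?F = "{0..<N} \<times> (UNIV :: ('p + 'q) set)"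
  have "pr (- ?F) * pp = pp * pr ({N..} \<times> (UNIV :: ('p + 'q) set))"
    using N(1) by (intro bmat_eqI) (auto simp: ent_proj' ent_pr)
  then have "pr (- ?F) * K = pp * (pr ({N..} \<times> UNIV) * \<Phi> * pr ({..0} \<times> UNIV)) * (pr ({..0} \<times> UNIV) * Z)"
    unfolding K by (simp add: mult.assoc pr_mult_pr[THEN mult_assoc_eq]) (simp add: Z flip: mult.assoc)
  moreover have "mbounded (1 / (2 * bnd Z)) (ent (pp * (pr ({N..} \<times> UNIV) * \<Phi> * pr ({..0} \<times> UNIV))))"
    unfolding pp_def by (rule mbounded_pr_mult[OF N(2)])
  ultimately have "mbounded (1 / (2 * bnd Z) * bnd Z) (ent (pr (- ?F) * K))"
    using mbounded_mprod[OF _ mbounded_ent[of Z]] by (simp only: Z ent_mult[of _ Z])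
  then have small: "mbounded (1 / 2) (ent (pr (- ?F) * K))" using bnd_pos[of Z] by simp
  have "\<exists>X. X * pr {l} = X \<and> X - K * X = - A12 * pr {l}"
  proof (rule fredholm[OF _ small])
    \<comment> \<open>A fixed point of K has its rows in the range of \<open>pp\<close>
      automatically, so the hypothesis on \<open>A11\<close> applies.\<close>
    fix X assume X: "K * X = X"
    have "pp * K = K" by (simp add: K_def right_diff_distrib proj_A proj_mult)
    then have ppX: "pp * X = X" using X by (metis mult.assoc)
    then have "A11 * X = 0" using X by (simp add: K_def left_diff_distrib)
    then show "X = 0" using inj ppX by blast
  qed (simp_all add: mult.assoc pr_mult_pr)
  then obtain X where X: "X * pr {l} = X" "X - K * X = - A12 * pr {l}" by blast
  have "X = K * X - A12 * pr {l}" using X(2) by (simp add: algebra_simps)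
  moreover have "pp * (K * X - A12 * pr {l}) = K * X - A12 * pr {l}"
    by (simp add: K_def algebra_simps proj_A proj_simps)
  ultimately have ppX: "pp * X = X" by metis
  have "A11 * X = - A12 * pr {l}" using X(2) ppX by (simp add: K_def left_diff_distrib)
  then show ?thesis using X(1) ppX by blast
qed

text \<open>The column of \<open>G\<close> with index \<open>j - 1\<close> is the backward shift of the column with index \<open>j\<close>, so the shift
  identities carry the equation downwards from \<open>j = 0\<close>; injectivity of \<open>A22\<close> is needed in each step.\<close>

lemma A11_G_all_columns:
  assumes inj22: "\<And>X. pm * X = X \<Longrightarrow> A22 * X = 0 \<Longrightarrow> X = 0"
    and \<Gamma>: "laurent \<Gamma>" "e1 * \<Gamma> * e2 = \<Gamma>" and G: "G = pp * \<Gamma> * pm"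
    and col0: "A11 * G * eps 0 = - A12 * eps 0"
  shows "A11 * G = - A12"
proof -
  have Gp: "pp * G = G" "G * pm = G" by (simp_all add: G mult.assoc proj_simps)
  have col: "A11 * G * eps (- int n) = - A12 * eps (- int n)" for n
  proof (induction n)
    case 0
    then show ?case using col0 by simp
  next
    case (Suc n)
    define j where "j = - int n"
    have IH: "A11 * (G * eps j) = - (A12 * eps j)" using Suc by (simp add: j_def mult.assoc)
    have pmj: "pm * eps j = e2 * (eps j :: ('p, 'q) bl)"
      by (rule bmat_eqI) (auto simp: ent_proj' j_def)
    have step: "eps (j - 1) = sh (- 1) * eps j * (sh 1 :: ('p, 'q) bl)"
      by (rule bmat_eqI) (auto simp: ent_sh ent_proj' prod_eq_iff)
    \<comment> \<open>Column j of \<open>A22 + A21 * G = pm\<close>: \<open>A22\<close> annihilates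
      the difference of the two sides, by the block identities and the induction hypothesis.\<close>
    have "(A22 + A21 * G) * eps j = pm * eps j"
    proof -
      have "A22 * ((A22 + A21 * G - pm) * eps j) = (A22 * A22 - A22) * eps j + A22 * A21 * (G * eps j)"
        by (simp add: algebra_simps proj_A)
      also have "A22 * A21 * (G * eps j) = - (A21 * A12 * eps j)"
        by (simp add: A_identities(3) mult.assoc IH)
      also have "(A22 * A22 - A22) * eps j + - (A21 * A12 * eps j) = (A22 * A22 - A21 * A12 - A22) * eps j"
        by (simp add: algebra_simps)
      also have "\<dots> = 0" by (simp add: A_identities(4))
      finally have "(A22 + A21 * G - pm) * eps j = 0"
        by (rule inj22[rotated]) (simp_all add: algebra_simps proj_A proj_simps)
      then show ?thesis by (simp add: left_diff_distrib)
    qed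
    then have Y: "A22 * eps j + A21 * (G * eps j) = e2 * eps j" by (simp add: distrib_right mult.assoc pmj)
    \<comment> \<open>Rows of negative index stay negative under the backward shift, so
      \<open>pp\<close> may be inserted to its right.\<close>
    have sh_pp: "pp * (sh (- 1) * ((e1 - pp) * X)) = 0" for X :: "('p, 'q) bl"
      by (rule bmat_eqI) (auto simp: left_diff_distrib)
    have pm_sh: "pm * (sh (- 1) * (eps j * X)) = e2 * (sh (- 1) * (eps j * X))" for X :: "('p, 'q) bl"
      by (rule bmat_eqI) (auto simp: j_def)
    have e1\<Gamma>: "e1 * (\<Gamma> * X) = \<Gamma> * X" for X
      by (subst \<Gamma>(2)[symmetric], subst (2) \<Gamma>(2)[symmetric]) (simp add: mult.assoc proj_simps)
    have \<Gamma>sh: "\<Gamma> * (sh (- 1) * X) = sh (- 1) * (\<Gamma> * X)" for X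
      using laurent_sh_commute[OF \<Gamma>(1), of "- 1"] by (simp flip: mult.assoc)
    have "G * eps (j - 1) = pp * (\<Gamma> * (pm * (sh (- 1) * (eps j * sh 1))))"
      by (simp add: G step mult.assoc)
    also have "\<dots> = pp * (sh (- 1) * (\<Gamma> * (e2 * (eps j * sh 1))))"
      by (simp only: pm_sh) (simp add: \<Gamma>sh sh_e(2)[THEN mult_assoc_eq, symmetric, unfolded mult.assoc])
    also have "\<dots> = pp * (sh (- 1) * (pp * (\<Gamma> * (e2 * (eps j * sh 1)))))"
      using sh_pp[of "\<Gamma> * (e2 * (eps j * sh 1))"] by (simp add: algebra_simps e1\<Gamma>)
    also have "\<Gamma> * (e2 * (eps j * sh 1)) = \<Gamma> * (pm * (eps j * sh 1))"
      using pmj by (simp flip: mult.assoc)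
    finally have Gstep: "G * eps (j - 1) = pp * (sh (- 1) * (G * (eps j * sh 1)))"
      by (simp add: G mult.assoc)
    have "A11 * (G * eps (j - 1)) = A11 * sh (- 1) * (G * (eps j * sh 1))"
      unfolding Gstep by (simp add: proj_A mult.assoc)
    \<comment> \<open>The shift identity, read backwards, produces \<open>A11 * (G * eps j)\<close>
      and \<open>A21 * (G * eps j)\<close>, which the induction hypothesis and \<open>Y\<close>
      determine.\<close>
    also have "\<dots> = (A11 * sh (- 1) * A11 - A12 * sh (- 1) * A21) * (G * (eps j * sh 1))"
      by (simp only: A_shift_identities(1))
    also have "\<dots> = A11 * sh (- 1) * (A11 * (G * eps j)) * sh 1 - A12 * sh (- 1) * (A21 * (G * eps j)) * sh 1"
      by (simp add: algebra_simps)
    also have "\<dots> = - (A11 * sh (- 1) * A12) * eps j * sh 1 - A12 * sh (- 1) * (A21 * (G * eps j)) * sh 1"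
      unfolding IH by (simp add: algebra_simps)
    also have "\<dots> = - (A12 * sh (- 1) * (A22 * eps j + A21 * (G * eps j)) * sh 1)"
      unfolding A_shift_identities(2) by (simp add: algebra_simps)
    also have "\<dots> = - (A12 * (sh (- 1) * eps j * sh 1))"
      unfolding Y by (simp add: mult.assoc sh_e(2)[THEN mult_assoc_eq, unfolded mult.assoc] proj_A)
    finally have "A11 * (G * eps (j - 1)) = - A12 * eps (j - 1)" unfolding step by simp
    moreover have "- int (Suc n) = j - 1" by (simp add: j_def)
    ultimately show ?case by (simp only: mult.assoc)
  qed
  show ?thesis
  proof (rule bmat_eqI)
    fix x y :: "int \<times> ('p + 'q)"
    obtain j t where y: "y = (j, t)" by (cases y)
    show "ent (A11 * G) x y = ent (- A12) x y"
    proof (cases "j \<le> 0")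
      case True
      then have "ent (A11 * G * eps j) x y = ent (- A12 * eps j) x y"
        using col[of "nat (- j)"] by simp
      then show ?thesis by (simp add: y)
    next
      case False
      have "ent (A11 * G * pm) x y = 0" "ent (A12 * pm) x y = 0" using False by (simp_all add: y)
      then show ?thesis by (simp add: mult.assoc Gp proj_A)
    qed
  qed
qed

text \<open>Once \<open>A11 * G = - A12\<close> is known, each remaining equation is either
  multiplied by the injective \<open>A11\<close> or \<open>A22\<close>, which reduces it to a block
  identity, or obtained as an adjoint.\<close>

lemma solvable:
  assumes inj11: "\<And>X. pp * X = X \<Longrightarrow> A11 * X = 0 \<Longrightarrow> X = 0"
    and inj22: "\<And>X. pm * X = X \<Longrightarrow> A22 * X = 0 \<Longrightarrow> X = 0"
  shows "\<exists>\<Gamma>. laurent \<Gamma> \<and> e1 * \<Gamma> * e2 = \<Gamma> \<and> (\<forall>\<nu><0. \<forall>s t. cf \<Gamma> \<nu> s t = 0)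
    \<and> inverse_pair (pp * \<Gamma> * pm) (pm * adj \<Gamma> * pp)"
proof -
  obtain X where X: "\<And>l. X l * pr {l} = X l" "\<And>l. pp * X l = X l" "\<And>l. A11 * X l = - A12 * pr {l}"
    using fredholm_A11[OF inj11] by metis
  \<comment> \<open>The solutions for the columns \<open>(0, t)\<close> supply the coefficients of
    g; all other blocks and all negative \<nu> get 0.\<close>
  define r where "r \<nu> s t = (if isl s \<and> \<not> isl t \<and> 0 \<le> \<nu> then ent (X (0, t)) (\<nu>, s) (0, t) else 0)" for \<nu> s t
  \<comment> \<open>\<open>X (0, t)\<close> need not be Laurent; \<open>cf\<close> just reads its
    columns at index 0, which are absolutely summable as in every ring element.\<close>
  have r: "(\<lambda>\<nu>. norm (r \<nu> s t)) summable_on UNIV" for s t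
    by (rule summable_on_comparison_test[OF summable_cf[of "X (0, t)" s t]]) (auto simp: r_def cf_def)
  obtain \<Gamma> where \<Gamma>: "laurent \<Gamma>" "\<And>\<nu> s t. cf \<Gamma> \<nu> s t = r \<nu> s t" by (rule laurent_exists[of r, OF r], rule that, assumption, simp)
  have \<Gamma>e: "e1 * \<Gamma> * e2 = \<Gamma>"
    by (rule bmat_eqI) (auto simp: laurent_ent[OF \<Gamma>(1)] \<Gamma>(2) r_def split: prod.splits)
  define G where "G = pp * \<Gamma> * pm"
  have Gp: "pp * G = G" "G * pm = G" by (simp_all add: G_def mult.assoc proj_simps)
  have GX: "G * pr {(0, t)} = X (0, t)" if "\<not> isl t" for t
  proof (rule bmat_eqI)
    fix x y :: "int \<times> ('p + 'q)"
    have x0: "ent (X (0, t)) x y = 0" if "\<not> (0 \<le> fst x \<and> isl (snd x))"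
      using that X(2) by (metis ent_proj(3))
    have y0: "ent (X (0, t)) x y = 0" if "y \<noteq> (0, t)"
      using that X(1) by (metis ent_mult_pr singletonD)
    show "ent (G * pr {(0, t)}) x y = ent (X (0, t)) x y"
      using x0 y0 that by (cases x) (auto simp: G_def laurent_ent[OF \<Gamma>(1)] \<Gamma>(2) r_def)
  qed
  have col0: "A11 * G * eps 0 = - A12 * eps 0"
  proof (rule bmat_eqI)
    fix x y :: "int \<times> ('p + 'q)"
    obtain j t where y: "y = (j, t)" by (cases y)
    show "ent (A11 * G * eps 0) x y = ent (- A12 * eps 0) x y"
    proof (cases "isl t")
      case True
      have "ent (A11 * G * pm) x y = 0" "ent (A12 * pm) x y = 0" using True by (simp_all add: y)
      then have "ent (A11 * G) x y = 0" "ent A12 x y = 0" by (simp_all only: mult.assoc Gp proj_A)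
      then show ?thesis by (auto simp: y)
    next
      case False
      have "A11 * G * pr {(0, t)} = - A12 * pr {(0, t)}" using X(3) GX[OF False] by (simp add: mult.assoc)
      then have "ent (A11 * G * pr {(0, t)}) x (0, t) = ent (- A12 * pr {(0, t)}) x (0, t)" by simp
      then show ?thesis by (simp add: y)
    qed
  qed
  have c: "A11 * G = - A12" by (rule A11_G_all_columns[OF inj22 \<Gamma>(1) \<Gamma>e G_def col0])
  have a4: "A22 + A21 * G = pm"
  proof -
    have "A22 * (A22 + A21 * G - pm) = A22 * A22 - A22 + A22 * A21 * G"
      by (simp add: algebra_simps proj_A)
    also have "\<dots> = A22 * A22 - A21 * A12 - A22" by (simp add: A_identities(3) mult.assoc c)
    also have "\<dots> = 0" by (simp add: A_identities(4))
    finally have "A22 + A21 * G - pm = 0"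
      by (rule inj22[rotated]) (simp_all add: algebra_simps proj_A proj_simps)
    then show ?thesis by simp
  qed
  have a1: "A11 + G * A21 = pp"
  proof -
    have "A11 * (A11 + G * A21 - pp) = A11 * A11 - A11 + A11 * G * A21"
      by (simp add: algebra_simps proj_A)
    also have "\<dots> = A11 * A11 - A12 * A21 - A11" by (simp add: c)
    also have "\<dots> = 0" by (simp add: A_identities(1))
    finally have "A11 + G * A21 - pp = 0"
      by (rule inj11[rotated]) (simp_all add: algebra_simps proj_A proj_simps Gp Gp[THEN mult_assoc_eq])
    then show ?thesis by simp
  qed
  have a2: "A12 + G * A22 = 0"
  proof (rule inj11)
    show "A11 * (A12 + G * A22) = 0"
      using c by (simp add: distrib_left A_identities(2) flip: mult.assoc)
  qed (simp add: distrib_left proj_A Gp Gp[THEN mult_assoc_eq])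
  have adjG: "adj G = pm * adj \<Gamma> * pp" by (simp add: G_def adj_mult mult.assoc)
  have a3: "adj G * A11 + A21 = 0" using arg_cong[OF c, of adj] by (simp add: adj_mult adj_A adj_uminus)
  have a4': "adj G * A12 + A22 = pm" using arg_cong[OF a4, of adj] by (simp add: adj_mult adj_A adj_add add.commute)
  have "inverse_pair (pp * \<Gamma> * pm) (pm * adj \<Gamma> * pp)"
    unfolding inverse_pair_def adjG[symmetric] G_def[symmetric] using a1 a2 a3 a4' by simp
  moreover have "\<forall>\<nu><0. \<forall>s t. cf \<Gamma> \<nu> s t = 0" by (simp add: \<Gamma>(2) r_def)
  ultimately show ?thesis using \<Gamma>(1) \<Gamma>e by blast
qed

end

section \<open>The operators on sequence spaces as infinite matrices\<close>

lemma sum_range_inj: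
  fixes f :: "'n::finite \<Rightarrow> 's::finite"
  assumes "inj f" "\<And>s. s \<notin> range f \<Longrightarrow> h s = 0" shows "(\<Sum>s\<in>UNIV. h s) = (\<Sum>k\<in>UNIV. h (f k))"
proof -
  have "(\<Sum>s\<in>UNIV. h s) = (\<Sum>s\<in>range f. h s)" by (rule sum.mono_neutral_right) (use assms(2) in auto)
  then show ?thesis using assms(1) by (simp add: sum.reindex)
qed

lemma infsum_pairs:
  fixes g :: "int \<times> 's::finite \<Rightarrow> 'a::banach"
  assumes "g summable_on UNIV"
  shows "(\<lambda>i. \<Sum>s\<in>UNIV. g (i, s)) summable_on UNIV"
    and "(\<Sum>\<^sub>\<infinity>x. g x) = (\<Sum>\<^sub>\<infinity>i. \<Sum>s\<in>UNIV. g (i, s))"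
proof -
  have s: "(\<lambda>(i, s). g (i, s)) summable_on (SIGMA i:UNIV. UNIV)" using assms by simp
  show "(\<lambda>i. \<Sum>s\<in>UNIV. g (i, s)) summable_on UNIV"
    using summable_on_Sigma_banach[OF s] by simp
  show "(\<Sum>\<^sub>\<infinity>x. g x) = (\<Sum>\<^sub>\<infinity>i. \<Sum>s\<in>UNIV. g (i, s))"
    using infsum_Sigma'_banach[OF s] by simp
qed

lemma summable_pairsI:
  fixes g :: "int \<times> 's::finite \<Rightarrow> real"
  assumes "(\<lambda>i. \<Sum>s\<in>UNIV. g (i, s)) summable_on UNIV" "\<And>x. 0 \<le> g x"
  shows "g summable_on UNIV"
proof -
  have "g summable_on (SIGMA i:UNIV. UNIV)"
    by (rule summable_on_SigmaI[where g = "\<lambda>i. \<Sum>s\<in>UNIV. g (i, s)"]) (use assms in auto)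
  then show ?thesis by simp
qed

text \<open>Places sequences in the component \<open>range f\<close>. The sum avoids an inverse of
  f; for injective f it has at most one nonzero term.\<close>

definition emb :: "('n::finite \<Rightarrow> 's) \<Rightarrow> 'n seq \<Rightarrow> int \<times> 's \<Rightarrow> complex" where
  "emb f x = (\<lambda>(i, s). \<Sum>k\<in>UNIV. if s = f k then x i $ k else 0)"

definition unemb :: "('n::finite \<Rightarrow> 's) \<Rightarrow> (int \<times> 's \<Rightarrow> complex) \<Rightarrow> 'n seq" where
  "unemb f v = (\<lambda>i. \<chi> k. v (i, f k))"

lemma emb_f [simp]: "inj f \<Longrightarrow> emb f x (i, f k) = x i $ k"
  by (simp add: emb_def inj_eq)

lemma emb_out: "s \<notin> range f \<Longrightarrow> emb f x (i, s) = 0"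
  unfolding emb_def by (auto intro!: sum.neutral)

lemma unemb_nth [simp]: "unemb f v i $ k = v (i, f k)"
  by (simp add: unemb_def)

lemma unemb_emb: "inj f \<Longrightarrow> unemb f (emb f x) = x"
  by (auto simp: vec_eq_iff)

lemma emb_unemb: "inj f \<Longrightarrow> emb f (unemb f v) = app (pr (UNIV \<times> range f)) v"
proof
  fix x :: "int \<times> 'b" assume f: "inj f"
  obtain i s where x: "x = (i, s)" by (cases x)
  show "emb f (unemb f v) x = app (pr (UNIV \<times> range f)) v x"
    using f emb_out[of s f "unemb f v" i] by (cases "s \<in> range f") (auto simp: x)
qed

lemma emb_inject: "inj f \<Longrightarrow> emb f x = emb f y \<longleftrightarrow> x = y"
  by (metis unemb_emb)

lemma emb_range [simp]: "inj f \<Longrightarrow> app (pr (UNIV \<times> range f)) (emb f x) = emb f x"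
  by (metis emb_unemb unemb_emb)

lemma norm_sq_emb: "inj f \<Longrightarrow> (norm (x i))\<^sup>2 = (\<Sum>s\<in>UNIV. (norm (emb f x (i, s :: 's::finite)))\<^sup>2)"
  by (subst sum_range_inj[of f]) (auto simp: emb_out norm_vec_def L2_set_def sum_nonneg)

lemma ell2_emb:
  fixes f :: "'n::finite \<Rightarrow> 's::finite"
  assumes f: "inj f"
  shows "ell2 (emb f x) \<longleftrightarrow> (\<lambda>i. (norm (x i))\<^sup>2) summable_on UNIV"
    and "ell2 (emb f x) \<Longrightarrow> (\<Sum>\<^sub>\<infinity>w. (norm (emb f x w))\<^sup>2) = (\<Sum>\<^sub>\<infinity>i. (norm (x i))\<^sup>2)"
  unfolding ell2_def norm_sq_emb[OF f, of x]
  using infsum_pairs[of "\<lambda>w. (norm (emb f x w))\<^sup>2"] summable_pairsI[of "\<lambda>w. (norm (emb f x w))\<^sup>2"] by auto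

lemma lspace2_iff:
  fixes f :: "'n::finite \<Rightarrow> 's::finite"
  assumes f: "inj f"
  shows "x \<in> lspace 2 J \<longleftrightarrow> (\<forall>j. j \<notin> J \<longrightarrow> x j = 0) \<and> ell2 (emb f x)"
proof -
  have "(\<lambda>j. (norm (x j))\<^sup>2) summable_on J \<longleftrightarrow> (\<lambda>j. (norm (x j))\<^sup>2) summable_on UNIV" if "\<forall>j. j \<notin> J \<longrightarrow> x j = 0"
    by (rule summable_on_cong_neutral) (use that in auto)
  then show ?thesis unfolding lspace_def ell2_emb(1)[OF f] by auto
qed

lemma lspace2_norm:
  fixes f :: "'n::finite \<Rightarrow> 's::finite"
  assumes f: "inj f" and x: "x \<in> lspace 2 J"
  shows "(\<Sum>\<^sub>\<infinity>j\<in>J. (norm (x j))\<^sup>2) = (\<Sum>\<^sub>\<infinity>w. (norm (emb f x w))\<^sup>2)"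
proof -
  have "(\<Sum>\<^sub>\<infinity>j\<in>J. (norm (x j))\<^sup>2) = (\<Sum>\<^sub>\<infinity>j. (norm (x j))\<^sup>2)"
    by (rule infsum_cong_neutral) (use x in \<open>auto simp: lspace_def\<close>)
  then show ?thesis using ell2_emb(2)[OF f] x by (simp add: lspace2_iff[OF f])
qed

lemma emb_supp:
  assumes "\<forall>j. j \<notin> J \<longrightarrow> x j = 0" shows "app (pr (J \<times> UNIV)) (emb f x) = emb f x"
  using assms by (auto simp: emb_def fun_eq_iff intro!: sum.neutral)

lemma emb_add: "emb f (\<lambda>j. x j + y j) = (\<lambda>w. emb f x w + emb f y w)"
  by (auto simp: emb_def fun_eq_iff sum.distrib[symmetric] intro!: sum.cong)

lemma emb_cmult: "emb f (\<lambda>j. c *s x j) = (\<lambda>w. c * emb f x w)"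
  by (auto simp: emb_def fun_eq_iff sum_distrib_left intro!: sum.cong)

lemma l2_inner_emb:
  fixes f :: "'n::finite \<Rightarrow> 's::finite"
  assumes f: "inj f" and x: "ell2 (emb f x)" and y: "ell2 (emb f y)"
  shows "l2_inner x y = inner2 (emb f x) (emb f y)"
  unfolding inner2_def l2_inner_def infsum_pairs(2)[OF abs_summable_summable[OF inner2_summable[OF x y]]]
  by (intro infsum_cong, subst sum_range_inj[OF f]) (auto simp: f emb_out)

text \<open>The operator given by the block of A with rows in \<open>range f\<close> and columns in
  \<open>range h\<close>.\<close>

definition act :: "('n::finite \<Rightarrow> 's) \<Rightarrow> (int \<times> 's) bmat \<Rightarrow> ('m::finite \<Rightarrow> 's) \<Rightarrow> 'm seq \<Rightarrow> 'n seq" where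
  "act f A h x = unemb f (app A (emb h x))"

lemma emb_act: "inj f \<Longrightarrow> vbounded (emb h x) \<Longrightarrow> emb f (act f A h x) = app (pr (UNIV \<times> range f) * A) (emb h x)"
  by (simp add: act_def emb_unemb app_mult del: app_pr)

lemma act_act: "inj h \<Longrightarrow> vbounded (emb w x) \<Longrightarrow> act f A h (act h B w x) = act f (A * (pr (UNIV \<times> range h) * B)) w x"
  by (simp add: act_def emb_unemb app_mult vbounded_app del: app_pr)

lemma ell2_emb_act:
  fixes f :: "'n::finite \<Rightarrow> 's::finite"
  shows "inj f \<Longrightarrow> ell2 (emb h x) \<Longrightarrow> ell2 (emb f (act f A h x))"
  by (simp add: emb_act ell2_vbounded ell2_app)

lemma act_in_lspace2:
  fixes f :: "'n::finite \<Rightarrow> 's::finite" and h :: "'m::finite \<Rightarrow> 's"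
  assumes "inj f" "inj h" "x \<in> lspace 2 J'" "pr (J \<times> UNIV) * A = A"
  shows "act f A h x \<in> lspace 2 J"
proof -
  have e: "ell2 (emb h x)" using assms(2,3) by (simp add: lspace2_iff)
  have "app A (emb h x) (j, f k) = 0" if "j \<notin> J" for j k
  proof -
    have "app A (emb h x) = app (pr (J \<times> UNIV)) (app A (emb h x))"
      using assms(4) app_mult[OF ell2_vbounded[OF e], of "pr (J \<times> UNIV)" A] by simp
    from fun_cong[OF this, of "(j, f k)"] show ?thesis using that by simp
  qed
  then show ?thesis
    using ell2_emb_act[OF assms(1) e] by (auto simp: lspace2_iff[OF assms(1)] act_def vec_eq_iff)
qed

text \<open>Unit sequences test single entries; this yields the uniqueness that the definite
  description in \<open>l2_adjoint\<close> demands.\<close>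

lemma l2_inner_unit:
  assumes "j \<in> J"
  shows "\<exists>x\<in>lspace 2 J. \<forall>z. l2_inner x z = cnj (z j $ (k :: 'n::finite))"
proof
  let ?x = "\<lambda>i. if i = j then axis k 1 else (0 :: complex^'n)"
  have "(\<lambda>i. (norm (?x i))\<^sup>2) summable_on J"
    by (rule finite_nonzero_values_imp_summable_on) (auto intro: finite_subset[of _ "{j}"])
  then show "?x \<in> lspace 2 J" using assms by (auto simp: lspace_def)
  show "\<forall>z. l2_inner ?x z = cnj (z j $ k)"
  proof
    fix z :: "'n seq"
    have "l2_inner ?x z = (\<Sum>k'\<in>UNIV. ?x j $ k' * cnj (z j $ k'))"
      unfolding l2_inner_def by (rule infsum_single) simp
    also have "\<dots> = cnj (z j $ k)" by (simp add: axis_def if_distrib[of "\<lambda>a. a * _"] cong: if_cong)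
    finally show "l2_inner ?x z = cnj (z j $ k)" .
  qed
qed

text \<open>T is known only on \<open>lspace 2 J\<close>, so the conjugate transpose is truncated to
  J in order to land in that space.\<close>

lemma l2_adjoint_act:
  fixes f :: "'n::finite \<Rightarrow> 's::finite" and h :: "'m::finite \<Rightarrow> 's"
  assumes f: "inj f" and h: "inj h"
    and T: "\<And>x. x \<in> lspace 2 J \<Longrightarrow> T x = act f A h x" and y: "y \<in> lspace 2 J"
  shows "l2_adjoint J T y = act h (pr (J \<times> UNIV) * adj A) f y"
    and "l2_adjoint J T y \<in> lspace 2 J"
proof -
  let ?z = "act h (pr (J \<times> UNIV) * adj A) f y"
  have z: "?z \<in> lspace 2 J"
    by (rule act_in_lspace2[OF h f y]) (simp add: pr_mult_pr flip: mult.assoc)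
  have ey: "ell2 (emb f y)" using y by (simp add: lspace2_iff[OF f])
  have adj: "l2_inner (T x) y = l2_inner x ?z" if x: "x \<in> lspace 2 J" for x
  proof -
    have ex: "ell2 (emb h x)" and sx: "\<forall>j. j \<notin> J \<longrightarrow> x j = 0" using x by (simp_all add: lspace2_iff[OF h])
    have "l2_inner (T x) y = inner2 (app (pr (UNIV \<times> range f) * A) (emb h x)) (emb f y)"
      using l2_inner_emb[OF f _ ey, of "T x"] ell2_emb_act[OF f ex, of A] emb_act[OF f ell2_vbounded[OF ex], of A]
      by (simp add: T[OF x])
    also have "\<dots> = inner2 (emb h x) (app (adj A) (emb f y))"
      unfolding inner2_app[OF ex ey] adj_mult adj_pr app_mult[OF ell2_vbounded[OF ey]] emb_range[OF f] ..
    also have "\<dots> = inner2 (app (pr (J \<times> UNIV)) (app (pr (UNIV \<times> range h)) (emb h x))) (app (adj A) (emb f y))"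
      by (simp only: emb_range[OF h] emb_supp[OF sx])
    also have "\<dots> = inner2 (emb h x) (app (pr (UNIV \<times> range h) * (pr (J \<times> UNIV) * adj A)) (emb f y))"
      using ex ey by (simp only: inner2_app ell2_app adj_pr app_mult ell2_vbounded)
    also have "\<dots> = l2_inner x ?z"
      using l2_inner_emb[OF h ex, of ?z] ell2_emb_act[OF h ey] by (simp add: emb_act[OF h ell2_vbounded[OF ey]])
    finally show ?thesis .
  qed
  have "l2_adjoint J T y = ?z"
    unfolding l2_adjoint_def
  proof (rule the_equality)
    fix z assume z': "z \<in> lspace 2 J \<and> (\<forall>x\<in>lspace 2 J. l2_inner (T x) y = l2_inner x z)"
    show "z = ?z"
    proof
      fix j
      show "z j = ?z j"
      proof (cases "j \<in> J")
        case True
        have "z j $ k = ?z j $ k" for k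
        proof -
          obtain x where x: "x \<in> lspace 2 J" "\<And>w. l2_inner x w = cnj (w j $ k)"
            using l2_inner_unit[OF True, of k] by blast
          have "l2_inner x z = l2_inner x ?z" using z' adj x(1) by metis
          then show ?thesis unfolding x(2) by simp
        qed
        then show ?thesis by (simp add: vec_eq_iff)
      next
        case False
        have "z j = 0" "?z j = 0" using False z z' unfolding lspace_def by blast+
        then show ?thesis by simp
      qed
    qed
  qed (use z adj in blast)
  then show "l2_adjoint J T y = ?z" "l2_adjoint J T y \<in> lspace 2 J" using z by simp_all
qed

lemma has_sum_vecI:
  fixes w :: "'a \<Rightarrow> 'b::real_normed_vector^'n"
  assumes "\<And>k. ((\<lambda>j. w j $ k) has_sum y $ k) A" shows "(w has_sum y) A"
  using assms unfolding has_sum_def by (intro vec_tendstoI) simp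

text \<open>The defining series runs over integers with vector values, the matrix action over pairs
  of an integer and a component; absolute summability allows the regrouping, one coordinate at a
  time.\<close>

lemma toeplitz_act:
  fixes f :: "'n::finite \<Rightarrow> 's::finite" and h :: "'m::finite \<Rightarrow> 's" and \<rho> :: "complex \<Rightarrow> complex^'m^'n"
  assumes f: "inj f" and h: "inj h"
    and A: "\<And>i j k l. ent A (i, f k) (j, h l) = fourier_coeff \<rho> (i - j) $ k $ l" and x: "x \<in> lspace 2 J"
  shows "toeplitz J \<rho> x = act f (pr (J \<times> UNIV) * A) h x"
proof
  fix i
  have ex: "ell2 (emb h x)" and sx: "\<forall>j. j \<notin> J \<longrightarrow> x j = 0" using x by (simp_all add: lspace2_iff[OF h])
  note vb = ell2_vbounded[OF ex]
  show "toeplitz J \<rho> x i = act f (pr (J \<times> UNIV) * A) h x i"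
  proof (cases "i \<in> J")
    case True
    let ?w = "\<lambda>j. fourier_coeff \<rho> (i - j) *v x j"
    have "((\<lambda>j. ?w j $ k) has_sum app A (emb h x) (i, f k)) UNIV" for k
    proof -
      let ?g = "\<lambda>y. ent A (i, f k) y * emb h x y"
      have g: "?w j $ k = (\<Sum>s\<in>UNIV. ?g (j, s))" for j
        by (subst sum_range_inj[OF h]) (auto simp: emb_out A h matrix_vector_mult_def)
      show ?thesis
        unfolding g app_def infsum_pairs(2)[OF app_summable[OF vb]]
        by (rule has_sum_infsum[OF infsum_pairs(1)[OF app_summable[OF vb]]])
    qed
    then have "(?w has_sum act f (pr (J \<times> UNIV) * A) h x i) UNIV"
      by (intro has_sum_vecI) (simp add: act_def app_mult[OF vb] True)
    moreover have "(\<Sum>\<^sub>\<infinity>j\<in>J. ?w j) = (\<Sum>\<^sub>\<infinity>j. ?w j)"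
      by (rule infsum_cong_neutral) (use sx in auto)
    ultimately show ?thesis using True by (simp add: toeplitz_def infsumI)
  next
    case False
    then show ?thesis by (simp add: toeplitz_def act_def app_mult[OF vb] vec_eq_iff)
  qed
qed

lemma diag_op_act:
  fixes f :: "'n::finite \<Rightarrow> 's::finite" and h :: "'m::finite \<Rightarrow> 's" and r :: "complex^'m^'n"
  assumes h: "inj h"
    and C: "\<And>i j k l. ent C (i, f k) (j, h l) = (if i = j then r $ k $ l else 0)"
  shows "diag_op r x = act f C h x"
proof (intro ext, simp add: vec_eq_iff, intro allI)
  fix i k
  have "app C (emb h x) (i, f k) = (\<Sum>\<^sub>\<infinity>y\<in>Pair i ` UNIV. ent C (i, f k) y * emb h x y)"
    unfolding app_def
  proof (rule infsum_cong_neutral)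
    fix y :: "int \<times> 's" assume "y \<in> UNIV - Pair i ` UNIV"
    then obtain j s where y: "y = (j, s)" "j \<noteq> i" by (cases y) auto
    show "ent C (i, f k) y * emb h x y = 0"
      using y C[of i k j] by (cases "s \<in> range h") (auto simp: emb_out)
  qed auto
  also have "\<dots> = (\<Sum>s\<in>UNIV. ent C (i, f k) (i, s) * emb h x (i, s))"
    by (simp add: sum.reindex inj_on_def)
  also have "\<dots> = diag_op r x i $ k"
    by (subst sum_range_inj[OF h]) (auto simp: emb_out C h diag_op_def matrix_vector_mult_def)
  finally show "diag_op r x i $ k = act f C h x i $ k" by (simp add: act_def)
qed

lemma diag_op_lspace2:
  fixes f :: "'n::finite \<Rightarrow> 's::finite" and h :: "'m::finite \<Rightarrow> 's" and r :: "complex^'m^'n"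
  assumes f: "inj f" and h: "inj h"
    and C: "\<And>(i::int) j k l. ent C (i, f k) (j, h l) = (if i = j then r $ k $ l else 0)"
    and x: "x \<in> lspace 2 J"
  shows "diag_op r x \<in> lspace 2 J"
  using x ell2_emb_act[OF f, of h x C] unfolding lspace2_iff[OF f] lspace2_iff[OF h]
  by (auto simp: diag_op_act[OF h C, symmetric] diag_op_def)

lemma app_sh: "app (sh m) v = (\<lambda>(i, s). v (i - m, s))"
proof
  fix x :: "int \<times> 'a"
  show "app (sh m) v x = (case x of (i, s) \<Rightarrow> v (i - m, s))"
    unfolding app_def
    by (subst infsum_single[of "(fst x - m, snd x)"]) (auto simp: ent_sh prod_eq_iff split: prod.splits)
qed

lemma shift_act: "inj f \<Longrightarrow> (\<lambda>j. x (j - m)) = act f (sh m) f x"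
  by (auto simp: act_def app_sh vec_eq_iff fun_eq_iff)

lemma shift_lspace2:
  assumes x: "x \<in> lspace 2 J" and J: "\<And>j. j - m \<in> J \<Longrightarrow> j \<in> J" shows "(\<lambda>j. x (j - m)) \<in> lspace 2 J"
proof -
  have e: "ell2 (emb id x)" and s: "\<forall>j. j \<notin> J \<longrightarrow> x j = 0" using x by (simp_all add: lspace2_iff[of id])
  have "ell2 (emb id (\<lambda>j. x (j - m)))"
    unfolding shift_act[OF inj_on_id] by (rule ell2_emb_act[OF inj_on_id e])
  then show ?thesis using s J by (auto simp: lspace2_iff[of id])
qed

text \<open>Covers both operators: f, h, J, m are \<open>Inl\<close>, \<open>Inr\<close>,
  \<open>{0..}\<close>, 1 for \<open>M11\<close> and \<open>Inr\<close>, \<open>Inl\<close>,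
  \<open>{..0}\<close>, -1 for \<open>M22\<close>.\<close>

lemma toeplitz_difference_act:
  fixes f :: "'n::finite \<Rightarrow> 's::finite" and h :: "'m::finite \<Rightarrow> 's"
    and \<rho> :: "complex \<Rightarrow> complex^'n^'n" and \<sigma> :: "complex \<Rightarrow> complex^'m^'n"
  assumes f: "inj f" and h: "inj h"
    and A1: "\<And>i j k l. ent A (i, f k) (j, f l) = fourier_coeff \<rho> (i - j) $ k $ l"
    and A2: "\<And>i j k l. ent A (i, f k) (j, h l) = fourier_coeff \<sigma> (i - j) $ k $ l"
    and C1: "\<And>i j k l. ent C1 (i, f k) (j, f l) = (if i = j then r1 $ k $ l else 0)"
    and C2: "\<And>i j k l. ent C2 (i, h k) (j, h l) = (if i = j then r2 $ k $ l else 0)"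
    and S: "\<And>x. S x = act f (sh m) f x" "\<And>x. x \<in> lspace 2 J \<Longrightarrow> S x \<in> lspace 2 J"
    and P: "P = pr (J \<times> UNIV)" and F: "F = pr (UNIV \<times> range f)" and H: "H = pr (UNIV \<times> range h)"
    and x: "x \<in> lspace 2 J"
  shows "(\<lambda>i. toeplitz J \<rho> (diag_op r1 (l2_adjoint J (toeplitz J \<rho>) x)) i
      - S (toeplitz J \<sigma> (diag_op r2 (l2_adjoint J (toeplitz J \<sigma>) (l2_adjoint J S x)))) i)
    = act f (P * A * F * C1 * F * P * adj A * P - sh m * F * P * A * H * C2 * H * P * adj A * P * F * P * sh (- m)) f x"
proof -
  note t1 = toeplitz_act[where A = A, OF f f A1] and t2 = toeplitz_act[where A = A, OF f h A2]
  have adj1: "l2_adjoint J (toeplitz J \<rho>) y = act f (pr (J \<times> UNIV) * adj (pr (J \<times> UNIV) * A)) f y"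
    "l2_adjoint J (toeplitz J \<rho>) y \<in> lspace 2 J" if "y \<in> lspace 2 J" for y
    by (rule l2_adjoint_act[OF f f _ that]; rule t1; assumption)+
  have adj2: "l2_adjoint J (toeplitz J \<sigma>) y = act h (pr (J \<times> UNIV) * adj (pr (J \<times> UNIV) * A)) f y"
    "l2_adjoint J (toeplitz J \<sigma>) y \<in> lspace 2 J" if "y \<in> lspace 2 J" for y
    by (rule l2_adjoint_act[OF f h _ that]; rule t2; assumption)+
  have adj3: "l2_adjoint J S y = act f (pr (J \<times> UNIV) * adj (sh m)) f y"
    "l2_adjoint J S y \<in> lspace 2 J" if "y \<in> lspace 2 J" for y
    by (rule l2_adjoint_act[OF f f S(1) that])+
  have vb: "vbounded (emb f x)" using x by (simp add: lspace2_iff[OF f] ell2_vbounded)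
  have "toeplitz J \<rho> (diag_op r1 (l2_adjoint J (toeplitz J \<rho>) x))
    = act f (P * A * F * C1 * F * P * adj A * P) f x"
    unfolding t1[OF diag_op_lspace2[OF f f C1 adj1(2)[OF x]]]
    unfolding diag_op_act[OF f C1] adj1(1)[OF x]
    by (simp add: act_act f vb adj_mult P F mult.assoc)
  moreover have "S (toeplitz J \<sigma> (diag_op r2 (l2_adjoint J (toeplitz J \<sigma>) (l2_adjoint J S x))))
    = act f (sh m * F * P * A * H * C2 * H * P * adj A * P * F * P * sh (- m)) f x"
    unfolding t2[OF diag_op_lspace2[OF h h C2 adj2(2)[OF adj3(2)[OF x]]]]
    unfolding diag_op_act[OF h C2] adj2(1)[OF adj3(2)[OF x]]
    unfolding adj3(1)[OF x]
    by (simp add: S(1) act_act f h vb adj_mult adj_sh P F H mult.assoc)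
  ultimately show ?thesis
    using vb by (simp add: act_def app_minus vec_eq_iff fun_eq_iff)
qed

lemma sum_UNIV_sum:
  "(\<Sum>u\<in>(UNIV :: ('p::finite + 'q::finite) set). h u) = (\<Sum>k\<in>UNIV. h (Inl k)) + (\<Sum>l\<in>UNIV. h (Inr l))"
  by (simp add: UNIV_Plus_UNIV[symmetric] sum.Plus del: UNIV_Plus_UNIV)

lemma sphere_iff: "\<zeta> \<in> sphere 0 1 \<longleftrightarrow> norm (\<zeta> :: complex) = 1"
  by simp

section \<open>Dictionary between the data and Laurent matrices\<close>

locale eg_data = eg \<Phi> D D' for \<Phi> D D' :: "('p::finite, 'q::finite) bl" +
  fixes \<alpha> :: "complex \<Rightarrow> complex^'p^'p" and \<beta> :: "complex \<Rightarrow> complex^'q^'p"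
    and \<gamma> :: "complex \<Rightarrow> complex^'p^'q" and \<delta> :: "complex \<Rightarrow> complex^'q^'q"
  assumes wien: "\<alpha> \<in> wiener" "\<beta> \<in> wiener" "\<gamma> \<in> wiener" "\<delta> \<in> wiener"
    and cf_\<Phi>: "cf \<Phi> \<nu> (Inl k) (Inl k') = fourier_coeff \<alpha> \<nu> $ k $ k'" "cf \<Phi> \<nu> (Inl k) (Inr l) = fourier_coeff \<beta> \<nu> $ k $ l"
      "cf \<Phi> \<nu> (Inr l) (Inl k) = fourier_coeff \<gamma> \<nu> $ l $ k" "cf \<Phi> \<nu> (Inr l) (Inr l') = fourier_coeff \<delta> \<nu> $ l $ l'"
    and cf_D'_blocks: "cf D' \<nu> (Inl k) (Inl k') = (if \<nu> = 0 then matrix_inv (fourier_coeff \<alpha> 0) $ k $ k' else 0)"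
      "cf D' \<nu> (Inr l) (Inr l') = (if \<nu> = 0 then - matrix_inv (fourier_coeff \<delta> 0) $ l $ l' else 0)"
begin

lemma symf_\<Phi>:
  assumes "norm \<zeta> = 1"
  shows "symf \<Phi> \<zeta> (Inl k) (Inl k') = \<alpha> \<zeta> $ k $ k'" "symf \<Phi> \<zeta> (Inl k) (Inr l) = \<beta> \<zeta> $ k $ l"
    "symf \<Phi> \<zeta> (Inr l) (Inl k) = \<gamma> \<zeta> $ l $ k" "symf \<Phi> \<zeta> (Inr l) (Inr l') = \<delta> \<zeta> $ l $ l'"
  using assms wienerD(2)[OF wien(1)] wienerD(2)[OF wien(2)] wienerD(2)[OF wien(3)] wienerD(2)[OF wien(4)]
  by (simp_all add: symf_def cf_\<Phi>)

text \<open>Laurent matrices are equal when their symbols are. At each point this splits into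
  blocks, the lower left one being the adjoint of the upper right one.\<close>

lemma D1_iff:
  "adj \<Phi> * (e1 - e2) * \<Phi> = D \<longleftrightarrow> (\<forall>\<zeta>\<in>sphere 0 1.
      adj_mat (\<alpha> \<zeta>) ** \<alpha> \<zeta> - adj_mat (\<gamma> \<zeta>) ** \<gamma> \<zeta> = fourier_coeff \<alpha> 0 \<and>
      adj_mat (\<delta> \<zeta>) ** \<delta> \<zeta> - adj_mat (\<beta> \<zeta>) ** \<beta> \<zeta> = fourier_coeff \<delta> 0 \<and>
      adj_mat (\<alpha> \<zeta>) ** \<beta> \<zeta> = adj_mat (\<gamma> \<zeta>) ** \<delta> \<zeta>)" (is "?ring \<longleftrightarrow> ?pointwise")
proof -
  have lJ: "laurent (e1 - e2 :: ('p, 'q) bl)" by (intro laurent_minus laurent_e1 laurent_e2)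
  have lX: "laurent (adj \<Phi> * (e1 - e2) * \<Phi>)" by (intro laurent_mult laurent_adj lau lJ)
  have J\<Phi>: "symf ((e1 - e2) * \<Phi>) \<zeta> s t = (if isl s then symf \<Phi> \<zeta> s t else - symf \<Phi> \<zeta> s t)" for \<zeta> s t
  proof -
    have "cf ((e1 - e2) * \<Phi>) \<nu> s t = (if isl s then cf \<Phi> \<nu> s t else - cf \<Phi> \<nu> s t)" for \<nu>
      by (simp add: cf_def left_diff_distrib)
    then show ?thesis by (simp add: symf_def infsum_uminus)
  qed
  have X: "symf (adj \<Phi> * (e1 - e2) * \<Phi>) \<zeta> s t =
      (\<Sum>k\<in>UNIV. cnj (symf \<Phi> \<zeta> (Inl k) s) * symf \<Phi> \<zeta> (Inl k) t) - (\<Sum>l\<in>UNIV. cnj (symf \<Phi> \<zeta> (Inr l) s) * symf \<Phi> \<zeta> (Inr l) t)"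
    if "norm \<zeta> = 1" for \<zeta> s t
    using symf_mult[OF laurent_adj[OF lau(1)] laurent_mult[OF lJ lau(1)] that, of s t]
    by (simp add: mult.assoc sum_UNIV_sum J\<Phi> symf_adj[OF lau(1) that] sum_negf)
  have D: "symf D \<zeta> s t = cf D 0 s t" for \<zeta> s t
    by (rule symf_const) (simp add: cf_D)
  have mm: "(adj_mat A ** B) $ i $ j = (\<Sum>m\<in>UNIV. cnj (A $ m $ i) * B $ m $ j)" for A :: "complex^'a^'c" and B :: "complex^'b^'c" and i j
    by (simp add: matrix_matrix_mult_def)
  have entries: "(\<forall>s t. symf (adj \<Phi> * (e1 - e2) * \<Phi>) \<zeta> s t = symf D \<zeta> s t) \<longleftrightarrow>
      adj_mat (\<alpha> \<zeta>) ** \<alpha> \<zeta> - adj_mat (\<gamma> \<zeta>) ** \<gamma> \<zeta> = fourier_coeff \<alpha> 0 \<and>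
      adj_mat (\<delta> \<zeta>) ** \<delta> \<zeta> - adj_mat (\<beta> \<zeta>) ** \<beta> \<zeta> = fourier_coeff \<delta> 0 \<and>
      adj_mat (\<alpha> \<zeta>) ** \<beta> \<zeta> = adj_mat (\<gamma> \<zeta>) ** \<delta> \<zeta>" (is "?L \<longleftrightarrow> ?R1 \<and> ?R2 \<and> ?R3")
    if \<zeta>: "norm \<zeta> = 1" for \<zeta>
  proof -
    let ?eq = "\<lambda>s t. symf (adj \<Phi> * (e1 - e2) * \<Phi>) \<zeta> s t = symf D \<zeta> s t"
    have r1: "?R1 \<longleftrightarrow> (\<forall>k k'. ?eq (Inl k) (Inl k'))"
      unfolding X[OF \<zeta>] by (simp add: vec_eq_iff mm symf_\<Phi>[OF \<zeta>] D cf_D cf_\<Phi>)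
    have "?R2 \<longleftrightarrow> (\<forall>l l'. - (adj_mat (\<delta> \<zeta>) ** \<delta> \<zeta> - adj_mat (\<beta> \<zeta>) ** \<beta> \<zeta>) $ l $ l' = - fourier_coeff \<delta> 0 $ l $ l')"
      by (simp only: vec_eq_iff neg_equal_iff_equal)
    then have r2: "?R2 \<longleftrightarrow> (\<forall>l l'. ?eq (Inr l) (Inr l'))"
      unfolding X[OF \<zeta>] by (simp add: mm symf_\<Phi>[OF \<zeta>] D cf_D cf_\<Phi>)
    have r3: "?R3 \<longleftrightarrow> (\<forall>k l. ?eq (Inl k) (Inr l))"
      unfolding X[OF \<zeta>] by (simp add: vec_eq_iff mm symf_\<Phi>[OF \<zeta>] D cf_D cf_\<Phi>)
    have "?eq (Inr l) (Inl k) \<longleftrightarrow> ?eq (Inl k) (Inr l)" for k l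
    proof -
      have "symf (adj \<Phi> * (e1 - e2) * \<Phi>) \<zeta> (Inr l) (Inl k) = cnj (symf (adj \<Phi> * (e1 - e2) * \<Phi>) \<zeta> (Inl k) (Inr l))"
        unfolding X[OF \<zeta>] by (simp add: mult.commute)
      then show ?thesis by (simp add: D cf_D)
    qed
    then show ?thesis unfolding r1 r2 r3 split_sum_all by blast
  qed
  show ?thesis
  proof
    show ?pointwise if ?ring using that entries by (metis sphere_iff)
    show ?ring if ?pointwise
      using that entries by (intro symf_inject[OF lX lau(2)]) (metis sphere_iff)
  qed
qed

text \<open>\<Gamma> carries g in its upper right block and zeros elsewhere. This is a relation,
  since g matters only on the circle.\<close>

definition symbol_of :: "('p, 'q) bl \<Rightarrow> (complex \<Rightarrow> complex^'q^'p) \<Rightarrow> bool" where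
  "symbol_of \<Gamma> g \<longleftrightarrow> laurent \<Gamma> \<and> e1 * \<Gamma> * e2 = \<Gamma> \<and> (\<forall>\<nu><0. \<forall>s t. cf \<Gamma> \<nu> s t = 0) \<and>
    (\<forall>\<zeta>. norm \<zeta> = 1 \<longrightarrow> (\<forall>k l. g \<zeta> $ k $ l = symf \<Gamma> \<zeta> (Inl k) (Inr l)))"

lemma symbol_of_exists:
  assumes "g \<in> wiener_plus" obtains \<Gamma> where "symbol_of \<Gamma> g"
proof -
  have g: "g \<in> wiener" "\<And>\<nu>. \<nu> < 0 \<Longrightarrow> fourier_coeff g \<nu> = 0" using assms by (auto simp: wiener_supp_def)
  define r where "r \<nu> s t = (case (s, t) of (Inl k, Inr l) \<Rightarrow> fourier_coeff g \<nu> $ k $ l | _ \<Rightarrow> 0)"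
    for \<nu> and s t :: "'p + 'q"
  have "(\<lambda>\<nu>. norm (r \<nu> s t)) summable_on UNIV" for s t
    using wienerD(1)[OF g(1)] by (cases s; cases t) (simp_all add: r_def)
  then obtain \<Gamma> where \<Gamma>: "laurent \<Gamma>" "\<forall>\<nu> s t. cf \<Gamma> \<nu> s t = r \<nu> s t"
    using laurent_exists[of r] by metis
  have "e1 * \<Gamma> * e2 = \<Gamma>"
    by (rule bmat_eqI) (auto simp: laurent_ent[OF \<Gamma>(1)] \<Gamma>(2) r_def isl_def split: prod.splits sum.splits)
  moreover have "cf \<Gamma> \<nu> s t = 0" if "\<nu> < 0" for \<nu> s t
    using g(2)[OF that] by (simp add: \<Gamma>(2) r_def split: sum.splits)
  moreover have "g \<zeta> $ k $ l = symf \<Gamma> \<zeta> (Inl k) (Inr l)" if "norm \<zeta> = 1" for \<zeta> k l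
    using wienerD(2)[OF g(1), of \<zeta> k l] that by (simp add: symf_def \<Gamma>(2) r_def)
  ultimately show ?thesis using that[of \<Gamma>] \<Gamma>(1) by (simp add: symbol_of_def)
qed

lemma symbol_of_coeff:
  assumes "symbol_of \<Gamma> g"
  shows "g \<in> wiener_plus" "fourier_coeff g \<nu> $ k $ l = cf \<Gamma> \<nu> (Inl k) (Inr l)"
    "(\<lambda>\<zeta>. adj_mat (g \<zeta>)) \<in> wiener_minus" "fourier_coeff (\<lambda>\<zeta>. adj_mat (g \<zeta>)) \<nu> $ l $ k = cf (adj \<Gamma>) \<nu> (Inr l) (Inl k)"
proof -
  have \<Gamma>: "laurent \<Gamma>" "\<And>\<nu> s t. \<nu> < 0 \<Longrightarrow> cf \<Gamma> \<nu> s t = 0"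
    "\<And>\<zeta> k l. norm \<zeta> = 1 \<Longrightarrow> g \<zeta> $ k $ l = symf \<Gamma> \<zeta> (Inl k) (Inr l)"
    using assms by (auto simp: symbol_of_def)
  have w: "g \<in> wiener" and fc: "fourier_coeff g \<nu> $ k $ l = cf \<Gamma> \<nu> (Inl k) (Inr l)" for \<nu> k l
    by (rule block_wiener[of g \<Gamma> Inl Inr]; simp add: \<Gamma>(3))+
  have w': "(\<lambda>\<zeta>. adj_mat (g \<zeta>)) \<in> wiener" and fc': "fourier_coeff (\<lambda>\<zeta>. adj_mat (g \<zeta>)) \<nu> $ l $ k = cf (adj \<Gamma>) \<nu> (Inr l) (Inl k)" for \<nu> k l
    by (rule block_wiener[of "\<lambda>\<zeta>. adj_mat (g \<zeta>)" "adj \<Gamma>" Inr Inl]; simp add: \<Gamma>(3) symf_adj[OF \<Gamma>(1)])+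
  show "g \<in> wiener_plus" using w by (simp add: wiener_supp_def vec_eq_iff fc \<Gamma>(2))
  show "fourier_coeff g \<nu> $ k $ l = cf \<Gamma> \<nu> (Inl k) (Inr l)" by (rule fc)
  show "(\<lambda>\<zeta>. adj_mat (g \<zeta>)) \<in> wiener_minus" using w' by (simp add: wiener_supp_def vec_eq_iff fc' cf_adj[OF \<Gamma>(1)] \<Gamma>(2))
  show "fourier_coeff (\<lambda>\<zeta>. adj_mat (g \<zeta>)) \<nu> $ l $ k = cf (adj \<Gamma>) \<nu> (Inr l) (Inl k)" by (rule fc')
qed

text \<open>The four functions of the problem are the blocks of the symbol of
  \<open>\<Psi> * \<Phi> - 1\<close>. They are Wiener functions by \<open>block_wiener\<close>, so
  only the support conditions remain, and \<open>EG\<close> states these in the columns at index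
  0.\<close>

lemma solution_iff_EG:
  assumes \<Gamma>g: "symbol_of \<Gamma> g"
  shows "twofold_EG_solution \<alpha> \<beta> \<gamma> \<delta> g \<longleftrightarrow> EG (1 + \<Gamma> + adj \<Gamma>)"
proof -
  define \<Psi> where "\<Psi> = 1 + \<Gamma> + adj \<Gamma>"
  define N where "N = \<Psi> * \<Phi> - 1"
  have \<Gamma>: "laurent \<Gamma>" "e1 * \<Gamma> * e2 = \<Gamma>"
    "\<And>\<zeta> k l. norm \<zeta> = 1 \<Longrightarrow> g \<zeta> $ k $ l = symf \<Gamma> \<zeta> (Inl k) (Inr l)"
    using \<Gamma>g by (auto simp: symbol_of_def)
  have l\<Psi>: "laurent \<Psi>" unfolding \<Psi>_def by (intro laurent_add laurent_one laurent_adj \<Gamma>(1))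
  have "e2 * (e1 * \<Gamma> * e2) = 0" "(e1 * \<Gamma> * e2) * e1 = 0" by (simp_all add: mult.assoc proj_simps)
  then have G0: "e2 * \<Gamma> = 0" "\<Gamma> * e1 = 0" by (simp_all only: \<Gamma>(2))
  have G0': "e1 * adj \<Gamma> = 0" "adj \<Gamma> * e2 = 0" using G0[THEN arg_cong[of _ _ adj]] by (simp_all add: adj_mult)
  have blk: "e1 * \<Psi> * e1 = e1" "e2 * \<Psi> * e2 = e2"
    by (simp_all add: \<Psi>_def algebra_simps proj_simps G0 G0' mult_assoc_eq[OF G0'(1)] mult_assoc_eq[OF G0(1)])
  have adj\<Psi>: "adj \<Psi> = \<Psi>" by (simp add: \<Psi>_def adj_add algebra_simps)
  have z1: "cf \<Gamma> \<nu> s t = 0" if "\<not> isl s \<or> isl t" for \<nu> s t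
    using that arg_cong[OF \<Gamma>(2), of "\<lambda>X. cf X \<nu> s t"] by (auto simp: cf_def split: if_splits)
  have z: "symf \<Gamma> \<zeta> s t = 0" if "\<not> isl s \<or> isl t" for \<zeta> s t
    by (simp add: symf_def z1[OF that])
  have s\<Psi>: "symf \<Psi> \<zeta> s t = (if s = t then 1 else 0) + symf \<Gamma> \<zeta> s t + cnj (symf \<Gamma> \<zeta> t s)" if "norm \<zeta> = 1" for \<zeta> s t
    using that by (simp add: \<Psi>_def symf_add symf_one symf_adj[OF \<Gamma>(1)])
  have sN: "symf N \<zeta> s t = (\<Sum>k\<in>UNIV. symf \<Psi> \<zeta> s (Inl k) * symf \<Phi> \<zeta> (Inl k) t)
      + (\<Sum>l\<in>UNIV. symf \<Psi> \<zeta> s (Inr l) * symf \<Phi> \<zeta> (Inr l) t) - (if s = t then 1 else 0)" if "norm \<zeta> = 1" for \<zeta> s t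
    using that by (simp add: N_def symf_minus symf_one symf_mult[OF l\<Psi> lau(1)] sum_UNIV_sum)
  note calc = sN s\<Psi> z symf_\<Phi> \<Gamma>(3) matrix_matrix_mult_def mat_def sum.distrib distrib_right if_distrib[of "\<lambda>a. a * _"]
  have f1: "(\<alpha> \<zeta> + g \<zeta> ** \<gamma> \<zeta> - mat 1) $ k $ k' = symf N \<zeta> (Inl k) (Inl k')" if "norm \<zeta> = 1" for \<zeta> k k'
    using that by (simp add: calc cong: if_cong)
  have f2: "(adj_mat (g \<zeta>) ** \<alpha> \<zeta> + \<gamma> \<zeta>) $ l $ k = symf N \<zeta> (Inr l) (Inl k)" if "norm \<zeta> = 1" for \<zeta> l k
    using that by (simp add: calc cong: if_cong)
  have f3: "(\<delta> \<zeta> + adj_mat (g \<zeta>) ** \<beta> \<zeta> - mat 1) $ l $ l' = symf N \<zeta> (Inr l) (Inr l')" if "norm \<zeta> = 1" for \<zeta> l l'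
    using that by (simp add: calc cong: if_cong)
  have f4: "(g \<zeta> ** \<delta> \<zeta> + \<beta> \<zeta>) $ k $ l = symf N \<zeta> (Inl k) (Inr l)" if "norm \<zeta> = 1" for \<zeta> k l
    using that by (simp add: calc cong: if_cong)
  note b1 = block_wiener[of "\<lambda>\<zeta>. \<alpha> \<zeta> + g \<zeta> ** \<gamma> \<zeta> - mat 1" N Inl Inl, OF f1]
  note b2 = block_wiener[of "\<lambda>\<zeta>. adj_mat (g \<zeta>) ** \<alpha> \<zeta> + \<gamma> \<zeta>" N Inr Inl, OF f2]
  note b3 = block_wiener[of "\<lambda>\<zeta>. \<delta> \<zeta> + adj_mat (g \<zeta>) ** \<beta> \<zeta> - mat 1" N Inr Inr, OF f3]
  note b4 = block_wiener[of "\<lambda>\<zeta>. g \<zeta> ** \<delta> \<zeta> + \<beta> \<zeta>" N Inl Inr, OF f4]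
  have "twofold_EG_solution \<alpha> \<beta> \<gamma> \<delta> g \<longleftrightarrow>
      (\<forall>\<nu>\<ge>0. \<forall>k t. cf N \<nu> (Inl k) t = 0) \<and> (\<forall>\<nu>\<le>0. \<forall>l t. cf N \<nu> (Inr l) t = 0)"
    unfolding twofold_EG_solution_def wiener_supp_def split_sum_all
    using symbol_of_coeff(1)[OF \<Gamma>g] b1(1) b2(1) b3(1) b4(1)
    by (simp add: wiener_supp_def vec_eq_iff b1(2) b2(2) b3(2) b4(2) not_less) blast
  also have "\<dots> \<longleftrightarrow> pp * N * eps 0 = 0 \<and> pm * N * eps 0 = 0"
  proof -
    have "pp * N * eps 0 = 0 \<longleftrightarrow> (\<forall>\<nu>\<ge>0. \<forall>k t. cf N \<nu> (Inl k) t = 0)"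
    proof
      assume a: "pp * N * eps 0 = 0"
      show "\<forall>\<nu>\<ge>0. \<forall>k t. cf N \<nu> (Inl k) t = 0"
      proof (intro allI impI)
        fix \<nu> :: int and k t assume "0 \<le> \<nu>"
        then show "cf N \<nu> (Inl k) t = 0"
          using arg_cong[OF a, of "\<lambda>X. ent X (\<nu>, Inl k) (0, t)"] by (simp add: cf_def)
      qed
    qed (auto intro!: bmat_eqI simp: cf_def isl_def)
    moreover have "pm * N * eps 0 = 0 \<longleftrightarrow> (\<forall>\<nu>\<le>0. \<forall>l t. cf N \<nu> (Inr l) t = 0)"
    proof
      assume a: "pm * N * eps 0 = 0"
      show "\<forall>\<nu>\<le>0. \<forall>l t. cf N \<nu> (Inr l) t = 0"
      proof (intro allI impI)
        fix \<nu> :: int and l t assume "\<nu> \<le> 0"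
        then show "cf N \<nu> (Inr l) t = 0"
          using arg_cong[OF a, of "\<lambda>X. ent X (\<nu>, Inr l) (0, t)"] by (simp add: cf_def)
      qed
    next
      assume a: "\<forall>\<nu>\<le>0. \<forall>l t. cf N \<nu> (Inr l) t = 0"
      show "pm * N * eps 0 = 0"
      proof (rule bmat_eqI)
        fix x y :: "int \<times> ('p + 'q)"
        show "ent (pm * N * eps 0) x y = ent 0 x y"
          using a by (cases x; cases y; cases "snd x") (auto simp: cf_def)
      qed
    qed
    ultimately show ?thesis by blast
  qed
  also have "\<dots> \<longleftrightarrow> EG \<Psi>" using l\<Psi> adj\<Psi> blk by (simp add: EG_def N_def)
  finally show ?thesis by (simp add: \<Psi>_def)
qed

end

section \<open>Operators given by matrices\<close>

text \<open>W fixes the embedded sequences of \<open>lspace 2 J\<close> and plays the role of the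
  unit for the compressed matrix A.\<close>

locale matrix_operator =
  fixes f :: "'n::finite \<Rightarrow> 's::finite" and J :: "int set" and T :: "'n seq \<Rightarrow> 'n seq" and A W :: "(int \<times> 's) bmat"
  assumes f: "inj f" and W: "W = pr (J \<times> range f)" and WA: "W * A = A"
    and T: "\<And>x. x \<in> lspace 2 J \<Longrightarrow> T x = act f A f x"
begin

lemma W_apps: "x \<in> lspace 2 J \<Longrightarrow> app W (emb f x) = emb f x"
proof -
  assume x: "x \<in> lspace 2 J"
  have "W = pr (J \<times> UNIV) * pr (UNIV \<times> range f)" by (simp add: W pr_mult_pr Times_Int_Times)
  then show ?thesis
    using x emb_supp[of J x f] emb_range[OF f, of x]
    by (simp add: lspace2_iff[OF f] app_mult ell2_vbounded del: app_pr)
qed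

lemma emb_op: "x \<in> lspace 2 J \<Longrightarrow> emb f (T x) = app A (emb f x)"
proof -
  assume x: "x \<in> lspace 2 J"
  have "pr (UNIV \<times> range f) * A = pr (UNIV \<times> range f) * W * A" by (simp add: mult.assoc WA)
  also have "pr (UNIV \<times> range f) * W = W" by (simp add: W pr_mult_pr Times_Int_Times)
  finally show ?thesis
    using x by (simp add: T[OF x] emb_act f lspace2_iff[OF f] ell2_vbounded WA del: app_pr)
qed

lemma op_in_lspace2: "x \<in> lspace 2 J \<Longrightarrow> T x \<in> lspace 2 J"
proof -
  assume x: "x \<in> lspace 2 J"
  have "pr (J \<times> UNIV) * W = W" by (simp add: W pr_mult_pr Times_Int_Times)
  then have "pr (J \<times> UNIV) * A = A" using WA by (metis mult.assoc)
  then show ?thesis unfolding T[OF x] using act_in_lspace2[OF f f x] by blast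
qed

lemma op_eqI: "x \<in> lspace 2 J \<Longrightarrow> emb f y = app A (emb f x) \<Longrightarrow> T x = y"
  using emb_op emb_inject[OF f] by metis

lemma l2_bounded_op: "l2_bounded_op J T"
  unfolding l2_bounded_op_def
proof (intro conjI ballI allI)
  fix x y :: "'n seq" and c :: complex assume x: "x \<in> lspace 2 J" and y: "y \<in> lspace 2 J"
  note ex = emb_op[OF x] and ey = emb_op[OF y]
  show "T x \<in> lspace 2 J" by (rule op_in_lspace2[OF x])
  show "T (\<lambda>j. x j + y j) = (\<lambda>j. T x j + T y j)"
    using x y by (intro op_eqI) (auto simp: lspace2_iff[OF f] emb_add ell2_add ex ey app_vadd ell2_vbounded)
  show "T (\<lambda>j. c *s x j) = (\<lambda>j. c *s T x j)"
    using x by (intro op_eqI) (auto simp: lspace2_iff[OF f] emb_cmult ell2_cmult ex app_vcmult)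
next
  show "\<exists>K. \<forall>x\<in>lspace 2 J. sqrt (\<Sum>\<^sub>\<infinity>j\<in>J. norm (T x j) ^ 2) \<le> K * sqrt (\<Sum>\<^sub>\<infinity>j\<in>J. norm (x j) ^ 2)"
  proof (intro exI ballI)
    fix x :: "'n seq" assume x: "x \<in> lspace 2 J"
    have e: "ell2 (emb f x)" using x by (simp add: lspace2_iff[OF f])
    have "(\<Sum>\<^sub>\<infinity>j\<in>J. norm (T x j) ^ 2) \<le> (bnd A)\<^sup>2 * (\<Sum>\<^sub>\<infinity>j\<in>J. norm (x j) ^ 2)"
      unfolding lspace2_norm[OF f x] lspace2_norm[OF f op_in_lspace2[OF x]] emb_op[OF x] by (rule ell2_app(2)[OF e])
    then have "sqrt (\<Sum>\<^sub>\<infinity>j\<in>J. norm (T x j) ^ 2) \<le> sqrt ((bnd A)\<^sup>2 * (\<Sum>\<^sub>\<infinity>j\<in>J. norm (x j) ^ 2))"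
      by (rule real_sqrt_le_mono)
    then show "sqrt (\<Sum>\<^sub>\<infinity>j\<in>J. norm (T x j) ^ 2) \<le> bnd A * sqrt (\<Sum>\<^sub>\<infinity>j\<in>J. norm (x j) ^ 2)"
      using bnd_pos[of A] by (simp add: real_sqrt_mult)
  qed
qed

text \<open>The columns of X are square-summable vectors in the kernel of T. This carries (D2) over
  to the ring.\<close>

lemma inj_imp_matrix_inj:
  assumes inj: "inj_on T (lspace 2 J)" and X: "W * X = X" "A * X = 0" shows "X = 0"
proof (rule bmat_eqI)
  fix z y
  let ?v = "\<lambda>i. ent X i y"
  have v: "app W ?v = ?v" by (simp add: app_column X)
  have vb: "vbounded ?v" by (rule ell2_vbounded[OF ell2_column])
  have "pr (UNIV \<times> range f) * W = W" "pr (J \<times> UNIV) * W = W" by (simp_all add: W pr_mult_pr Times_Int_Times)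
  then have "app (pr (UNIV \<times> range f)) ?v = ?v" and s: "app (pr (J \<times> UNIV)) ?v = ?v"
    unfolding app_column using X(1) by (metis mult.assoc)+
  then have e: "emb f (unemb f ?v) = ?v" by (simp add: emb_unemb f)
  have "ent X (j, t) y = 0" if "j \<notin> J" for j t
    using fun_cong[OF s, of "(j, t)"] that by simp
  then have x: "unemb f ?v \<in> lspace 2 J" by (simp add: lspace2_iff[OF f] e ell2_column vec_eq_iff)
  have e0: "emb f (\<lambda>j. 0) = (\<lambda>w. 0)" by (auto simp: emb_def fun_eq_iff intro!: sum.neutral)
  have x0: "(\<lambda>j. 0 :: complex^'n) \<in> lspace 2 J" by (simp add: lspace2_iff[OF f] e0 ell2_def)
  have "T (unemb f ?v) = T (\<lambda>j. 0)"
    by (rule op_eqI[OF x]) (simp add: emb_op[OF x0] e0 e app_column X(2), simp add: app_def)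
  then have "unemb f ?v = (\<lambda>j. 0)" using inj x x0 by (simp add: inj_on_def)
  then have "?v = (\<lambda>w. 0)" using e e0 by metis
  then show "ent X z y = ent 0 z y" by (cases z) (simp add: fun_eq_iff)
qed

text \<open>B inverts A relative to W, which is enough because W fixes the embedded
  sequences.\<close>

lemma inverse:
  assumes B: "W * B = B" "B * A = W" "A * B = W"
  shows "l2_invertible J T" "inj_on T (lspace 2 J)"
    "y \<in> lspace 2 J \<Longrightarrow> l2_inverse J T y = act f B f y"
proof -
  interpret B: matrix_operator f J "act f B f" B W
    by unfold_locales (use f W B in auto)
  have NT: "act f B f (T x) = x" if x: "x \<in> lspace 2 J" for x
  proof (rule B.op_eqI[OF op_in_lspace2[OF x]])
    have "app B (app A (emb f x)) = app (B * A) (emb f x)"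
      using x by (simp add: app_mult lspace2_iff[OF f] ell2_vbounded)
    then show "emb f x = app B (emb f (T x))" by (simp only: emb_op[OF x] B W_apps[OF x])
  qed
  have TN: "T (act f B f x) = x" if x: "x \<in> lspace 2 J" for x
  proof (rule op_eqI[OF B.op_in_lspace2[OF x]])
    have "app A (app B (emb f x)) = app (A * B) (emb f x)"
      using x by (simp add: app_mult lspace2_iff[OF f] ell2_vbounded)
    then show "emb f x = app A (emb f (act f B f x))" by (simp only: B.emb_op[OF x] B W_apps[OF x])
  qed
  show "l2_invertible J T" unfolding l2_invertible_def
    using l2_bounded_op B.l2_bounded_op NT TN by blast
  show inj: "inj_on T (lspace 2 J)" using NT by (metis inj_onI)
  show "l2_inverse J T y = act f B f y" if y: "y \<in> lspace 2 J"
    unfolding l2_inverse_def using inv_into_f_f[OF inj B.op_in_lspace2[OF y]] by (simp only: TN[OF y])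
qed

end

lemma act_column:
  fixes f :: "'n::finite \<Rightarrow> 's::finite" and h :: "'m::finite \<Rightarrow> 's" and \<rho> :: "complex \<Rightarrow> complex^'m^'n"
  assumes f: "inj f" and h: "inj h"
    and A: "\<And>i k l. ent A (i, f k) (0, h l) = (if i \<in> J then fourier_coeff \<rho> i $ k $ l else 0)"
  shows "act f A h (\<lambda>j. if j = 0 then v else 0) = coeff_column J \<rho> v"
proof (intro ext, simp add: vec_eq_iff, intro allI)
  fix i k
  have "app A (emb h (\<lambda>j. if j = 0 then v else 0)) (i, f k)
    = (\<Sum>\<^sub>\<infinity>y\<in>Pair 0 ` UNIV. ent A (i, f k) y * emb h (\<lambda>j. if j = 0 then v else 0) y)"
    unfolding app_def by (rule infsum_cong_neutral) (auto simp: emb_def image_iff intro!: sum.neutral)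
  also have "\<dots> = (\<Sum>s\<in>UNIV. ent A (i, f k) (0, s) * emb h (\<lambda>j. if j = 0 then v else 0) (0, s))"
    by (simp add: sum.reindex inj_on_def)
  also have "\<dots> = coeff_column J \<rho> v i $ k"
    by (subst sum_range_inj[OF h]) (auto simp: emb_out A h coeff_column_def matrix_vector_mult_def)
  finally show "act f A h (\<lambda>j. if j = 0 then v else 0) i $ k = coeff_column J \<rho> v i $ k" by (simp add: act_def)
qed

lemma delta_lspace2: "0 \<in> J \<Longrightarrow> (\<lambda>j. if j = 0 then v else 0) \<in> (lspace 2 J :: ('m::finite) seq set)"
  unfolding lspace_def by (auto intro!: finite_nonzero_values_imp_summable_on intro: finite_subset[of _ "{0}"])

text \<open>The minus sign is the one in \<open>solution_formulas\<close>.\<close>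

lemma coeff_column_lspace1:
  fixes \<rho> :: "complex \<Rightarrow> complex^'m^'n"
  assumes "\<rho> \<in> wiener" shows "(\<lambda>j. - coeff_column J \<rho> v j) \<in> lspace 1 J"
proof -
  have "(\<lambda>j. \<Sum>k\<in>UNIV. \<Sum>l\<in>UNIV. norm (fourier_coeff \<rho> j $ k $ l) * norm (v $ l)) summable_on UNIV"
    by (intro infsum_sum(1) summable_on_cmult_left wienerD(1)[OF assms])
  then have s: "(\<lambda>j. \<Sum>k\<in>UNIV. \<Sum>l\<in>UNIV. norm (fourier_coeff \<rho> j $ k $ l) * norm (v $ l)) summable_on J"
    by (rule summable_on_subset_banach) simp
  have "(\<lambda>j. norm (coeff_column J \<rho> v j)) summable_on J"
  proof (rule summable_on_comparison_test[OF s])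
    fix j assume "j \<in> J"
    have "norm (fourier_coeff \<rho> j *v v) \<le> (\<Sum>k\<in>UNIV. norm ((fourier_coeff \<rho> j *v v) $ k))"
      by (simp add: norm_vec_def L2_set_le_sum)
    also have "\<dots> \<le> (\<Sum>k\<in>UNIV. \<Sum>l\<in>UNIV. norm (fourier_coeff \<rho> j $ k $ l) * norm (v $ l))"
      unfolding matrix_vector_mult_def
      by (intro sum_mono) (simp add: order_trans[OF norm_sum] norm_mult)
    finally show "norm (coeff_column J \<rho> v j) \<le> (\<Sum>k\<in>UNIV. \<Sum>l\<in>UNIV. norm (fourier_coeff \<rho> j $ k $ l) * norm (v $ l))"
      using \<open>j \<in> J\<close> by (simp add: coeff_column_def)
  qed simp
  then show ?thesis by (simp add: lspace_def coeff_column_def)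
qed

lemma inv_fourier_coeff_column:
  fixes \<rho> :: "complex \<Rightarrow> complex^'m^'n"
  assumes \<rho>: "\<rho> \<in> wiener_supp J" and \<zeta>: "\<zeta> \<in> sphere 0 1"
  shows "inv_fourier J (\<lambda>v j. - coeff_column J \<rho> v j) \<zeta> = - \<rho> \<zeta>"
proof -
  have m: "matrix (\<lambda>v. - coeff_column J \<rho> v \<nu>) = - fourier_coeff \<rho> \<nu>" if "\<nu> \<in> J" for \<nu>
    using that by (simp add: vec_eq_iff matrix_def coeff_column_def matrix_vector_mult_def axis_def if_distrib[of "\<lambda>a. _ * a"] cong: if_cong)
  have "((\<lambda>\<nu>. smult_mat (\<zeta> powi \<nu>) (fourier_coeff \<rho> \<nu>)) has_sum \<rho> \<zeta>) UNIV"
    using \<rho> \<zeta> by (simp add: wiener_supp_def wiener_def)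
  then have "((\<lambda>\<nu>. - smult_mat (\<zeta> powi \<nu>) (fourier_coeff \<rho> \<nu>)) has_sum - \<rho> \<zeta>) UNIV"
    by (simp add: has_sum_uminus)
  then have "(\<Sum>\<^sub>\<infinity>\<nu>. - smult_mat (\<zeta> powi \<nu>) (fourier_coeff \<rho> \<nu>)) = - \<rho> \<zeta>" by (rule infsumI)
  moreover have "inv_fourier J (\<lambda>v j. - coeff_column J \<rho> v j) \<zeta> = (\<Sum>\<^sub>\<infinity>\<nu>. - smult_mat (\<zeta> powi \<nu>) (fourier_coeff \<rho> \<nu>))"
    unfolding inv_fourier_def
    by (rule infsum_cong_neutral) (use \<rho> in \<open>auto simp: m wiener_supp_def vec_eq_iff\<close>)
  ultimately show ?thesis by simp
qed

section \<open>The operators \<open>M11\<close> and \<open>M22\<close>\<close>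

context eg
begin

text \<open>Triangularity of \<Phi> absorbs the inner truncations and the shifts commute with
  Laurent matrices, so both summands become \<Phi> times a projection times
  \<open>D' * adj \<Phi>\<close>. For \<open>M11\<close> these projections add up to Q, for
  \<open>M22\<close> to \<open>1 - Q\<close>.\<close>

lemma truncated_shape:
  assumes comm: "P * F = F * P" "P * D' = D' * P" "P * H = H * P" and idem: "P * P = P" "F * F = F"  "H * H = H"
    and adjP: "adj P = P" "adj F = F" and FH: "F * D' = D' * F" "H * D' = D' * H"
    and tri: "F * \<Phi> * P = P * F * \<Phi> * P" and lF: "laurent F" and lH: "laurent H"
  shows "F * (P * \<Phi> * F * D' * F * P * adj \<Phi> * P + sh m * F * P * \<Phi> * H * D' * H * P * adj \<Phi> * P * F * P * sh (- m)) * (P * F)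
    = F * \<Phi> * (P * F + sh m * P * sh (- m) * H) * D' * adj \<Phi> * (P * F)"
proof -
  have tri': "P * (adj \<Phi> * F) = P * (adj \<Phi> * (F * P))"
    using arg_cong[OF tri, of adj] unfolding adj_mult adjP mult.assoc .
  have sh\<Phi>: "sh m * (\<Phi> * X) = \<Phi> * (sh m * X)" "adj \<Phi> * (sh (- m) * X) = sh (- m) * (adj \<Phi> * X)" for X
    using laurent_sh_commute[OF lau(1), of m] laurent_sh_commute[OF laurent_adj[OF lau(1)], of "- m"]
    by (simp_all flip: mult.assoc)
  have shF: "sh n * (F * X) = F * (sh n * X)" "sh n * (D' * X) = D' * (sh n * X)" "sh n * (H * X) = H * (sh n * X)" for n X
    using laurent_sh_commute[OF lF, of n] laurent_sh_commute[OF lau(3), of n] laurent_sh_commute[OF lH, of n]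
    by (simp_all flip: mult.assoc)
  \<comment> \<open>The truncation to the left of \<Phi> is absorbed once P stands to its
    right.\<close>
  have triX: "F * (P * (\<Phi> * (P * X))) = F * (\<Phi> * (P * X))" for X
    using arg_cong[OF tri, of "\<lambda>Y. Y * X"] unfolding comm(1) mult.assoc by simp
  have triX': "P * (adj \<Phi> * (F * (P * X))) = P * (adj \<Phi> * (F * X))" for X
    using arg_cong[OF tri', of "\<lambda>Y. Y * X"] unfolding mult.assoc by simp
  note c = comm[THEN mult_assoc_eq, unfolded mult.assoc] and i = idem[THEN mult_assoc_eq] and FHa = FH[THEN mult_assoc_eq, unfolded mult.assoc]
  have "F * (P * F) = P * F" using comm(1) idem(2) by (metis mult.assoc)
  then have FPF: "F * (sh n * (P * F)) = sh n * (P * F)" for n by (metis shF(1))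
  have t1: "F * (P * \<Phi> * F * D' * F * P * adj \<Phi> * P) * (P * F) = F * \<Phi> * (P * F) * D' * adj \<Phi> * (P * F)"
  proof -
    have "F * (P * \<Phi> * F * D' * F * P * adj \<Phi> * P) * (P * F) = F * (P * (\<Phi> * (P * (F * (D' * (adj \<Phi> * (P * F)))))))"
      by (simp add: mult.assoc c i FHa)
    also have "\<dots> = F * (\<Phi> * (P * (F * (D' * (adj \<Phi> * (P * F))))))" by (rule triX)
    finally show ?thesis by (simp add: mult.assoc)
  qed
  have t2: "F * (sh m * F * P * \<Phi> * H * D' * H * P * adj \<Phi> * P * F * P * sh (- m)) * (P * F)
      = F * \<Phi> * (sh m * P * sh (- m) * H) * D' * adj \<Phi> * (P * F)"
  proof -
    have "F * (sh m * F * P * \<Phi> * H * D' * H * P * adj \<Phi> * P * F * P * sh (- m)) * (P * F)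
       = sh m * (F * (P * (\<Phi> * (P * (H * (D' * (P * (adj \<Phi> * (F * (P * (sh (- m) * (P * F))))))))))))"
      by (simp add: mult.assoc c i FHa shF)
    also have "\<dots> = sh m * (F * (\<Phi> * (P * (H * (D' * (P * (adj \<Phi> * (F * (sh (- m) * (P * F))))))))))"
      by (simp only: triX triX')
    also have "\<dots> = F * (\<Phi> * (sh m * (P * (H * (D' * (adj \<Phi> * (sh (- m) * (P * F))))))))"
      by (simp only: FPF) (simp add: c i FHa shF sh\<Phi>)
    also have "\<dots> = F * \<Phi> * (sh m * P * sh (- m) * H) * D' * adj \<Phi> * (P * F)"
      by (simp add: mult.assoc sh\<Phi> shF c i)
    finally show ?thesis .
  qed
  show ?thesis using t1 t2 by (simp only: distrib_left distrib_right)
qed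

end

text \<open>An operator on \<open>lspace 2 J\<close> sees only the compression of its
  matrix.\<close>

lemma app_act_pr:
  fixes f :: "'n::finite \<Rightarrow> 's::finite"
  assumes f: "inj f" and x: "x \<in> lspace 2 J" and B: "pr (UNIV \<times> range f) * B * (pr (J \<times> UNIV) * pr (UNIV \<times> range f)) = A"
  shows "act f B f x = act f A f x"
proof -
  have vb: "vbounded (emb f x)" and s: "\<forall>j. j \<notin> J \<longrightarrow> x j = 0"
    using x by (simp_all add: lspace2_iff[OF f] ell2_vbounded)
  have e: "app (pr (J \<times> UNIV) * pr (UNIV \<times> range f)) (emb f x) = emb f x"
    by (simp only: app_mult[OF vb] emb_range[OF f] emb_supp[OF s])
  have "emb f (act f B f x) = app (pr (UNIV \<times> range f) * B) (emb f x)" by (rule emb_act[OF f vb])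
  also have "\<dots> = app A (emb f x)"
    unfolding B[symmetric] app_mult[OF vb, of "pr (UNIV \<times> range f) * B"] by (simp only: e)
  also have "\<dots> = emb f (act f A f x)"
  proof -
    have "pr (UNIV \<times> range f) * A = A" unfolding B[symmetric] by (simp add: pr_mult_pr flip: mult.assoc)
    then show ?thesis by (simp only: emb_act[OF f vb])
  qed
  finally show ?thesis by (simp only: emb_inject[OF f])
qed

locale eg_data_D1 = eg_data \<Phi> D D' \<alpha> \<beta> \<gamma> \<delta> + eg_D1 \<Phi> D D'
  for \<Phi> D D' :: "('p::finite, 'q::finite) bl"
    and \<alpha> :: "complex \<Rightarrow> complex^'p^'p" and \<beta> :: "complex \<Rightarrow> complex^'q^'p"
    and \<gamma> :: "complex \<Rightarrow> complex^'p^'q" and \<delta> :: "complex \<Rightarrow> complex^'q^'q"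
begin

lemma tri1': "ent \<Phi> (i, s) (j, t) \<noteq> 0 \<Longrightarrow> isl s \<Longrightarrow> j \<le> i" and tri2': "ent \<Phi> (i, s) (j, t) \<noteq> 0 \<Longrightarrow> \<not> isl s \<Longrightarrow> i \<le> j"
  using tri1[of s i j t] tri2[of s j i t] by force+

lemma ent_\<Phi>_blocks: "ent \<Phi> (i, Inl k) (j, Inl k') = fourier_coeff \<alpha> (i - j) $ k $ k'"
    "ent \<Phi> (i, Inl k) (j, Inr l) = fourier_coeff \<beta> (i - j) $ k $ l"
    "ent \<Phi> (i, Inr l) (j, Inl k) = fourier_coeff \<gamma> (i - j) $ l $ k"
    "ent \<Phi> (i, Inr l) (j, Inr l') = fourier_coeff \<delta> (i - j) $ l $ l'"
  by (simp_all add: laurent_ent[OF lau(1)] cf_\<Phi>)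

lemma ent_D'_blocks: "ent D' (i, Inl k) (j, Inl k') = (if i = j then matrix_inv (fourier_coeff \<alpha> 0) $ k $ k' else 0)"
    "ent D' (i, Inr l) (j, Inr l') = (if i = j then - matrix_inv (fourier_coeff \<delta> 0) $ l $ l' else 0)"
  by (auto simp: laurent_ent[OF lau(3)] cf_D'_blocks)

lemma shifts_lspace2:
  fixes x :: "'p seq" and y :: "'q seq"
  shows "x \<in> lspace 2 {0..} \<Longrightarrow> shift_plus x \<in> lspace 2 {0..}" "y \<in> lspace 2 {..0} \<Longrightarrow> shift_minus y \<in> lspace 2 {..0}"
  unfolding shift_plus_def shift_minus_def
  using shift_lspace2[of x "{0..}" 1] shift_lspace2[of y "{..0}" "- 1"] by simp_all

lemma M11_act:
  assumes x: "x \<in> lspace 2 {0..}" shows "M11 \<alpha> \<beta> \<delta> x = act Inl A11 Inl x"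
proof -
  define P :: "('p, 'q) bl" where "P = pr ({0..} \<times> UNIV)"
  \<comment> \<open>The second block of \<open>D'\<close> is the negative of the inverse of d_0,
    hence the factor \<open>- D'\<close>.\<close>
  define B where "B = P * \<Phi> * e1 * D' * e1 * P * adj \<Phi> * P - sh 1 * e1 * P * \<Phi> * e2 * (- D') * e2 * P * adj \<Phi> * P * e1 * P * sh (- 1)"
  have S: "shift_plus x = act Inl (sh 1 :: ('p, 'q) bl) Inl x" for x
    unfolding shift_plus_def by (rule shift_act) simp
  have "M11 \<alpha> \<beta> \<delta> x = act Inl B Inl x"
    unfolding M11_def B_def
    by (rule toeplitz_difference_act) (simp_all add: ent_\<Phi>_blocks ent_D'_blocks S shifts_lspace2[unfolded S] P_def e1_def e2_def x)
  also have "\<dots> = act Inl A11 Inl x"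
  proof (rule app_act_pr[OF _ x])
    have Pe: "P * e1 = e1 * P" "P * e2 = e2 * P"
      unfolding P_def e1_def e2_def by (simp_all add: pr_mult_pr Int_commute)
    \<comment> \<open>Conjugation by the shift moves the half line from \<open>{0..}\<close> to
      \<open>{1..}\<close>; this is why Q starts strictly after 0 in the second component.\<close>
    have QP: "P * e1 + sh 1 * P * sh (- 1) * e2 = Q"
      by (rule bmat_eqI) (auto simp: P_def ent_proj' ent_sh ent_pr mult.assoc prod_eq_iff)
    have Pe1: "P * e1 = pp" unfolding P_def e1_def pp_def by (simp add: pr_mult_pr Times_Int_Times)
    have "e1 * B * (P * e1) = e1 * (P * \<Phi> * e1 * D' * e1 * P * adj \<Phi> * P + sh 1 * e1 * P * \<Phi> * e2 * D' * e2 * P * adj \<Phi> * P * e1 * P * sh (- 1)) * (P * e1)"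
      by (simp add: B_def)
    also have "\<dots> = e1 * \<Phi> * (P * e1 + sh 1 * P * sh (- 1) * e2) * D' * adj \<Phi> * (P * e1)"
    proof (rule truncated_shape)
      show "P * D' = D' * P" unfolding P_def by (rule D'_commute) simp
      show "e1 * \<Phi> * P = P * e1 * \<Phi> * P"
        by (intro bmat_eqI) (auto simp: P_def mult.assoc split: prod.splits dest!: tri1')
    qed (simp_all add: Pe proj_mult D'_proj laurent_e1 laurent_e2, simp_all add: P_def pr_mult_pr)
    also have "\<dots> = e1 * E * pp" unfolding QP unfolding Pe1 by (simp add: E_def mult.assoc)
    also have "\<dots> = A11" using proj_A_right(1) by (simp add: A11_def mult.assoc proj_simps)
    finally show "pr (UNIV \<times> range Inl) * B * (pr ({0..} \<times> UNIV) * pr (UNIV \<times> range Inl)) = A11"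
      by (simp only: e1_def P_def)
  qed simp
  finally show ?thesis .
qed

lemma M22_act:
  assumes x: "x \<in> lspace 2 {..0}" shows "M22 \<alpha> \<gamma> \<delta> x = act Inr A22 Inr x"
proof -
  define P :: "('p, 'q) bl" where "P = pr ({..0} \<times> UNIV)"
  define B where "B = P * \<Phi> * e2 * (- D') * e2 * P * adj \<Phi> * P - sh (- 1) * e2 * P * \<Phi> * e1 * D' * e1 * P * adj \<Phi> * P * e2 * P * sh (- (- 1))"
  have S: "shift_minus x = act Inr (sh (- 1) :: ('p, 'q) bl) Inr x" for x
    unfolding shift_minus_def using shift_act[of Inr x "- 1"] by simp
  have "M22 \<alpha> \<gamma> \<delta> x = act Inr B Inr x"
    unfolding M22_def B_def
    by (rule toeplitz_difference_act) (simp_all add: ent_\<Phi>_blocks ent_D'_blocks S shifts_lspace2[unfolded S] P_def e1_def e2_def x)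
  also have "\<dots> = act Inr A22 Inr x"
  proof (rule app_act_pr[OF _ x])
    have Pe: "P * e1 = e1 * P" "P * e2 = e2 * P"
      unfolding P_def e1_def e2_def by (simp_all add: pr_mult_pr Int_commute)
    \<comment> \<open>On the negative half line the shift goes the other way, and the bracket is the
      complement of Q.\<close>
    have QP: "P * e2 + sh (- 1) * P * sh (- (- 1)) * e1 = 1 - Q"
      by (rule bmat_eqI) (auto simp: P_def ent_proj' ent_sh ent_pr ent_one mult.assoc prod_eq_iff)
    have Pe2: "P * e2 = pm" unfolding P_def e2_def pm_def by (simp add: pr_mult_pr Times_Int_Times)
    have "e2 * B * (P * e2) = - (e2 * (P * \<Phi> * e2 * D' * e2 * P * adj \<Phi> * P + sh (- 1) * e2 * P * \<Phi> * e1 * D' * e1 * P * adj \<Phi> * P * e2 * P * sh (- (- 1))) * (P * e2))"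
      by (simp add: B_def algebra_simps)
    also have "e2 * (P * \<Phi> * e2 * D' * e2 * P * adj \<Phi> * P + sh (- 1) * e2 * P * \<Phi> * e1 * D' * e1 * P * adj \<Phi> * P * e2 * P * sh (- (- 1))) * (P * e2)
      = e2 * \<Phi> * (P * e2 + sh (- 1) * P * sh (- (- 1)) * e1) * D' * adj \<Phi> * (P * e2)"
    proof (rule truncated_shape)
      show "P * D' = D' * P" unfolding P_def by (rule D'_commute) simp
      show "e2 * \<Phi> * P = P * e2 * \<Phi> * P"
        by (intro bmat_eqI) (auto simp: P_def mult.assoc split: prod.splits dest!: tri2')
    qed (simp_all add: Pe proj_mult D'_proj laurent_e1 laurent_e2, simp_all add: P_def pr_mult_pr)
    also have "\<dots> = e2 * ((e1 - e2) - E) * pm" unfolding QP unfolding Pe2 by (simp only: E_compl mult.assoc)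
    \<comment> \<open>The sign stems from the negative second block of \<open>D'\<close>; the part
      \<open>- e2\<close> of \<open>e1 - e2\<close> then becomes the summand \<open>e2\<close> of
      \<open>A22\<close>.\<close>
    also have "- \<dots> = A22"
      using proj_A_right(4) by (simp add: A22_def algebra_simps proj_simps)
    finally show "pr (UNIV \<times> range Inr) * B * (pr ({..0} \<times> UNIV) * pr (UNIV \<times> range Inr)) = A22"
      by (simp only: e2_def P_def)
  qed simp
  finally show ?thesis .
qed

lemma M11_op: "matrix_operator Inl {0..} (M11 \<alpha> \<beta> \<delta>) A11 pp"
  and M22_op: "matrix_operator Inr {..0} (M22 \<alpha> \<gamma> \<delta>) A22 pm"
  by unfold_locales (simp_all add: pp_def[symmetric] pm_def[symmetric] proj_A M11_act M22_act)

text \<open>Since b and c are the columns of \<open>A12\<close> and \<open>A21\<close> at index 0,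
  the formulas are the last two identities of \<open>inverse_pair_inverses\<close>, read in that
  column.\<close>

lemma solution_formulas:
  assumes sym: "symbol_of \<Gamma> g" and EG: "EG (1 + \<Gamma> + adj \<Gamma>)"
  shows "l2_invertible {0..} (M11 \<alpha> \<beta> \<delta>)" "l2_invertible {..0} (M22 \<alpha> \<gamma> \<delta>)"
    "inj_on (M11 \<alpha> \<beta> \<delta>) (lspace 2 {0..})" "inj_on (M22 \<alpha> \<gamma> \<delta>) (lspace 2 {..0})"
    "l2_inverse {0..} (M11 \<alpha> \<beta> \<delta>) (coeff_column {0..} \<beta> v) = (\<lambda>j. - coeff_column {0..} g v j)"
    "l2_inverse {..0} (M22 \<alpha> \<gamma> \<delta>) (coeff_column {..0} \<gamma> w) = (\<lambda>j. - coeff_column {..0} (\<lambda>\<zeta>. adj_mat (g \<zeta>)) w j)"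
proof -
  interpret M1: matrix_operator Inl "{0..}" "M11 \<alpha> \<beta> \<delta>" A11 pp by (rule M11_op)
  interpret M2: matrix_operator Inr "{..0}" "M22 \<alpha> \<gamma> \<delta>" A22 pm by (rule M22_op)
  define G where "G = pp * (1 + \<Gamma> + adj \<Gamma>) * pm"
  have adj\<Psi>: "adj (1 + \<Gamma> + adj \<Gamma>) = 1 + \<Gamma> + adj \<Gamma>" using EG by (simp add: EG_def)
  have adjG: "adj G = pm * (1 + \<Gamma> + adj \<Gamma>) * pp" by (simp only: G_def adj_mult adj_proj adj\<Psi> mult.assoc)
  have G: "pp * G = G" "G * pm = G" by (simp_all add: G_def mult.assoc proj_simps)
  have "inverse_pair G (adj G)" unfolding adjG using EG_inverse_pair[OF EG] by (simp only: G_def)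
  note inv = inverse_pair_inverses[OF this G]
  have B: "pp * (pp - G * adj G) = pp - G * adj G" "pm * (pm - adj G * G) = pm - adj G * G"
    using G(1) arg_cong[OF G(2), of adj, unfolded adj_mult] by (simp_all add: right_diff_distrib proj_mult flip: mult.assoc)
  show "l2_invertible {0..} (M11 \<alpha> \<beta> \<delta>)" "inj_on (M11 \<alpha> \<beta> \<delta>) (lspace 2 {0..})"
    using M1.inverse[OF B(1) inv(1,2)] by auto
  show "l2_invertible {..0} (M22 \<alpha> \<gamma> \<delta>)" "inj_on (M22 \<alpha> \<gamma> \<delta>) (lspace 2 {..0})"
    using M2.inverse[OF B(2) inv(3,4)] by auto
  have \<Gamma>: "laurent \<Gamma>" "e1 * \<Gamma> * e2 = \<Gamma>" using sym by (auto simp: symbol_of_def)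
  have z: "ent \<Gamma> x y = 0" if "\<not> isl (snd x) \<or> isl (snd y)" for x y
    using that arg_cong[OF \<Gamma>(2), of "\<lambda>X. ent X x y"] by (auto split: if_splits)
  have i: "inj (Inl :: 'p \<Rightarrow> 'p + 'q)" "inj (Inr :: 'q \<Rightarrow> 'p + 'q)" by simp_all
  let ?dv = "\<lambda>j::int. if j = 0 then v else 0" and ?dw = "\<lambda>j::int. if j = 0 then w else 0"
  have dv: "?dv \<in> lspace 2 {..0}" and dw: "?dw \<in> lspace 2 {0..}"
    by (rule delta_lspace2, simp)+
  have vb: "vbounded (emb (Inr :: 'q \<Rightarrow> 'p + 'q) ?dv)" "vbounded (emb (Inl :: 'p \<Rightarrow> 'p + 'q) ?dw)"
    using dv dw by (simp_all add: lspace2_iff[OF i(1)] lspace2_iff[OF i(2)] ell2_vbounded)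
  have c1: "act Inl A12 Inr ?dv = coeff_column {0..} \<beta> v"
  proof (rule act_column[OF i])
    fix k :: int and a b
    have "ent A12 (k, Inl a) (0, Inr b) = ent (pp * (A12 * eps 0)) (k, Inl a) (0, Inr b)"
      using proj_A(2) by (simp flip: mult.assoc)
    also have "\<dots> = ent (pp * (e1 * \<Phi> * e2 * eps 0)) (k, Inl a) (0, Inr b)" by (simp only: A_columns)
    finally show "ent A12 (k, Inl a) (0, Inr b) = (if k \<in> {0..} then fourier_coeff \<beta> k $ a $ b else 0)"
      by (simp add: ent_\<Phi>_blocks)
  qed
  have c2: "act Inr A21 Inl ?dw = coeff_column {..0} \<gamma> w"
  proof (rule act_column[OF i(2,1)])
    fix k :: int and a b
    have "ent A21 (k, Inr a) (0, Inl b) = ent (pm * (A21 * eps 0)) (k, Inr a) (0, Inl b)"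
      using proj_A(3) by (simp flip: mult.assoc)
    also have "\<dots> = ent (pm * (e2 * \<Phi> * e1 * eps 0)) (k, Inr a) (0, Inl b)" by (simp only: A_columns)
    finally show "ent A21 (k, Inr a) (0, Inl b) = (if k \<in> {..0} then fourier_coeff \<gamma> k $ a $ b else 0)"
      by (simp add: ent_\<Phi>_blocks)
  qed
  have g1: "act Inl G Inr ?dv = coeff_column {0..} g v"
    by (rule act_column[OF i]) (simp add: G_def ent_one z symbol_of_coeff(2)[OF sym] cf_def)
  have g2: "act Inr (adj G) Inl ?dw = coeff_column {..0} (\<lambda>\<zeta>. adj_mat (g \<zeta>)) w"
    by (rule act_column[OF i(2,1)]) (simp add: adjG ent_one z symbol_of_coeff(4)[OF sym] cf_def del: ent_adj)
  have m1: "act Inl (- G) Inr ?dv = (\<lambda>j. - act Inl G Inr ?dv j)"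
    by (simp add: act_def app_uminus[OF vb(1)] vec_eq_iff fun_eq_iff)
  have m2: "act Inr (- adj G) Inl ?dw = (\<lambda>j. - act Inr (adj G) Inl ?dw j)"
    by (simp add: act_def app_uminus[OF vb(2)] vec_eq_iff fun_eq_iff)
  have e: "e1 * A12 = A12" "e2 * A21 = A21" by (simp_all add: proj_A)
  have "pr ({0..} \<times> UNIV) * pp = (pp :: ('p, 'q) bl)" "pr ({..0} \<times> UNIV) * pm = (pm :: ('p, 'q) bl)"
    by (simp_all add: pp_def pm_def pr_mult_pr Times_Int_Times)
  then have A0: "pr ({0..} \<times> UNIV) * A12 = A12" "pr ({..0} \<times> UNIV) * A21 = A21"
    using proj_A_left(2,3) by (metis mult.assoc)+
  have "coeff_column {0..} \<beta> v \<in> lspace 2 {0..}"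
    unfolding c1[symmetric] by (rule act_in_lspace2[OF i dv A0(1)])
  from M1.inverse(3)[OF B(1) inv(1,2) this]
  have "l2_inverse {0..} (M11 \<alpha> \<beta> \<delta>) (coeff_column {0..} \<beta> v) = act Inl (pp - G * adj G) Inl (act Inl A12 Inr ?dv)"
    by (simp only: c1)
  also have "\<dots> = act Inl (- G) Inr ?dv"
    unfolding act_act[OF i(1) vb(1)] e1_def[symmetric] e inv(5) ..
  finally show "l2_inverse {0..} (M11 \<alpha> \<beta> \<delta>) (coeff_column {0..} \<beta> v) = (\<lambda>j. - coeff_column {0..} g v j)"
    by (simp only: m1 g1)
  have "coeff_column {..0} \<gamma> w \<in> lspace 2 {..0}"
    unfolding c2[symmetric] by (rule act_in_lspace2[OF i(2,1) dw A0(2)])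
  from M2.inverse(3)[OF B(2) inv(3,4) this]
  have "l2_inverse {..0} (M22 \<alpha> \<gamma> \<delta>) (coeff_column {..0} \<gamma> w) = act Inr (pm - adj G * G) Inr (act Inr A21 Inl ?dw)"
    by (simp only: c2)
  also have "\<dots> = act Inr (- adj G) Inl ?dw"
    unfolding act_act[OF i(2) vb(2)] e2_def[symmetric] e inv(6) ..
  finally show "l2_inverse {..0} (M22 \<alpha> \<gamma> \<delta>) (coeff_column {..0} \<gamma> w) = (\<lambda>j. - coeff_column {..0} (\<lambda>\<zeta>. adj_mat (g \<zeta>)) w j)"
    by (simp only: m2 g2)
qed

lemma solution_exists:
  assumes "inj_on (M11 \<alpha> \<beta> \<delta>) (lspace 2 {0..})" "inj_on (M22 \<alpha> \<gamma> \<delta>) (lspace 2 {..0})"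
  shows "\<exists>g. twofold_EG_solution \<alpha> \<beta> \<gamma> \<delta> g"
proof -
  obtain \<Gamma> where \<Gamma>: "laurent \<Gamma>" "e1 * \<Gamma> * e2 = \<Gamma>" "\<forall>\<nu><0. \<forall>s t. cf \<Gamma> \<nu> s t = 0"
    "inverse_pair (pp * \<Gamma> * pm) (pm * adj \<Gamma> * pp)"
    using solvable[OF matrix_operator.inj_imp_matrix_inj[OF M11_op assms(1)] matrix_operator.inj_imp_matrix_inj[OF M22_op assms(2)]]
    by blast
  have "symbol_of \<Gamma> (\<lambda>\<zeta>. \<chi> k l. symf \<Gamma> \<zeta> (Inl k) (Inr l))"
    using \<Gamma> by (simp add: symbol_of_def)
  then show ?thesis using solution_iff_EG inverse_pair_EG[OF \<Gamma>(1,2,4)] by blast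
qed

end

section \<open>Construction of the Laurent matrices and proof of the theorem\<close>

lemma matrix_inv_mult:
  "invertible A \<Longrightarrow> A ** matrix_inv A = mat 1" "invertible A \<Longrightarrow> matrix_inv A ** A = mat 1"
  unfolding invertible_def matrix_inv_def using someI_ex[of "\<lambda>A'. A ** A' = mat 1 \<and> A' ** A = mat 1"] by blast+

lemma eg_data_exists:
  fixes \<alpha> :: "complex \<Rightarrow> complex^'p^'p" and \<beta> :: "complex \<Rightarrow> complex^'q^'p"
    and \<gamma> :: "complex \<Rightarrow> complex^'p^'q" and \<delta> :: "complex \<Rightarrow> complex^'q^'q"
  assumes \<alpha>: "\<alpha> \<in> wiener_plus" and \<beta>: "\<beta> \<in> wiener_plus" and \<gamma>: "\<gamma> \<in> wiener_minus" and \<delta>: "\<delta> \<in> wiener_minus"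
    and inv: "invertible (fourier_coeff \<alpha> 0)" "invertible (fourier_coeff \<delta> 0)"
  shows "\<exists>\<Phi> D D'. eg_data \<Phi> D D' \<alpha> \<beta> \<gamma> \<delta>"
proof -
  let ?a = "fourier_coeff \<alpha> 0" and ?d = "fourier_coeff \<delta> 0"
  have w: "\<alpha> \<in> wiener" "\<beta> \<in> wiener" "\<gamma> \<in> wiener" "\<delta> \<in> wiener"
    and supp: "\<And>\<nu>. \<nu> < 0 \<Longrightarrow> fourier_coeff \<alpha> \<nu> = 0" "\<And>\<nu>. \<nu> < 0 \<Longrightarrow> fourier_coeff \<beta> \<nu> = 0"
      "\<And>\<nu>. 0 < \<nu> \<Longrightarrow> fourier_coeff \<gamma> \<nu> = 0" "\<And>\<nu>. 0 < \<nu> \<Longrightarrow> fourier_coeff \<delta> \<nu> = 0"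
    using \<alpha> \<beta> \<gamma> \<delta> by (auto simp: wiener_supp_def)
  define r :: "int \<Rightarrow> 'p + 'q \<Rightarrow> 'p + 'q \<Rightarrow> complex" where
    "r \<nu> s t = (case s of Inl k \<Rightarrow> (case t of Inl k' \<Rightarrow> fourier_coeff \<alpha> \<nu> $ k $ k' | Inr l \<Rightarrow> fourier_coeff \<beta> \<nu> $ k $ l)
      | Inr l \<Rightarrow> (case t of Inl k \<Rightarrow> fourier_coeff \<gamma> \<nu> $ l $ k | Inr l' \<Rightarrow> fourier_coeff \<delta> \<nu> $ l $ l'))" for \<nu> s t
  \<comment> \<open>One pattern for D and \<open>D'\<close>: the minus sign in the second block is
    its own inverse, so inverse matrices inserted into it give inverse Laurent matrices.\<close>
  define bd :: "complex^'p^'p \<Rightarrow> complex^'q^'q \<Rightarrow> int \<Rightarrow> 'p + 'q \<Rightarrow> 'p + 'q \<Rightarrow> complex" where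
    "bd A B \<nu> s t = (if \<nu> = 0 then (case s of Inl k \<Rightarrow> (case t of Inl k' \<Rightarrow> A $ k $ k' | Inr l \<Rightarrow> 0)
      | Inr l \<Rightarrow> (case t of Inl k \<Rightarrow> 0 | Inr l' \<Rightarrow> - B $ l $ l')) else 0)" for A B \<nu> s t
  have "(\<lambda>\<nu>. norm (r \<nu> s t)) summable_on UNIV" for s t
    using wienerD(1)[OF w(1)] wienerD(1)[OF w(2)] wienerD(1)[OF w(3)] wienerD(1)[OF w(4)]
    by (cases s; cases t) (simp_all add: r_def)
  then obtain \<Phi> where \<Phi>: "laurent \<Phi>" "\<forall>\<nu> s t. cf \<Phi> \<nu> s t = r \<nu> s t" using laurent_exists[of r] by metis
  have sbd: "(\<lambda>\<nu>. norm (bd A B \<nu> s t)) summable_on UNIV" for A B s t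
    by (rule finite_nonzero_values_imp_summable_on) (auto simp: bd_def intro: finite_subset[of _ "{0}"])
  obtain D where D: "laurent D" "\<forall>\<nu> s t. cf D \<nu> s t = bd ?a ?d \<nu> s t"
    using laurent_exists[of "bd ?a ?d", OF sbd] by metis
  obtain D' where D': "laurent D'" "\<forall>\<nu> s t. cf D' \<nu> s t = bd (matrix_inv ?a) (matrix_inv ?d) \<nu> s t"
    using laurent_exists[of "bd (matrix_inv ?a) (matrix_inv ?d)", OF sbd] by metis
  have prod: "X * Y = 1"
    if X: "laurent X" "\<forall>\<nu> s t. cf X \<nu> s t = bd A B \<nu> s t" and Y: "laurent Y" "\<forall>\<nu> s t. cf Y \<nu> s t = bd A' B' \<nu> s t"
      and AB: "A ** A' = mat 1" "B ** B' = mat 1" for X Y A B A' B'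
  proof (rule symf_inject[OF laurent_mult[OF X(1) Y(1)] laurent_one])
    fix \<zeta> :: complex and s t :: "'p + 'q" assume \<zeta>: "norm \<zeta> = 1"
    have sX: "symf X \<zeta> s t = bd A B 0 s t" and sY: "symf Y \<zeta> s t = bd A' B' 0 s t" for s t
      by (rule symf_const; simp add: X(2) Y(2) bd_def)+
    have e: "(\<Sum>m\<in>UNIV. A $ i $ m * A' $ m $ j) = (if i = j then 1 else 0)" for i j
      using arg_cong[OF AB(1), of "\<lambda>M. M $ i $ j"] by (simp add: matrix_matrix_mult_def mat_def)
    have e': "(\<Sum>m\<in>UNIV. B $ i $ m * B' $ m $ j) = (if i = j then 1 else 0)" for i j
      using arg_cong[OF AB(2), of "\<lambda>M. M $ i $ j"] by (simp add: matrix_matrix_mult_def mat_def)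
    show "symf (X * Y) \<zeta> s t = symf 1 \<zeta> s t"
      unfolding symf_mult[OF X(1) Y(1) \<zeta>] sX sY sum_UNIV_sum symf_one
      by (cases s; cases t) (simp_all add: bd_def e e')
  qed
  have "eg_data \<Phi> D D' \<alpha> \<beta> \<gamma> \<delta>"
  proof unfold_locales
    show "D * D' = 1" "D' * D = 1"
      by (rule prod[OF D D'] prod[OF D' D]; simp add: matrix_inv_mult inv)+
    show "ent \<Phi> (i, s) (j, t) = 0" if "isl s" "i < j" for i j s t
      using that supp by (auto simp: laurent_ent[OF \<Phi>(1)] \<Phi>(2) r_def isl_def split: sum.split)
    show "ent \<Phi> (i, s) (j, t) = 0" if "\<not> isl s" "j < i" for i j s t
      using that supp by (auto simp: laurent_ent[OF \<Phi>(1)] \<Phi>(2) r_def isl_def split: sum.split)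
  qed (auto simp: \<Phi> D D' w r_def bd_def split: sum.splits if_splits)
  then show ?thesis by blast
qed

theorem theorem4p1:
  fixes \<alpha> :: "complex \<Rightarrow> complex^'p^'p"
    and \<beta> :: "complex \<Rightarrow> complex^'q^'p"
    and \<gamma> :: "complex \<Rightarrow> complex^'p^'q"
    and \<delta> :: "complex \<Rightarrow> complex^'q^'q"
  assumes "\<alpha> \<in> wiener_plus" and "\<beta> \<in> wiener_plus"
    and "\<gamma> \<in> wiener_minus" and "\<delta> \<in> wiener_minus"
    and "invertible (fourier_coeff \<alpha> 0)" and "invertible (fourier_coeff \<delta> 0)"
  shows
    "((\<exists>g. twofold_EG_solution \<alpha> \<beta> \<gamma> \<delta> g) \<longleftrightarrow>
       (\<forall>\<zeta>\<in>sphere 0 1.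
          adj_mat (\<alpha> \<zeta>) ** \<alpha> \<zeta> - adj_mat (\<gamma> \<zeta>) ** \<gamma> \<zeta> = fourier_coeff \<alpha> 0 \<and>
          adj_mat (\<delta> \<zeta>) ** \<delta> \<zeta> - adj_mat (\<beta> \<zeta>) ** \<beta> \<zeta> = fourier_coeff \<delta> 0 \<and>
          adj_mat (\<alpha> \<zeta>) ** \<beta> \<zeta> = adj_mat (\<gamma> \<zeta>) ** \<delta> \<zeta>) \<and>
       inj_on (M11 \<alpha> \<beta> \<delta>) (lspace 2 {0..}) \<and>
       inj_on (M22 \<alpha> \<gamma> \<delta>) (lspace 2 {..0}))
     \<and>
     ((\<exists>g. twofold_EG_solution \<alpha> \<beta> \<gamma> \<delta> g) \<longrightarrow>
       l2_invertible {0..} (M11 \<alpha> \<beta> \<delta>) \<and>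
       l2_invertible {..0} (M22 \<alpha> \<gamma> \<delta>) \<and>
       (\<forall>v. l2_inverse {0..} (M11 \<alpha> \<beta> \<delta>) (coeff_column {0..} \<beta> v) \<in> lspace 1 {0..}) \<and>
       (\<forall>v. l2_inverse {..0} (M22 \<alpha> \<gamma> \<delta>) (coeff_column {..0} \<gamma> v) \<in> lspace 1 {..0}) \<and>
       (\<exists>g. twofold_EG_solution \<alpha> \<beta> \<gamma> \<delta> g \<and>
          (\<forall>g'. twofold_EG_solution \<alpha> \<beta> \<gamma> \<delta> g' \<longrightarrow> (\<forall>\<zeta>\<in>sphere 0 1. g' \<zeta> = g \<zeta>)) \<and>
          (\<forall>\<zeta>\<in>sphere 0 1.
             g \<zeta> = - inv_fourier {0..}
               (\<lambda>v. l2_inverse {0..} (M11 \<alpha> \<beta> \<delta>) (coeff_column {0..} \<beta> v)) \<zeta> \<and>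
             adj_mat (g \<zeta>) = - inv_fourier {..0}
               (\<lambda>v. l2_inverse {..0} (M22 \<alpha> \<gamma> \<delta>) (coeff_column {..0} \<gamma> v)) \<zeta>)))"
proof -
  let ?sol = "twofold_EG_solution \<alpha> \<beta> \<gamma> \<delta>"
  obtain \<Phi> D D' where "eg_data \<Phi> D D' \<alpha> \<beta> \<gamma> \<delta>" using eg_data_exists[OF assms] by blast
  then interpret eg_data \<Phi> D D' \<alpha> \<beta> \<gamma> \<delta> .
  have sol: "adj \<Phi> * (e1 - e2) * \<Phi> = D \<and>
      inj_on (M11 \<alpha> \<beta> \<delta>) (lspace 2 {0..}) \<and> inj_on (M22 \<alpha> \<gamma> \<delta>) (lspace 2 {..0}) \<and>
      l2_invertible {0..} (M11 \<alpha> \<beta> \<delta>) \<and> l2_invertible {..0} (M22 \<alpha> \<gamma> \<delta>) \<and>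
      (\<forall>v. l2_inverse {0..} (M11 \<alpha> \<beta> \<delta>) (coeff_column {0..} \<beta> v) = (\<lambda>j. - coeff_column {0..} g v j)) \<and>
      (\<forall>v. l2_inverse {..0} (M22 \<alpha> \<gamma> \<delta>) (coeff_column {..0} \<gamma> v) = (\<lambda>j. - coeff_column {..0} (\<lambda>\<zeta>. adj_mat (g \<zeta>)) v j)) \<and>
      g \<in> wiener_plus \<and> (\<lambda>\<zeta>. adj_mat (g \<zeta>)) \<in> wiener_minus" if g: "?sol g" for g
  proof -
    have gw: "g \<in> wiener_plus" using g by (simp add: twofold_EG_solution_def)
    then obtain \<Gamma> where \<Gamma>: "symbol_of \<Gamma> g" by (rule symbol_of_exists)
    have EG: "EG (1 + \<Gamma> + adj \<Gamma>)" using g solution_iff_EG[OF \<Gamma>] by simp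
    \<comment> \<open>Only now is (D1) available, and with it the locale in which \<open>M11\<close>
      and \<open>M22\<close> are analyzed.\<close>
    note D1 = EG_imp_D1[OF EG]
    interpret eg_data_D1 \<Phi> D D' \<alpha> \<beta> \<gamma> \<delta> by unfold_locales (rule D1)
    show ?thesis using D1 solution_formulas[OF \<Gamma> EG] gw symbol_of_coeff(3)[OF \<Gamma>] by simp
  qed
  have ex: "\<exists>g. ?sol g" if "adj \<Phi> * (e1 - e2) * \<Phi> = D"
    "inj_on (M11 \<alpha> \<beta> \<delta>) (lspace 2 {0..})" "inj_on (M22 \<alpha> \<gamma> \<delta>) (lspace 2 {..0})"
  proof -
    interpret eg_data_D1 \<Phi> D D' \<alpha> \<beta> \<gamma> \<delta> by unfold_locales (rule that(1))
    show ?thesis using solution_exists that(2,3) by blast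
  qed
  have formula: "g \<zeta> = - inv_fourier {0..} (\<lambda>v. l2_inverse {0..} (M11 \<alpha> \<beta> \<delta>) (coeff_column {0..} \<beta> v)) \<zeta> \<and>
      adj_mat (g \<zeta>) = - inv_fourier {..0} (\<lambda>v. l2_inverse {..0} (M22 \<alpha> \<gamma> \<delta>) (coeff_column {..0} \<gamma> v)) \<zeta>"
    if "?sol g" "\<zeta> \<in> sphere 0 1" for g \<zeta>
    using sol[OF that(1)] inv_fourier_coeff_column[OF _ that(2), of g "{0..}"]
      inv_fourier_coeff_column[OF _ that(2), of "\<lambda>\<zeta>. adj_mat (g \<zeta>)" "{..0}"]
    by simp
  have l1: "l2_inverse {0..} (M11 \<alpha> \<beta> \<delta>) (coeff_column {0..} \<beta> v) \<in> lspace 1 {0..}"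
    "l2_inverse {..0} (M22 \<alpha> \<gamma> \<delta>) (coeff_column {..0} \<gamma> w) \<in> lspace 1 {..0}" if "?sol g" for g v w
    using sol[OF that] coeff_column_lspace1[of g] coeff_column_lspace1[of "\<lambda>\<zeta>. adj_mat (g \<zeta>)"]
    by (simp_all add: wiener_supp_def)
  show ?thesis
  proof (intro conjI impI)
    show "(\<exists>g. ?sol g) \<longleftrightarrow>
       (\<forall>\<zeta>\<in>sphere 0 1.
          adj_mat (\<alpha> \<zeta>) ** \<alpha> \<zeta> - adj_mat (\<gamma> \<zeta>) ** \<gamma> \<zeta> = fourier_coeff \<alpha> 0 \<and>
          adj_mat (\<delta> \<zeta>) ** \<delta> \<zeta> - adj_mat (\<beta> \<zeta>) ** \<beta> \<zeta> = fourier_coeff \<delta> 0 \<and>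
          adj_mat (\<alpha> \<zeta>) ** \<beta> \<zeta> = adj_mat (\<gamma> \<zeta>) ** \<delta> \<zeta>) \<and>
       inj_on (M11 \<alpha> \<beta> \<delta>) (lspace 2 {0..}) \<and> inj_on (M22 \<alpha> \<gamma> \<delta>) (lspace 2 {..0})"
      unfolding D1_iff[symmetric] using sol ex by blast
    assume "\<exists>g. ?sol g"
    then obtain g where g: "?sol g" by blast
    show "l2_invertible {0..} (M11 \<alpha> \<beta> \<delta>)" "l2_invertible {..0} (M22 \<alpha> \<gamma> \<delta>)" using sol[OF g] by simp_all
    show "\<forall>v. l2_inverse {0..} (M11 \<alpha> \<beta> \<delta>) (coeff_column {0..} \<beta> v) \<in> lspace 1 {0..}"
      "\<forall>v. l2_inverse {..0} (M22 \<alpha> \<gamma> \<delta>) (coeff_column {..0} \<gamma> v) \<in> lspace 1 {..0}"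
      using l1[OF g] by blast+
    show "\<exists>g. ?sol g \<and> (\<forall>g'. ?sol g' \<longrightarrow> (\<forall>\<zeta>\<in>sphere 0 1. g' \<zeta> = g \<zeta>)) \<and>
          (\<forall>\<zeta>\<in>sphere 0 1.
             g \<zeta> = - inv_fourier {0..} (\<lambda>v. l2_inverse {0..} (M11 \<alpha> \<beta> \<delta>) (coeff_column {0..} \<beta> v)) \<zeta> \<and>
             adj_mat (g \<zeta>) = - inv_fourier {..0} (\<lambda>v. l2_inverse {..0} (M22 \<alpha> \<gamma> \<delta>) (coeff_column {..0} \<gamma> v)) \<zeta>)"
    proof (intro exI[of _ g] conjI allI impI ballI)
      show "?sol g" by (rule g)
      \<comment> \<open>The right-hand side of the formula depends on the data alone, so two
        solutions agree on the circle.\<close>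
      show "g' \<zeta> = g \<zeta>" if "?sol g'" "\<zeta> \<in> sphere 0 1" for g' \<zeta>
        using formula[OF that] formula[OF g that(2)] by simp
    qed (use formula[OF g] in blast)+
  qed
qed

end
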